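(* For all $a\in\mathcal{M}_2^1\cup\mathcal{M}_2^2\cup\mathcal{M}_2^3$ the map $\mathrm{f}_a:\mathbb{C}/\hat\Gamma_a\to\mathbb{H}$ is a conformal immersion.
   Context: **Potentials.** $\mathbb{C}^d[\lambda]$ denotes the complex polynomials of degree at most $d$, $\mathbb{S}^1$ the unit circle. Let $$\mathcal{P}_2=\left\{\zeta=\begin{pmatrix}\alpha\lambda-\bar\alpha\lambda^2&-\gamma^{-1}+\beta\lambda-\gamma\lambda^2\\ \gamma\lambda-\bar\beta\lambda^2+\gamma^{-1}\lambda^3&-\alpha\lambda+\bar\alpha\lambda^2\end{pmatrix}\;\middle|\;\alpha,\beta\in\mathbb{C},\ \gamma\in\mathbb{R}^+\right\},$$ $$U(\zeta)=\begin{pmatrix}\frac{\alpha-\bar\alpha}{2}&-\gamma^{-1}\lambda^{-1}-\gamma\\ \gamma+\gamma^{-1}\lambda&\frac{\bar\alpha-\alpha}{2}\end{pmatrix},\qquad V(\zeta)=i\begin{pmatrix}\frac{\alpha+\bar\alpha}{2}&-\gamma^{-1}\lambda^{-1}+\gamma\\ \gamma-\gamma^{-1}\lambda&-\frac{\alpha+\bar\alpha}{2}\end{pmatrix}.$$ For each $\zeta_0\in\mathcal{P}_2$ there is a unique $\zeta:\mathbb{R}^2\to\mathcal{P}_2$ with $\zeta(0,0)=\zeta_0$, $\partial_x\zeta=[\zeta,U(\zeta)]$, $\partial_y\zeta=[\zeta,V(\zeta)]$. Its frame $F$ (depending on $\lambda\in\mathbb{C}\setminus\{0\}$) is the $2\times2$-matrix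 solution of $\partial_xF=FU(\zeta)$, $\partial_yF=FV(\zeta)$, $F(0,0)=1$. Identify $(x,y)$ with $z=x+iy\in\mathbb{C}$. Let $\mathcal{M}_2=\{a\in\mathbb{C}^4[\lambda]\mid\lambda a=\det\zeta\text{ for some }\zeta\in\mathcal{P}_2\}$, $I(a)=\{\zeta\in\mathcal{P}_2\mid\det\zeta=\lambda a\}$; $\mathcal{M}_2^1,\mathcal{M}_2^2,\mathcal{M}_2^3$ are the sets of $a\in\mathcal{M}_2$ with, respectively, four distinct simple roots not in $\mathbb{S}^1$; one double root in $\mathbb{S}^1$ and two simple roots not in $\mathbb{S}^1$; two distinct double roots in $\mathbb{S}^1$. **Curve and lattice.** Let $a\in\mathcal{M}_2^1\cup\mathcal{M}_2^2\cup\mathcal{M}_2^3$, $\Sigma^\ast=\{(\lambda,\nu)\in(\mathbb{C}\setminus\{0\})\times\mathbb{C}\mid\nu^2+\lambda a(\lambda)=0\}$, $\sigma:(\lambda,\nu)\mapsto(\lambda,-\nu)$, $\rho:(\lambda,\nu)\mapsto(\bar\lambda^{-1},-\bar\lambda^{-3}\bar\nu)$, $\eta=\sigma\circ\rho$. $\tilde\Gamma_a$ is the lattice of all $\omega=b(0)$ for $b\in\mathbb{C}^3[\lambda]$ with $\bar\lambda^3b(\bar\lambda^{-1})=-\overline{b(\lambda)}$ such that $\frac{b(\lambda)}{2\nu}d\ln\lambda=d\ln\mu_\omega$ for a nowhere vanishing function $\mu_\omega$ on $\Sigma^\ast$ with $\sigma^\ast\mu_\omega=\mu_\omega^{-1}$,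 $\rho^\ast\mu_\omega=\bar\mu_\omega^{-1}$ and $\mu_\omega=f(\lambda)+g(\lambda)\nu$ with $f,g$ holomorphic on $\mathbb{C}\setminus\{0\}$; $\mu_\omega$ is normalized so that $\mu_\omega\exp(-\omega\lambda^{-1}\nu)$ extends holomorphically to $\lambda=0$ with value $1$. Equivalently, $\mu_\omega$ is the eigenvalue of $F(\omega)$ on the eigenspaces of $\zeta_0\in I(a)$. **The points $p_1,\dots,p_4$ and $\hat\Gamma_a$.** Let $q(\lambda)$ be the product of $\lambda-\lambda_0$ over the double roots $\lambda_0$ of $a$ ($q=1$ for $a\in\mathcal{M}_2^1$). Each $\zeta_0\in I(a)$ is divisible by $q$, and $\{(\lambda,\tilde\nu)\mid\lambda\ne0,\ \tilde\nu^2+\lambda a/q^2=0\}$ is the normalization of $\Sigma^\ast$ via $\nu=q\tilde\nu$; the involutions lift to it. The points $p_1,\dots,p_4$ of this normalization satisfy $p_3=\eta(p_1)$, $p_4=\eta(p_2)$ and are: for $a\in\mathcal{M}_2^1$ the four points over the roots of $a$; for $a\in\mathcal{M}_2^2$, $p_1,p_3$ the two points over the double root and $p_2,p_4$ the points over the two simple roots; for $a\in\mathcal{M}_2^3$, $p_1,p_3$ the two points over one double root and $p_2,p_4$ the two points over the other. There are generators $\omega_1,\omega_2$ of $\tilde\Gamma_a$ such that $\mu_j=\mu_{\omega_j}$ satisfy $(\mu_1,\mu_2)=(-1,1)$ at $p_1,p_3$ and $(\mu_1,\mu_2)=(1,-1)$ at $p_2,p_4$. Then $\hat\Gamma_a\subset\tilde\Gamma_a$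 is the sublattice generated by $\hat\omega_1=\omega_1+\omega_2$ and $\hat\omega_2=\omega_2-\omega_1$. **The map.** Let $\mathrm{j}=\begin{pmatrix}0&1\\-1&0\end{pmatrix}$. The quaternions $\mathbb{H}\simeq\mathbb{R}^4$ (with the Euclidean metric) are represented by the complex $2\times2$-matrices $A$ with $\mathrm{j}A=\bar A\mathrm{j}$, i.e. the matrices with columns $(\chi,-\mathrm{j}\bar\chi)$, $\chi\in\mathbb{C}^2$. Choose $\zeta_0\in I(a)$. For $i=1,2$ let $\lambda_i,\tilde\nu_i$ be the coordinates of $p_i$, $\chi_i\in\mathbb{C}^2\setminus\{0\}$ an eigenvector of $(\zeta_0/q)|_{\lambda_i}$ with eigenvalue $\tilde\nu_i$, and $\psi_i(z)=F|_{\lambda_i}^{-1}(z)\chi_i$. Set $s_i=(\psi_i,-\mathrm{j}\bar\psi_i)$ and $\mathrm{f}_a=s_1^{-1}s_2:\mathbb{C}\to\mathbb{H}$. This map is $\hat\Gamma_a$-periodic, and up to translations in $z$ and left and right multiplication by nonzero quaternions it does not depend on the choices of $\zeta_0$ and $\chi_i$. *)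

theory Defs
  imports "HOL-Analysis.Analysis" "HOL-Computational_Algebra.Polynomial"
begin

section \<open>Potentials\<close>

text \<open>
  Matrix polynomials in \<open>\<lambda>\<close> have type \<open>complex poly^2^2\<close>; the Laurent polynomial matrices
  \<open>U(\<zeta>)\<close>, \<open>V(\<zeta>)\<close> are functions of \<open>\<lambda> \<noteq> 0\<close>.
\<close>

definition potential :: "complex \<Rightarrow> complex \<Rightarrow> real \<Rightarrow> complex poly^2^2" where
  "potential \<alpha> \<beta> \<gamma> =
     vector [vector [[:0, \<alpha>, - cnj \<alpha>:],
                     [:- of_real (inverse \<gamma>), \<beta>, - of_real \<gamma>:]],
             vector [[:0, of_real \<gamma>, - cnj \<beta>, of_real (inverse \<gamma>):],
                     [:0, - \<alpha>, cnj \<alpha>:]]]"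

definition P2 :: "(complex poly^2^2) set" where
  "P2 = {potential \<alpha> \<beta> \<gamma> | \<alpha> \<beta> \<gamma>. \<gamma> > 0}"

definition pot_alpha :: "complex poly^2^2 \<Rightarrow> complex" where
  "pot_alpha \<zeta> = coeff (\<zeta> $ 1 $ 1) 1"

definition pot_gamma :: "complex poly^2^2 \<Rightarrow> real" where
  "pot_gamma \<zeta> = Re (coeff (\<zeta> $ 2 $ 1) 1)"

lemma pot_alpha_potential [simp]: "pot_alpha (potential \<alpha> \<beta> \<gamma>) = \<alpha>"
  and pot_gamma_potential [simp]: "pot_gamma (potential \<alpha> \<beta> \<gamma>) = \<gamma>"
  by (simp_all add: pot_alpha_def pot_gamma_def potential_def)

definition U_mat :: "complex poly^2^2 \<Rightarrow> complex \<Rightarrow> complex^2^2" where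
  "U_mat \<zeta> l =
     (let \<alpha> = pot_alpha \<zeta>; \<gamma> = complex_of_real (pot_gamma \<zeta>) in
      vector [vector [(\<alpha> - cnj \<alpha>) / 2, - (inverse \<gamma> * inverse l) - \<gamma>],
              vector [\<gamma> + inverse \<gamma> * l, (cnj \<alpha> - \<alpha>) / 2]])"

definition V_mat :: "complex poly^2^2 \<Rightarrow> complex \<Rightarrow> complex^2^2" where
  "V_mat \<zeta> l =
     (let \<alpha> = pot_alpha \<zeta>; \<gamma> = complex_of_real (pot_gamma \<zeta>) in
      vector [vector [\<i> * ((\<alpha> + cnj \<alpha>) / 2), \<i> * (- (inverse \<gamma> * inverse l) + \<gamma>)],
              vector [\<i> * (\<gamma> - inverse \<gamma> * l), \<i> * (- ((\<alpha> + cnj \<alpha>) / 2))]])"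

definition eval_mat :: "complex poly^2^2 \<Rightarrow> complex \<Rightarrow> complex^2^2" where
  "eval_mat \<zeta> l = (\<chi> i j. poly (\<zeta> $ i $ j) l)"

definition commutator :: "complex^2^2 \<Rightarrow> complex^2^2 \<Rightarrow> complex^2^2" where
  "commutator A B = A ** B - B ** A"

text \<open>
  \<open>\<real>\<^sup>2\<close> is identified with \<open>\<complex>\<close>.  A function \<open>g\<close> on the plane has partial derivatives \<open>gx\<close>, \<open>gy\<close>
  at \<open>z\<close> in the sense of total differentiability.
\<close>

definition has_partials ::
    "(complex \<Rightarrow> 'a::real_normed_vector) \<Rightarrow> 'a \<Rightarrow> 'a \<Rightarrow> complex \<Rightarrow> bool" where
  "has_partials g gx gy z \<longleftrightarrow> (g has_derivative (\<lambda>h. Re h *\<^sub>R gx + Im h *\<^sub>R gy)) (at z)"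

definition is_flow :: "complex poly^2^2 \<Rightarrow> (complex \<Rightarrow> complex poly^2^2) \<Rightarrow> bool" where
  "is_flow \<zeta>0 \<zeta> \<longleftrightarrow>
     \<zeta> 0 = \<zeta>0 \<and> (\<forall>z. \<zeta> z \<in> P2) \<and>
     (\<forall>l z. l \<noteq> 0 \<longrightarrow>
        has_partials (\<lambda>w. eval_mat (\<zeta> w) l)
          (commutator (eval_mat (\<zeta> z) l) (U_mat (\<zeta> z) l))
          (commutator (eval_mat (\<zeta> z) l) (V_mat (\<zeta> z) l)) z)"

definition is_frame ::
    "(complex \<Rightarrow> complex poly^2^2) \<Rightarrow> (complex \<Rightarrow> complex \<Rightarrow> complex^2^2) \<Rightarrow> bool" where
  "is_frame \<zeta> F \<longleftrightarrow>
     (\<forall>l. l \<noteq> 0 \<longrightarrow> F l 0 = mat 1 \<and>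
        (\<forall>z. has_partials (F l) (F l z ** U_mat (\<zeta> z) l) (F l z ** V_mat (\<zeta> z) l) z))"

definition M2 :: "complex poly set" where
  "M2 = {a. degree a \<le> 4 \<and> (\<exists>\<zeta>\<in>P2. [:0, 1:] * a = det \<zeta>)}"

definition I_set :: "complex poly \<Rightarrow> (complex poly^2^2) set" where
  "I_set a = {\<zeta> \<in> P2. det \<zeta> = [:0, 1:] * a}"

definition M21 :: "complex poly set" where
  "M21 = {a \<in> M2. card {x. poly a x = 0} = 4 \<and>
                  (\<forall>x. poly a x = 0 \<longrightarrow> order x a = 1 \<and> x \<notin> sphere 0 1)}"

definition M22 :: "complex poly set" where
  "M22 = {a \<in> M2. \<exists>r s t. distinct [r, s, t] \<and> {x. poly a x = 0} = {r, s, t} \<and>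
                  order r a = 2 \<and> r \<in> sphere 0 1 \<and>
                  order s a = 1 \<and> s \<notin> sphere 0 1 \<and>
                  order t a = 1 \<and> t \<notin> sphere 0 1}"

definition M23 :: "complex poly set" where
  "M23 = {a \<in> M2. \<exists>r s. r \<noteq> s \<and> {x. poly a x = 0} = {r, s} \<and>
                  order r a = 2 \<and> r \<in> sphere 0 1 \<and>
                  order s a = 2 \<and> s \<in> sphere 0 1}"


section \<open>The spectral curve and the lattice of periods\<close>

definition curve :: "complex poly \<Rightarrow> (complex \<times> complex) set" where
  "curve a = {(l, n). l \<noteq> 0 \<and> n\<^sup>2 + l * poly a l = 0}"

definition sigma :: "complex \<times> complex \<Rightarrow> complex \<times> complex" where
  "sigma = (\<lambda>(l, n). (l, - n))"

definition rho :: "complex \<times> complex \<Rightarrow> complex \<times> complex" where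
  "rho = (\<lambda>(l, n). (inverse (cnj l), - (inverse (cnj l) ^ 3 * cnj n)))"

definition eta :: "complex \<times> complex \<Rightarrow> complex \<times> complex" where
  "eta = sigma \<circ> rho"

text \<open>
  The equation \<open>b / (2 \<nu>) dln \<lambda> = dln \<mu>\<close> is imposed on the open dense part \<open>\<nu> \<noteq> 0\<close> of the curve,
  where \<open>\<lambda>\<close> is a local coordinate: along every local holomorphic branch \<open>\<nu> = n(\<lambda>)\<close> of the
  curve, \<open>d\<mu>/d\<lambda> = \<mu> b / (2 \<nu> \<lambda>)\<close>.
\<close>

definition dlog_equation ::
    "complex poly \<Rightarrow> complex poly \<Rightarrow> (complex \<times> complex \<Rightarrow> complex) \<Rightarrow> bool" where
  "dlog_equation a b \<mu> \<longleftrightarrow>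
     (\<forall>S n. open S \<and> n holomorphic_on S \<and> (\<forall>l\<in>S. n l \<noteq> 0 \<and> (l, n l) \<in> curve a) \<longrightarrow>
        (\<forall>l\<in>S. ((\<lambda>t. \<mu> (t, n t)) has_field_derivative
                   \<mu> (l, n l) * (poly b l / (2 * n l * l))) (at l)))"

definition is_multiplier ::
    "complex poly \<Rightarrow> complex poly \<Rightarrow> (complex \<times> complex \<Rightarrow> complex) \<Rightarrow> bool" where
  "is_multiplier a b \<mu> \<longleftrightarrow>
     (\<forall>p\<in>curve a. \<mu> p \<noteq> 0) \<and>
     dlog_equation a b \<mu> \<and>
     (\<forall>p\<in>curve a. \<mu> (sigma p) = inverse (\<mu> p)) \<and>
     (\<forall>p\<in>curve a. \<mu> (rho p) = inverse (cnj (\<mu> p))) \<and>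
     (\<exists>f g. f holomorphic_on (- {0}) \<and> g holomorphic_on (- {0}) \<and>
        (\<forall>(l, n)\<in>curve a. \<mu> (l, n) = f l + g l * n))"

definition admissible_b :: "complex poly \<Rightarrow> bool" where
  "admissible_b b \<longleftrightarrow>
     degree b \<le> 3 \<and> (\<forall>l. l \<noteq> 0 \<longrightarrow> cnj l ^ 3 * poly b (inverse (cnj l)) = - cnj (poly b l))"

definition tilde_lattice :: "complex poly \<Rightarrow> complex set" where
  "tilde_lattice a = {poly b 0 | b. admissible_b b \<and> (\<exists>\<mu>. is_multiplier a b \<mu>)}"

text \<open>
  Since \<open>a(0) \<noteq> 0\<close> on \<open>M2\<close>, the equation \<open>\<nu>\<^sup>2 + \<lambda> a(\<lambda>) = 0\<close> adds the single smooth point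
  \<open>(0, 0)\<close> over \<open>\<lambda> = 0\<close>, at which \<open>\<nu>\<close> is a local coordinate.  Holomorphic extension to this point
  therefore means being a holomorphic function \<open>h\<close> of \<open>\<nu>\<close> near it.
\<close>

definition normalized_at_zero ::
    "complex poly \<Rightarrow> complex \<Rightarrow> (complex \<times> complex \<Rightarrow> complex) \<Rightarrow> bool" where
  "normalized_at_zero a \<omega> \<mu> \<longleftrightarrow>
     (\<exists>r>0. \<exists>h. h holomorphic_on ball 0 r \<and> h 0 = 1 \<and>
        (\<forall>(l, n)\<in>curve a. norm l < r \<and> norm n < r \<longrightarrow>
            \<mu> (l, n) * exp (- \<omega> * inverse l * n) = h n))"

definition is_mu :: "complex poly \<Rightarrow> complex \<Rightarrow> (complex \<times> complex \<Rightarrow> complex) \<Rightarrow> bool" where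
  "is_mu a \<omega> \<mu> \<longleftrightarrow>
     (\<exists>b. admissible_b b \<and> poly b 0 = \<omega> \<and> is_multiplier a b \<mu>) \<and> normalized_at_zero a \<omega> \<mu>"

definition int_span :: "complex \<Rightarrow> complex \<Rightarrow> complex set" where
  "int_span u v = {of_int m * u + of_int n * v | m n :: int. True}"


section \<open>The normalization and the marked points\<close>

definition double_roots :: "complex poly \<Rightarrow> complex set" where
  "double_roots a = {x. poly a x = 0 \<and> order x a = 2}"

definition q_poly :: "complex poly \<Rightarrow> complex poly" where
  "q_poly a = (\<Prod>r\<in>double_roots a. [:- r, 1:])"

definition normalization :: "complex poly \<Rightarrow> (complex \<times> complex) set" where
  "normalization a = {(l, m). l \<noteq> 0 \<and> m\<^sup>2 + l * poly (a div (q_poly a)\<^sup>2) l = 0}"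

definition normalization_map :: "complex poly \<Rightarrow> complex \<times> complex \<Rightarrow> complex \<times> complex" where
  "normalization_map a = (\<lambda>(l, m). (l, poly (q_poly a) l * m))"

text \<open>
  The lift of \<open>\<eta>\<close> multiplies the coordinate \<open>cnj m\<close> in addition by
  \<open>cnj (q(\<lambda>)) / q(1 / cnj \<lambda>)\<close>.  As double roots \<open>r\<close> lie on the unit circle, each factor
  \<open>cnj (\<lambda> - r) / (1 / cnj \<lambda> - r)\<close> is \<open>- cnj \<lambda> * cnj r\<close>, which is also defined at \<open>\<lambda> = r\<close>.
\<close>

definition eta_lift :: "complex poly \<Rightarrow> complex \<times> complex \<Rightarrow> complex \<times> complex" where
  "eta_lift a = (\<lambda>(l, m). (inverse (cnj l),
      inverse (cnj l) ^ 3 * (\<Prod>r\<in>double_roots a. - (cnj l * cnj r)) * cnj m))"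

lemma normalization_map_eta_lift:
  assumes "double_roots a \<subseteq> sphere 0 1" "fst p \<noteq> 0"
  shows "normalization_map a (eta_lift a p) = eta (normalization_map a p)"
proof -
  obtain l m where p: "p = (l, m)" by (cases p)
  with assms(2) have l: "l \<noteq> 0" by simp
  have "(inverse (cnj l) - r) * - (cnj l * cnj r) = cnj (l - r)" if "r \<in> double_roots a" for r
  proof -
    have "r * cnj r = 1"
      using that assms(1) by (auto simp: complex_norm_square[symmetric] simp del: complex_cnj_cnj)
    moreover have "(inverse (cnj l) - r) * - (cnj l * cnj r)
        = - (inverse (cnj l) * cnj l) * cnj r + cnj l * (r * cnj r)"
      by (simp add: algebra_simps)
    ultimately show ?thesis using l by simp
  qed
  then have "poly (q_poly a) (inverse (cnj l)) * (\<Prod>r\<in>double_roots a. - (cnj l * cnj r))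
      = cnj (poly (q_poly a) l)"
    by (simp add: q_poly_def poly_prod prod.distrib[symmetric])
  then show ?thesis
    by (simp add: p normalization_map_def eta_lift_def eta_def sigma_def rho_def mult_ac)
qed

definition marked_points ::
    "complex poly \<Rightarrow> complex \<times> complex \<Rightarrow> complex \<times> complex \<Rightarrow>
       complex \<times> complex \<Rightarrow> complex \<times> complex \<Rightarrow> bool" where
  "marked_points a p1 p2 p3 p4 \<longleftrightarrow>
     p3 = eta_lift a p1 \<and> p4 = eta_lift a p2 \<and>
     (a \<in> M21 \<longrightarrow> {p1, p2, p3, p4} = {p \<in> normalization a. poly a (fst p) = 0}) \<and>
     (a \<in> M22 \<longrightarrow>
        {p1, p3} = {p \<in> normalization a. order (fst p) a = 2} \<and>
        {p2, p4} = {p \<in> normalization a. order (fst p) a = 1}) \<and>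
     (a \<in> M23 \<longrightarrow> (\<exists>r s. r \<noteq> s \<and> double_roots a = {r, s} \<and>
        {p1, p3} = {p \<in> normalization a. fst p = r} \<and>
        {p2, p4} = {p \<in> normalization a. fst p = s}))"

definition is_hat_lattice ::
    "complex poly \<Rightarrow> complex \<times> complex \<Rightarrow> complex \<times> complex \<Rightarrow>
       complex \<times> complex \<Rightarrow> complex \<times> complex \<Rightarrow> complex set \<Rightarrow> bool" where
  "is_hat_lattice a p1 p2 p3 p4 \<Gamma> \<longleftrightarrow>
     (\<exists>\<omega>1 \<omega>2 \<mu>1 \<mu>2.
        tilde_lattice a = int_span \<omega>1 \<omega>2 \<and> is_mu a \<omega>1 \<mu>1 \<and> is_mu a \<omega>2 \<mu>2 \<and>
        (\<forall>p\<in>{p1, p3}. \<mu>1 (normalization_map a p) = -1 \<and> \<mu>2 (normalization_map a p) = 1) \<and>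
        (\<forall>p\<in>{p2, p4}. \<mu>1 (normalization_map a p) = 1 \<and> \<mu>2 (normalization_map a p) = -1) \<and>
        \<Gamma> = int_span (\<omega>1 + \<omega>2) (\<omega>2 - \<omega>1))"


section \<open>Quaternions and the map\<close>

definition jmat :: "complex^2^2" where
  "jmat = vector [vector [0, 1], vector [-1, 0]]"

definition cnj_vec :: "complex^2 \<Rightarrow> complex^2" where
  "cnj_vec v = (\<chi> i. cnj (v $ i))"

definition cnj_mat :: "complex^2^2 \<Rightarrow> complex^2^2" where
  "cnj_mat A = (\<chi> i j. cnj (A $ i $ j))"

definition quaternions :: "(complex^2^2) set" where
  "quaternions = {A. jmat ** A = cnj_mat A ** jmat}"

definition quat :: "complex^2 \<Rightarrow> complex^2^2" where
  "quat v = transpose (vector [v, - (jmat *v cnj_vec v)])"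

text \<open>
  The Euclidean metric of \<open>\<complex>\<^sup>2 \<simeq> \<real>\<^sup>4\<close> on the quaternions is half of the Frobenius inner product, as
  the two columns of a quaternion have the same norm.
\<close>

definition quat_inner :: "complex^2^2 \<Rightarrow> complex^2^2 \<Rightarrow> real" where
  "quat_inner A B = inner A B / 2"

lemma quat_inner_quat: "quat_inner (quat v) (quat w) = inner v w"
  by (simp add: quat_inner_def quat_def jmat_def cnj_vec_def inner_vec_def sum_2 transpose_def
      matrix_vector_mult_def inner_complex_def)

lemma quaternions_eq_range: "quaternions = range quat"
proof
  show "range quat \<subseteq> quaternions"
    by (auto simp: quaternions_def quat_def jmat_def cnj_vec_def cnj_mat_def transpose_def
        matrix_vector_mult_def matrix_matrix_mult_def sum_2 vec_eq_iff forall_2)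
  show "quaternions \<subseteq> range quat"
  proof
    fix A assume "A \<in> quaternions"
    then have A: "jmat ** A = cnj_mat A ** jmat" by (simp add: quaternions_def)
    have "(jmat ** A) $ 1 $ 1 = (cnj_mat A ** jmat) $ 1 $ 1"
      and "(jmat ** A) $ 1 $ 2 = (cnj_mat A ** jmat) $ 1 $ 2"
      by (simp_all only: A)
    then have "A $ 2 $ 1 = - cnj (A $ 1 $ 2)" "A $ 2 $ 2 = cnj (A $ 1 $ 1)"
      by (simp_all add: jmat_def cnj_mat_def matrix_matrix_mult_def sum_2)
    then have "A = quat (vector [A $ 1 $ 1, A $ 2 $ 1])"
      by (simp add: quat_def jmat_def cnj_vec_def transpose_def matrix_vector_mult_def sum_2
          vec_eq_iff forall_2)
    then show "A \<in> range quat" by blast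
  qed
qed

definition divided :: "complex poly^2^2 \<Rightarrow> complex poly \<Rightarrow> complex poly^2^2" where
  "divided \<zeta> q = (\<chi> i j. (\<zeta> $ i $ j) div q)"

definition is_f_map ::
    "complex poly \<Rightarrow> complex \<times> complex \<Rightarrow> complex \<times> complex \<Rightarrow>
       (complex \<Rightarrow> complex^2^2) \<Rightarrow> bool" where
  "is_f_map a p1 p2 f \<longleftrightarrow>
     (\<exists>\<zeta>0 \<zeta> F v1 v2.
        \<zeta>0 \<in> I_set a \<and> is_flow \<zeta>0 \<zeta> \<and> is_frame \<zeta> F \<and>
        v1 \<noteq> 0 \<and> eval_mat (divided \<zeta>0 (q_poly a)) (fst p1) *v v1 = snd p1 *s v1 \<and>
        v2 \<noteq> 0 \<and> eval_mat (divided \<zeta>0 (q_poly a)) (fst p2) *v v2 = snd p2 *s v2 \<and>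
        (\<forall>z. f z = matrix_inv (quat (matrix_inv (F (fst p1) z) *v v1)) **
                    quat (matrix_inv (F (fst p2) z) *v v2)))"


section \<open>Conformal immersions\<close>

primrec C_times :: "nat \<Rightarrow> (complex \<Rightarrow> 'a::real_normed_vector) \<Rightarrow> bool" where
  "C_times 0 g \<longleftrightarrow> continuous_on UNIV g"
| "C_times (Suc k) g \<longleftrightarrow>
     (\<exists>gx gy. (\<forall>z. has_partials g (gx z) (gy z) z) \<and> C_times k gx \<and> C_times k gy)"

definition smooth_map :: "(complex \<Rightarrow> 'a::real_normed_vector) \<Rightarrow> bool" where
  "smooth_map g \<longleftrightarrow> (\<forall>k. C_times k g)"

definition conformal_immersion :: "(complex \<Rightarrow> complex^2^2) \<Rightarrow> bool" where
  "conformal_immersion g \<longleftrightarrow>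
     range g \<subseteq> quaternions \<and> smooth_map g \<and>
     (\<forall>z. \<exists>D. (g has_derivative D) (at z) \<and> inj D \<and>
        (\<exists>c>0. \<forall>u v. quat_inner (D u) (D v) = c * inner u v))"

definition quotient_proj :: "complex set \<Rightarrow> complex \<Rightarrow> complex set" where
  "quotient_proj \<Gamma> z = {w. w - z \<in> \<Gamma>}"

text \<open>
  The charts of \<open>\<complex> / \<Gamma>\<close> are the local inverses of the projection, so a map on \<open>\<complex> / \<Gamma>\<close> is a conformal
  immersion iff its composition with the projection is one.
\<close>

definition conformal_immersion_quotient ::
    "complex set \<Rightarrow> (complex set \<Rightarrow> complex^2^2) \<Rightarrow> bool" where
  "conformal_immersion_quotient \<Gamma> \<phi> \<longleftrightarrow> conformal_immersion (\<phi> \<circ> quotient_proj \<Gamma>)"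

end

theory Submission
  imports Defs "HOL-Complex_Analysis.Conformal_Mappings"
begin

text \<open>
  Write \<open>\<psi>\<^sub>i = F(\<lambda>\<^sub>i)\<^sup>-\<^sup>1 \<chi>\<^sub>i\<close>.  As a function on the plane \<open>\<psi>\<^sub>i\<close> solves \<open>\<partial>\<^sub>x \<psi> = - U \<psi>\<close>,
  \<open>\<partial>\<^sub>y \<psi> = - V \<psi>\<close>, and \<open>f = s\<^sub>1\<^sup>-\<^sup>1 s\<^sub>2\<close> for the quaternions \<open>s\<^sub>i\<close> with first column \<open>\<psi>\<^sub>i\<close>.  Two things
  have to be shown: \<open>f\<close> is a conformal immersion of the plane, and \<open>f\<close> is \<open>\<Gamma>\<close>-periodic.

  \<^bold>\<open>Conformality.\<close>  The part of \<open>U\<close> that does not depend on \<open>\<lambda>\<close> is itself a quaternion \<open>Q\<close>, so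
  \<open>\<partial>\<^sub>x s = - (Q + N) s\<close>, where \<open>N\<close> is a quaternion with components \<open>(A, B)\<close> that depend on \<open>\<lambda>\<close> and on the
  line spanned by \<open>\<psi>\<close>.  The same computation for \<open>V\<close> gives \<open>(\<i> A, - \<i> B)\<close>.  Hence
  \<open>s\<^sub>1 \<partial>\<^sub>x f = (N\<^sub>1 - N\<^sub>2) s\<^sub>2\<close> and \<open>s\<^sub>1 \<partial>\<^sub>y f = (N\<^sub>1' - N\<^sub>2') s\<^sub>2\<close>; since \<open>(a, b)\<close> and \<open>(\<i> a, - \<i> b)\<close> are orthogonal
  of equal length and multiplication by quaternions is conformal, \<open>f\<close> is conformal wherever
  \<open>N\<^sub>1 \<noteq> N\<^sub>2\<close>.  The pair \<open>(A, B)\<close> determines the argument of \<open>\<lambda>\<close> and \<open>\<bar>\<lambda>\<bar> + 1 / \<bar>\<lambda>\<bar>\<close>, hence \<open>\<lambda>\<close> up to the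
  reflection \<open>\<lambda> \<mapsto> 1 / cnj \<lambda>\<close> (\<open>log_derivative_determines_lambda\<close>).  The choice of the marked points
  excludes both coincidences \<open>\<lambda>\<^sub>2 = \<lambda>\<^sub>1\<close> and \<open>\<lambda>\<^sub>2 = 1 / cnj \<lambda>\<^sub>1\<close> (\<open>marked_points_lambda\<close>), so
  \<open>f\<close> is an immersion everywhere (\<open>quotient_conformal\<close>).

  \<^bold>\<open>Periodicity.\<close>  Let \<open>\<mu> = m\<^sub>0 + m\<^sub>1 \<nu>\<close> be the multiplier of \<open>\<omega>\<close>, where \<open>m\<^sub>0\<close> and \<open>m\<^sub>1\<close> are
  holomorphic in \<open>\<lambda> \<noteq> 0\<close>, and let \<open>M = m\<^sub>0 + m\<^sub>1 \<zeta>\<^sub>0\<close>, which acts on the eigenvectors of \<open>\<zeta>\<^sub>0\<close> by \<open>\<mu>\<close>.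
  The claim is \<open>F(z + \<omega>) = \<plusminus> M F(z)\<close> with a sign that does not depend
  on \<open>\<lambda>\<close>.  Consider \<open>C(\<lambda>) = F(z + \<omega>)\<^sup>-\<^sup>1 M F(z)\<close>, which is holomorphic for \<open>\<lambda> \<noteq> 0\<close> because the frame
  depends holomorphically on \<open>\<lambda>\<close> (\<open>linear_ode_holomorphic_parameter\<close>).  Near \<open>\<lambda> = 0\<close> the
  essential singularities cancel: \<open>P = F(z)\<^sup>-\<^sup>1 exp(z \<lambda>\<^sup>-\<^sup>1 \<zeta>\<^sub>0)\<close> solves a linear equation whose coefficient
  \<open>\<lambda>\<^sup>-\<^sup>1 \<zeta> - U\<close> has no pole at \<open>\<lambda> = 0\<close>, so \<open>P\<close> stays bounded (\<open>gauge_bounded\<close>), and the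
  normalization of \<open>\<mu>\<close> says that \<open>M exp(- \<omega> \<lambda>\<^sup>-\<^sup>1 \<zeta>\<^sub>0)\<close> is bounded too.  The reality conditions
  give \<open>C(\<lambda>) C(1 / cnj \<lambda>)\<^sup>* = 1\<close>, so \<open>C\<close> is also bounded near infinity, and Liouville's theorem makes
  it constant.  The constant is unitary and unimodular, and it conjugates \<open>\<zeta>(z)\<close> to \<open>\<zeta>(z + \<omega>)\<close>;
  comparing the values at \<open>\<lambda> = 0\<close> leaves only \<open>C = \<plusminus> 1\<close> (\<open>frame_over_period\<close>).

  At \<open>p\<^sub>1\<close> and \<open>p\<^sub>2\<close> the two multipliers are \<open>\<plusminus> 1\<close> with opposite signs, so \<open>f(z + \<omega>\<^sub>1) = - f(z) = f(z + \<omega>\<^sub>2)\<close>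
  (\<open>antiperiodic\<close>), and the unknown common sign cancels in the quotient.  Therefore \<open>\<omega>\<^sub>1 + \<omega>\<^sub>2\<close>
  and \<open>\<omega>\<^sub>2 - \<omega>\<^sub>1\<close> are periods of \<open>f\<close>.
\<close>

section \<open>Two by two matrices\<close>

definition mat2 :: "complex \<Rightarrow> complex \<Rightarrow> complex \<Rightarrow> complex \<Rightarrow> complex^2^2" where
  "mat2 a b c d = vector [vector [a, b], vector [c, d]]"

lemma mat2_nth [simp]:
  "mat2 a b c d $ 1 $ 1 = a" "mat2 a b c d $ 1 $ 2 = b"
  "mat2 a b c d $ 2 $ 1 = c" "mat2 a b c d $ 2 $ 2 = d"
  by (simp_all add: mat2_def)

definition adj2 :: "complex^2^2 \<Rightarrow> complex^2^2" where
  "adj2 A = mat2 (A $ 2 $ 2) (- A $ 1 $ 2) (- A $ 2 $ 1) (A $ 1 $ 1)"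

definition herm :: "complex^2^2 \<Rightarrow> complex^2^2" where
  "herm A = (\<chi> i j. cnj (A $ j $ i))"

lemma mult_nth [simp]:
  "((A::'a::semiring_1^2^2) ** B) $ i $ j = A $ i $ 1 * B $ 1 $ j + A $ i $ 2 * B $ 2 $ j"
  by (simp add: matrix_matrix_mult_def sum_2)

lemma mult_vec_nth [simp]:
  "((A::'a::semiring_1^2^2) *v x) $ i = A $ i $ 1 * x $ 1 + A $ i $ 2 * x $ 2"
  by (simp add: matrix_vector_mult_def sum_2)

lemma herm_nth [simp]: "herm A $ i $ j = cnj (A $ j $ i)"
  by (simp add: herm_def)

lemma adj2_nth [simp]:
  "adj2 A $ 1 $ 1 = A $ 2 $ 2" "adj2 A $ 1 $ 2 = - A $ 1 $ 2"
  "adj2 A $ 2 $ 1 = - A $ 2 $ 1" "adj2 A $ 2 $ 2 = A $ 1 $ 1"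
  by (simp_all add: adj2_def)

lemma mat_nth [simp]:
  "(mat c :: complex^2^2) $ 1 $ 1 = c" "(mat c :: complex^2^2) $ 1 $ 2 = 0"
  "(mat c :: complex^2^2) $ 2 $ 1 = 0" "(mat c :: complex^2^2) $ 2 $ 2 = c"
  by (simp_all add: mat_def)

lemma eval_mat_nth [simp]: "eval_mat \<zeta> l $ i $ j = poly (\<zeta> $ i $ j) l"
  by (simp add: eval_mat_def)

lemma mat2_eqI:
  fixes A B :: "'a^2^2"
  assumes "A $ 1 $ 1 = B $ 1 $ 1" "A $ 1 $ 2 = B $ 1 $ 2" "A $ 2 $ 1 = B $ 2 $ 1" "A $ 2 $ 2 = B $ 2 $ 2"
  shows "A = B"
  using assms by (simp add: vec_eq_iff forall_2)

lemma vec2_eqI: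
  fixes v w :: "'a^2"
  assumes "v $ 1 = w $ 1" "v $ 2 = w $ 2"
  shows "v = w"
  using assms by (simp add: vec_eq_iff forall_2)

lemma adj2_right: "A ** adj2 A = mat (det A)" and adj2_left: "adj2 A ** A = mat (det A)"
  by (rule mat2_eqI; simp add: det_2 algebra_simps)+

lemma adj2_mult: "adj2 (A ** B) = adj2 B ** adj2 A"
  by (rule mat2_eqI) (simp_all add: algebra_simps)

lemma det_adj2 [simp]: "det (adj2 A) = det A"
  by (simp add: det_2)

lemma herm_mult: "herm (A ** B) = herm B ** herm A"
  by (rule mat2_eqI) (simp_all add: algebra_simps)

lemma adj2_herm: "adj2 (herm A) = herm (adj2 A)"
  by (rule mat2_eqI) simp_all

lemma matrix_inv_2:
  assumes "det (A::complex^2^2) \<noteq> 0"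
  shows "matrix_inv A = mat (inverse (det A)) ** adj2 A"
proof -
  define B where "B = mat (inverse (det A)) ** adj2 A"
  have "A ** B = mat (inverse (det A)) ** mat (det A)"
    unfolding adj2_right[symmetric] B_def by (rule mat2_eqI) (simp_all add: algebra_simps)
  then have AB: "A ** B = mat 1"
    using assms by (simp add: vec_eq_iff forall_2)
  have "B ** A = mat (inverse (det A)) ** mat (det A)"
    by (simp only: B_def adj2_left matrix_mul_assoc[symmetric])
  then have BA: "B ** A = mat 1"
    using assms by (simp add: vec_eq_iff forall_2)
  have inv: "A ** matrix_inv A = mat 1 \<and> matrix_inv A ** A = mat 1"
    unfolding matrix_inv_def using AB BA by (rule_tac someI[of _ B]) simp
  then have "matrix_inv A = matrix_inv A ** (A ** B)" by (simp add: AB)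
  also have "\<dots> = B"
    using inv by (simp add: matrix_mul_assoc)
  finally show ?thesis by (simp add: B_def)
qed

lemma matrix_inv_unimodular: "det (A::complex^2^2) = 1 \<Longrightarrow> matrix_inv A = adj2 A"
  by (simp add: matrix_inv_2)

lemma bounded_linear_euclidean:
  "linear (f :: 'a::euclidean_space \<Rightarrow> 'b::real_normed_vector) \<Longrightarrow> bounded_linear f"
  by (simp add: linear_conv_bounded_linear)

lemma bounded_bilinear_matrix_mult: "bounded_bilinear (\<lambda>(A::complex^2^2) (B::complex^2^2). A ** B)"
  unfolding bilinear_conv_bounded_bilinear[symmetric] bilinear_def
  by (auto intro!: linearI mat2_eqI simp: algebra_simps)

lemma bounded_bilinear_matrix_vec: "bounded_bilinear (\<lambda>(A::complex^2^2) (x::complex^2). A *v x)"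
  unfolding bilinear_conv_bounded_bilinear[symmetric] bilinear_def
  by (auto intro!: linearI vec2_eqI simp: algebra_simps)

lemma bounded_linear_adj2: "bounded_linear adj2"
  by (intro bounded_linear_euclidean linearI mat2_eqI) simp_all

lemma bounded_linear_herm: "bounded_linear herm"
  by (intro bounded_linear_euclidean linearI mat2_eqI) simp_all

lemma bounded_linear_nth2: "bounded_linear (\<lambda>A::complex^2^2. A $ i $ j)"
  by (intro bounded_linear_euclidean linearI) simp_all

lemma quat_nth [simp]:
  "quat v $ 1 $ 1 = v $ 1" "quat v $ 1 $ 2 = - cnj (v $ 2)"
  "quat v $ 2 $ 1 = v $ 2" "quat v $ 2 $ 2 = cnj (v $ 1)"
  by (simp_all add: quat_def transpose_def jmat_def cnj_vec_def)

lemma bounded_linear_quat: "bounded_linear quat"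
  by (intro bounded_linear_euclidean linearI mat2_eqI) simp_all

lemma norm_vec_scalar: "norm (c *s (v::complex^2)) = norm c * norm v"
proof -
  have "norm (c *s v) = sqrt ((norm c)\<^sup>2 * ((norm (v$1))\<^sup>2 + (norm (v$2))\<^sup>2))"
    by (simp add: norm_vec_def L2_set_def sum_2 norm_mult power_mult_distrib algebra_simps)
  also have "\<dots> = norm c * norm v"
    by (simp add: norm_vec_def L2_set_def sum_2 real_sqrt_mult)
  finally show ?thesis .
qed

lemma bounded_linear_vec_scalar: "bounded_linear (\<lambda>v::complex^2. c *s v)"
  by (intro bounded_linear_euclidean linearI vec2_eqI) (simp_all add: algebra_simps)

lemmas mult_minus_left2 = bounded_bilinear.minus_left[OF bounded_bilinear_matrix_mult]
lemmas mult_minus_right2 = bounded_bilinear.minus_right[OF bounded_bilinear_matrix_mult]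
lemmas mult_add_left2 = bounded_bilinear.add_left[OF bounded_bilinear_matrix_mult]
lemmas mult_diff_left2 = bounded_bilinear.diff_left[OF bounded_bilinear_matrix_mult]
lemmas mult_diff_right2 = bounded_bilinear.diff_right[OF bounded_bilinear_matrix_mult]

lemma bounded_linear_mat2:
  "bounded_linear (\<lambda>a. mat2 a 0 0 0)" "bounded_linear (\<lambda>a. mat2 0 a 0 0)"
  "bounded_linear (\<lambda>a. mat2 0 0 a 0)" "bounded_linear (\<lambda>a. mat2 0 0 0 a)"
  by (intro bounded_linear_euclidean linearI mat2_eqI; simp)+

lemma mat2_sum: "mat2 a b c d = mat2 a 0 0 0 + mat2 0 b 0 0 + mat2 0 0 c 0 + mat2 0 0 0 d"
  by (rule mat2_eqI) simp_all

lemma continuous_on_mat2: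
  assumes "continuous_on S a" "continuous_on S b" "continuous_on S c" "continuous_on S d"
  shows "continuous_on S (\<lambda>s. mat2 (a s) (b s) (c s) (d s))"
  by (subst ext[OF mat2_sum])
    (intro continuous_on_add bounded_linear.continuous_on[OF bounded_linear_mat2(1)]
      bounded_linear.continuous_on[OF bounded_linear_mat2(2)]
      bounded_linear.continuous_on[OF bounded_linear_mat2(3)]
      bounded_linear.continuous_on[OF bounded_linear_mat2(4)] assms)

lemma bounded_linear_mat: "bounded_linear (mat :: complex \<Rightarrow> complex^2^2)"
  by (intro bounded_linear_euclidean linearI mat2_eqI) simp_all

section \<open>Partial derivatives and smoothness\<close>

lemma has_partials_const: "has_partials (\<lambda>w. c) 0 0 z"
  by (simp add: has_partials_def)

lemma has_partials_linear:
  assumes "bounded_linear T" "has_partials g gx gy z"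
  shows "has_partials (\<lambda>w. T (g w)) (T gx) (T gy) z"
proof -
  interpret bounded_linear T by fact
  show ?thesis
    using has_derivative[OF assms(2)[unfolded has_partials_def]]
    by (simp add: has_partials_def add scaleR)
qed

lemma has_partials_add:
  assumes "has_partials g gx gy z" "has_partials h hx hy z"
  shows "has_partials (\<lambda>w. g w + h w) (gx + hx) (gy + hy) z"
  using has_derivative_add[OF assms[unfolded has_partials_def]]
  by (simp add: has_partials_def algebra_simps)

lemma has_partials_bilinear:
  assumes "bounded_bilinear B" "has_partials g gx gy z" "has_partials h hx hy z"
  shows "has_partials (\<lambda>w. B (g w) (h w))
           (B (g z) hx + B gx (h z)) (B (g z) hy + B gy (h z)) z"
proof -
  interpret bounded_bilinear B by fact
  show ?thesis
    using FDERIV[OF assms(2,3)[unfolded has_partials_def]]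
    by (simp add: has_partials_def add_left add_right scaleR_left scaleR_right algebra_simps)
qed

lemma has_partials_inverse:
  fixes g :: "complex \<Rightarrow> complex"
  assumes "has_partials g gx gy z" "g z \<noteq> 0"
  shows "has_partials (\<lambda>w. inverse (g w)) (- (inverse (g z) * gx * inverse (g z)))
           (- (inverse (g z) * gy * inverse (g z))) z"
  using Deriv.has_derivative_inverse[OF assms(2) assms(1)[unfolded has_partials_def]]
  by (simp add: has_partials_def algebra_simps scaleR_conv_of_real)

lemma has_partials_unique:
  assumes "has_partials g gx gy z" "has_partials g gx' gy' z"
  shows "gx = gx'" "gy = gy'"
proof -
  have "(\<lambda>h. Re h *\<^sub>R gx + Im h *\<^sub>R gy) = (\<lambda>h. Re h *\<^sub>R gx' + Im h *\<^sub>R gy')"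
    using assms unfolding has_partials_def by (rule has_derivative_unique)
  from fun_cong[OF this, of 1] fun_cong[OF this, of \<i>] show "gx = gx'" "gy = gy'" by simp_all
qed

text \<open>
  All conservation laws of the frame below (unimodularity, unitarity, conjugation of the potential)
  have this form.
\<close>

lemma has_partials_zero_imp_const:
  assumes "\<And>z. has_partials g 0 0 z"
  shows "g z = g 0"
proof -
  have "(g has_derivative (\<lambda>h. 0)) (at z within UNIV)" for z
    using assms[of z] by (simp add: has_partials_def)
  then obtain c where "\<And>z. g z = c"
    using has_derivative_zero_constant[of UNIV g] by auto
  then show ?thesis by simp
qed

lemma has_partials_ray:
  assumes "has_partials g gx gy (of_real t * w)"
  shows "((\<lambda>t. g (of_real t * w)) has_vector_derivative (Re w *\<^sub>R gx + Im w *\<^sub>R gy)) (at t)"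
proof -
  have "((\<lambda>t. of_real t * w) has_derivative (\<lambda>h. of_real h * w)) (at t)"
    by (auto intro!: derivative_eq_intros)
  then have "((\<lambda>t. g (of_real t * w)) has_derivative
      (\<lambda>h. Re (of_real h * w) *\<^sub>R gx + Im (of_real h * w) *\<^sub>R gy)) (at t)"
    using assms unfolding has_partials_def by (rule has_derivative_compose)
  then show ?thesis
    by (simp add: has_vector_derivative_def algebra_simps)
qed

lemma has_partials_imp_continuous: "(\<And>z. has_partials g (gx z) (gy z) z) \<Longrightarrow> continuous_on UNIV g"
  unfolding has_partials_def
  by (meson continuous_at_imp_continuous_on has_derivative_continuous)

lemma C_times_SucI:
  "(\<And>z. has_partials g (gx z) (gy z) z) \<Longrightarrow> C_times k gx \<Longrightarrow> C_times k gy \<Longrightarrow> C_times (Suc k) g"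
  by auto

lemma C_times_SucE:
  assumes "C_times (Suc k) g"
  obtains gx gy where "\<And>z. has_partials g (gx z) (gy z) z" "C_times k gx" "C_times k gy"
  using assms by auto

text \<open>
  \<open>C_times (Suc k) g\<close> speaks about the derivatives of \<open>g\<close>; the product rule also contains \<open>g\<close> itself as a
  factor, for which this lemma provides the induction hypothesis.
\<close>

lemma C_times_decrease: "C_times (Suc k) g \<Longrightarrow> C_times k g"
proof (induction k arbitrary: g)
  case 0
  then show ?case by (auto intro: has_partials_imp_continuous)
next
  case (Suc k)
  from Suc.prems obtain gx gy where "\<And>z. has_partials g (gx z) (gy z) z"
    "C_times (Suc k) gx" "C_times (Suc k) gy"
    by (metis C_times_SucE)
  with Suc.IH show ?case
    by (blast intro: C_times_SucI)
qed

lemma C_times_const: "C_times k (\<lambda>w. c)"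
proof (induction k arbitrary: c)
  case (Suc k)
  then show ?case by (intro C_times_SucI[OF has_partials_const])
qed simp

lemma C_times_linear: "bounded_linear T \<Longrightarrow> C_times k g \<Longrightarrow> C_times k (\<lambda>w. T (g w))"
proof (induction k arbitrary: g)
  case 0
  then show ?case by (auto intro: bounded_linear.continuous_on)
next
  case (Suc k)
  from Suc.prems obtain gx gy where "\<And>z. has_partials g (gx z) (gy z) z"
    "C_times k gx" "C_times k gy"
    by auto
  with Suc show ?case
    by (intro C_times_SucI[OF has_partials_linear]) auto
qed

lemma C_times_add: "C_times k g \<Longrightarrow> C_times k h \<Longrightarrow> C_times k (\<lambda>w. g w + h w)"
proof (induction k arbitrary: g h)
  case 0
  then show ?case by (auto intro: continuous_on_add)
next
  case (Suc k)
  from Suc.prems obtain gx gy hx hy where "\<And>z. has_partials g (gx z) (gy z) z"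
    "\<And>z. has_partials h (hx z) (hy z) z"
    "C_times k gx" "C_times k gy" "C_times k hx" "C_times k hy"
    by auto
  with Suc.IH show ?case
    by (intro C_times_SucI[OF has_partials_add])
qed

lemma C_times_bilinear:
  assumes "bounded_bilinear B"
  shows "C_times k g \<Longrightarrow> C_times k h \<Longrightarrow> C_times k (\<lambda>w. B (g w) (h w))"
proof (induction k arbitrary: g h)
  case 0
  then show ?case using bounded_bilinear.continuous_on[OF assms] by auto
next
  case (Suc k)
  from Suc.prems obtain gx gy hx hy where d: "\<And>z. has_partials g (gx z) (gy z) z"
    "\<And>z. has_partials h (hx z) (hy z) z" and
    c: "C_times k gx" "C_times k gy" "C_times k hx" "C_times k hy"
    by auto
  have "C_times k g" "C_times k h"
    using Suc.prems by (auto intro: C_times_decrease simp del: C_times.simps)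
  with c have "C_times k (\<lambda>z. B (g z) (hx z) + B (gx z) (h z))"
    "C_times k (\<lambda>z. B (g z) (hy z) + B (gy z) (h z))"
    by (auto intro!: C_times_add Suc.IH)
  then show ?case
    by (rule C_times_SucI[OF has_partials_bilinear[OF assms d]])
qed

lemma C_times_inverse:
  fixes g :: "complex \<Rightarrow> complex"
  assumes nz: "\<And>z. g z \<noteq> 0"
  shows "C_times k g \<Longrightarrow> C_times k (\<lambda>w. inverse (g w))"
proof (induction k)
  case 0
  then show ?case using nz by (auto intro: continuous_on_inverse)
next
  case (Suc k)
  from Suc.prems obtain gx gy where d: "\<And>z. has_partials g (gx z) (gy z) z" and
    c: "C_times k gx" "C_times k gy"
    by auto
  have "C_times k (\<lambda>w. inverse (g w))"
    using Suc by (auto intro: C_times_decrease simp del: C_times.simps)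
  with c have "C_times k (\<lambda>z. - (inverse (g z) * gx z * inverse (g z)))"
    "C_times k (\<lambda>z. - (inverse (g z) * gy z * inverse (g z)))"
    by (auto intro!: C_times_linear[OF bounded_linear_minus[OF bounded_linear_ident]]
        C_times_bilinear[OF bounded_bilinear_mult])
  then show ?case
    by (rule C_times_SucI[OF has_partials_inverse[OF d nz]])
qed

lemma C_times_diff: "C_times k g \<Longrightarrow> C_times k h \<Longrightarrow> C_times k (\<lambda>w. g w - h w)"
  using C_times_add[OF _ C_times_linear[OF bounded_linear_minus[OF bounded_linear_ident]], of k g h]
  by simp

lemma C_times_minus: "C_times k g \<Longrightarrow> C_times k (\<lambda>w. - g w)"
  by (rule C_times_linear[OF bounded_linear_minus[OF bounded_linear_ident]])

lemma C_times_cnj: "C_times k g \<Longrightarrow> C_times k (\<lambda>w. cnj (g w))"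
  by (rule C_times_linear[OF bounded_linear_cnj])

lemma C_times_mult: "C_times k g \<Longrightarrow> C_times k h \<Longrightarrow> C_times k (\<lambda>w. g w * h w :: complex)"
  by (rule C_times_bilinear[OF bounded_bilinear_mult])

lemma C_times_mat2:
  assumes "C_times k a" "C_times k b" "C_times k c" "C_times k d"
  shows "C_times k (\<lambda>s. mat2 (a s) (b s) (c s) (d s))"
  by (subst ext[OF mat2_sum])
    (intro C_times_add C_times_linear[OF bounded_linear_mat2(1)]
      C_times_linear[OF bounded_linear_mat2(2)] C_times_linear[OF bounded_linear_mat2(3)]
      C_times_linear[OF bounded_linear_mat2(4)] assms)

section \<open>Linear differential equations\<close>

text \<open>
  The constant \<open>\<delta>\<^sup>2\<close> is added to \<open>\<bar>y\<bar>\<^sup>2\<close> because \<open>2 \<delta> \<bar>y\<bar> \<le> \<bar>y\<bar>\<^sup>2 + \<delta>\<^sup>2\<close> then absorbs the inhomogeneous term.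
  In this way one estimate covers the homogeneous equation (\<open>\<delta> = 0\<close>) and the inhomogeneous one with
  zero initial value.
\<close>

lemma gronwall:
  fixes y y' :: "real \<Rightarrow> 'a::real_inner"
  assumes d: "\<And>t. t \<in> {0..1} \<Longrightarrow> (y has_vector_derivative y' t) (at t)"
    and b: "\<And>t. t \<in> {0..1} \<Longrightarrow> norm (y' t) \<le> K * norm (y t) + \<delta>"
    and K: "0 \<le> K" and t: "t \<in> {0..1}"
  shows "(norm (y t))\<^sup>2 + \<delta>\<^sup>2 \<le> exp (2 * K + 1) * ((norm (y 0))\<^sup>2 + \<delta>\<^sup>2)"
proof -
  define \<phi> where "\<phi> s = (inner (y s) (y s) + \<delta>\<^sup>2) * exp (- ((2 * K + 1) * s))" for s
  have "\<exists>D. (\<phi> has_real_derivative D) (at s) \<and> D \<le> 0" if "0 \<le> s" "s \<le> t" for s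
  proof -
    have s: "s \<in> {0..1}" using that t by simp
    let ?D = "(2 * inner (y s) (y' s) - (2 * K + 1) * (inner (y s) (y s) + \<delta>\<^sup>2))
        * exp (- ((2 * K + 1) * s))"
    have yd: "(y has_derivative (\<lambda>h. h *\<^sub>R y' s)) (at s)"
      using d[OF s] by (simp add: has_vector_derivative_def)
    have "((\<lambda>s. inner (y s) (y s)) has_derivative
        (\<lambda>h. inner (y s) (h *\<^sub>R y' s) + inner (h *\<^sub>R y' s) (y s))) (at s)"
      by (rule has_derivative_inner[OF yd yd])
    then have "((\<lambda>s. inner (y s) (y s)) has_real_derivative (2 * inner (y s) (y' s))) (at s)"
      by (rule has_derivative_imp_has_field_derivative) (simp add: inner_commute algebra_simps)
    then have 1: "(\<phi> has_real_derivative ?D) (at s)"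
      unfolding \<phi>_def by (auto intro!: derivative_eq_intros simp: algebra_simps)
    have "2 * inner (y s) (y' s) \<le> 2 * (norm (y s) * norm (y' s))"
      using norm_cauchy_schwarz[of "y s" "y' s"] by simp
    also have "\<dots> \<le> 2 * (norm (y s) * (K * norm (y s) + \<delta>))"
      using b[OF s] by (simp add: mult_left_mono)
    also have "\<dots> = 2 * K * (norm (y s))\<^sup>2 + 2 * norm (y s) * \<delta>"
      by (simp add: algebra_simps power2_eq_square)
    also have "\<dots> \<le> 2 * K * (norm (y s))\<^sup>2 + ((norm (y s))\<^sup>2 + \<delta>\<^sup>2)"
      using sum_squares_bound[of "norm (y s)" \<delta>] by simp
    also have "\<dots> \<le> (2 * K + 1) * (inner (y s) (y s) + \<delta>\<^sup>2)"
      using K by (simp add: dot_square_norm algebra_simps)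
    finally have "?D \<le> 0" by (simp add: mult_nonpos_nonneg)
    with 1 show ?thesis by blast
  qed
  then have "\<phi> t \<le> \<phi> 0"
    using DERIV_nonpos_imp_nonincreasing[of 0 t \<phi>] t by simp
  then have "((norm (y t))\<^sup>2 + \<delta>\<^sup>2) / exp ((2 * K + 1) * t) \<le> (norm (y 0))\<^sup>2 + \<delta>\<^sup>2"
    by (simp add: \<phi>_def dot_square_norm exp_minus divide_inverse)
  then have "(norm (y t))\<^sup>2 + \<delta>\<^sup>2 \<le> exp ((2 * K + 1) * t) * ((norm (y 0))\<^sup>2 + \<delta>\<^sup>2)"
    by (simp add: divide_le_eq mult.commute)
  also have "\<dots> \<le> exp (2 * K + 1) * ((norm (y 0))\<^sup>2 + \<delta>\<^sup>2)"
  proof -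
    have "(2 * K + 1) * t \<le> 2 * K + 1"
      using t K by (intro mult_left_le) simp_all
    then show ?thesis by (intro mult_right_mono) simp_all
  qed
  finally show ?thesis .
qed

corollary gronwall_homogeneous:
  fixes y y' :: "real \<Rightarrow> 'a::real_inner"
  assumes "\<And>t. t \<in> {0..1} \<Longrightarrow> (y has_vector_derivative y' t) (at t)"
    and "\<And>t. t \<in> {0..1} \<Longrightarrow> norm (y' t) \<le> K * norm (y t)"
    and "0 \<le> K" and "t \<in> {0..1}"
  shows "norm (y t) \<le> exp (K + 1 / 2) * norm (y 0)"
proof -
  have "(norm (y t))\<^sup>2 \<le> exp (2 * K + 1) * (norm (y 0))\<^sup>2"
    using gronwall[of y y' K 0 t] assms by simp
  also have "\<dots> = (exp (K + 1 / 2) * norm (y 0))\<^sup>2"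
    by (simp add: power_mult_distrib exp_double[symmetric] algebra_simps)
  finally show ?thesis by (rule power2_le_imp_le) simp
qed

corollary gronwall_inhomogeneous:
  fixes y y' :: "real \<Rightarrow> 'a::real_inner"
  assumes "\<And>t. t \<in> {0..1} \<Longrightarrow> (y has_vector_derivative y' t) (at t)"
    and "\<And>t. t \<in> {0..1} \<Longrightarrow> norm (y' t) \<le> K * norm (y t) + \<delta>"
    and "0 \<le> K" and "0 \<le> \<delta>" and "y 0 = 0" and "t \<in> {0..1}"
  shows "norm (y t) \<le> exp (K + 1 / 2) * \<delta>"
proof -
  have "(norm (y t))\<^sup>2 \<le> exp (2 * K + 1) * \<delta>\<^sup>2"
    using gronwall[of y y' K \<delta> t] assms by (smt (verit) norm_zero zero_le_power2 zero_power2)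
  also have "\<dots> = (exp (K + 1 / 2) * \<delta>)\<^sup>2"
    by (simp add: power_mult_distrib exp_double[symmetric] algebra_simps)
  finally show ?thesis by (rule power2_le_imp_le) (simp add: assms)
qed

lemma cauchy_criterion_at:
  fixes f :: "complex \<Rightarrow> complex"
  assumes r: "r > 0"
    and b: "\<And>l m. l \<in> ball l0 r - {l0} \<Longrightarrow> m \<in> ball l0 r - {l0} \<Longrightarrow>
              norm (f l - f m) \<le> c * (norm (l - l0) + norm (m - l0))"
  shows "\<exists>L. (f \<longlongrightarrow> L) (at l0)"
proof -
  have "\<exists>P. eventually P (at l0) \<and> (\<forall>l m. P l \<and> P m \<longrightarrow> dist (f l) (f m) < e)" if e: "e > 0" for e
  proof -
    define d where "d = min r (e / (2 * (\<bar>c\<bar> + 1)))"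
    have d: "d > 0" "d \<le> r" "d \<le> e / (2 * (\<bar>c\<bar> + 1))" using r e by (auto simp: d_def)
    have "dist (f l) (f m) < e" if "l \<in> ball l0 d - {l0}" "m \<in> ball l0 d - {l0}" for l m
    proof -
      have "dist (f l) (f m) \<le> c * (norm (l - l0) + norm (m - l0))"
        using b[of l m] that d by (auto simp: dist_norm)
      also have "\<dots> \<le> (\<bar>c\<bar> + 1) * (norm (l - l0) + norm (m - l0))"
        by (intro mult_right_mono) auto
      also have "\<dots> < (\<bar>c\<bar> + 1) * (2 * d)"
        using that by (intro mult_strict_left_mono) (auto simp: dist_norm norm_minus_commute)
      also have "\<dots> \<le> e"
        using d(3) by (simp add: field_simps)
      finally show ?thesis .
    qed
    moreover have "eventually (\<lambda>l. l \<in> ball l0 d - {l0}) (at l0)"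
      using d(1) by (auto simp: eventually_at dist_commute)
    ultimately show ?thesis by blast
  qed
  then have "cauchy_filter (filtermap f (at l0))"
    by (simp add: cauchy_filter_metric_filtermap)
  then obtain L where "filtermap f (at l0) \<le> nhds L"
    using complete_UNIV[unfolded complete_uniform, rule_format, of "filtermap f (at l0)"]
    by (auto simp: filtermap_bot_iff)
  then show ?thesis by (auto simp: filterlim_def)
qed

text \<open>
  The coefficient is a Laurent polynomial in the parameter \<open>l\<close>.  The difference quotients
  \<open>D l = (y l - y l0) / (l - l0)\<close> solve a linear equation with zero initial value whose forcing term is
  bounded, and the difference of two of them solves one whose forcing term is
  \<open>O(\<bar>l - l0\<bar> + \<bar>m - l0\<bar>)\<close>.  By Gronwall's inequality they satisfy the Cauchy criterion as
  \<open>l \<rightarrow> l0\<close>, so the derivative exists.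
\<close>

lemma linear_ode_holomorphic_parameter:
  fixes y :: "complex \<Rightarrow> real \<Rightarrow> complex^2" and A0 A1 A2 :: "real \<Rightarrow> complex^2^2"
  assumes ode: "\<And>l t. l \<noteq> 0 \<Longrightarrow> t \<in> {0..1} \<Longrightarrow>
      (y l has_vector_derivative
        (A0 t *v y l t + l *s (A1 t *v y l t) + inverse l *s (A2 t *v y l t))) (at t)"
    and init: "\<And>l. l \<noteq> 0 \<Longrightarrow> y l 0 = y0"
    and K: "0 \<le> K"
    and bound: "\<And>t x. t \<in> {0..1} \<Longrightarrow> norm (A0 t *v x) \<le> K * norm x"
      "\<And>t x. t \<in> {0..1} \<Longrightarrow> norm (A1 t *v x) \<le> K * norm x"
      "\<And>t x. t \<in> {0..1} \<Longrightarrow> norm (A2 t *v x) \<le> K * norm x"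
  shows "(\<lambda>l. y l 1 $ i) holomorphic_on - {0}"
proof -
  have "\<exists>d. ((\<lambda>l. y l 1 $ i) has_field_derivative d) (at l0)" if l0: "l0 \<noteq> 0" for l0
  proof -
    define R where "R = norm l0"
    define S where "S = ball l0 (R / 2)"
    have R: "R > 0" using l0 by (simp add: R_def)
    have S: "l \<noteq> 0" "norm l \<le> 2 * R" "norm (inverse l) \<le> 2 / R" if "l \<in> S" for l
    proof -
      have "norm (l0 - l) < R / 2" using that by (simp add: S_def dist_norm)
      then have "norm l \<ge> R / 2" and "norm l \<le> 2 * R"
        using norm_triangle_ineq2[of l0 l] norm_triangle_ineq2[of l l0] R
        by (auto simp: R_def norm_minus_commute)
      then show "norm l \<le> 2 * R" "norm (inverse l) \<le> 2 / R"
        using le_imp_inverse_le[of "R / 2" "norm l"] R by (auto simp: norm_inverse)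
      show "l \<noteq> 0" using \<open>norm l \<ge> R / 2\<close> R by auto
    qed
    have l0S: "l0 \<in> S" using R by (simp add: S_def)
    define A where "A l t x = A0 t *v x + l *s (A1 t *v x) + inverse l *s (A2 t *v x)" for l t x
    define B where "B l t x = A1 t *v x - (inverse l * inverse l0) *s (A2 t *v x)" for l t x
    have A_diff: "A l t x - A l t y = A l t (x - y)" for l t x y
      by (rule vec2_eqI) (simp_all add: A_def algebra_simps)
    have A_scale: "c *s A l t x = A l t (c *s x)" for c l t x
      by (rule vec2_eqI) (simp_all add: A_def algebra_simps)
    have B_diff: "B l t x - B l t y = B l t (x - y)" for l t x y
      by (rule vec2_eqI) (simp_all add: B_def algebra_simps)
    \<comment> \<open>\<open>B\<close> is the divided difference of \<open>A\<close>, in a form without the small denominator \<open>l - l0\<close>.\<close>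
    have A_B: "A l t x - A l0 t x = (l - l0) *s B l t x" if "l \<noteq> 0" for l t x
    proof -
      have inv: "inverse l - inverse l0 = - ((l - l0) * (inverse l * inverse l0))"
        using that l0 by (simp add: field_simps)
      have "A l t x - A l0 t x = (l - l0) *s (A1 t *v x) + (inverse l - inverse l0) *s (A2 t *v x)"
        by (rule vec2_eqI) (simp_all add: A_def algebra_simps)
      also have "\<dots> = (l - l0) *s B l t x"
        unfolding inv by (rule vec2_eqI) (simp_all add: B_def algebra_simps)
      finally show ?thesis .
    qed
    define L where "L = K + 2 * R * K + 2 / R * K"
    define M where "M = K + (2 / R) * (2 / R) * K"
    have L: "0 \<le> L" and M: "0 \<le> M" using K R by (simp_all add: L_def M_def)
    have A_le: "norm (A l t x) \<le> L * norm x" if "l \<in> S" "t \<in> {0..1}" for l t x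
    proof -
      have "norm (A l t x) \<le> norm (A0 t *v x) + norm l * norm (A1 t *v x)
          + norm (inverse l) * norm (A2 t *v x)"
        unfolding A_def by (intro norm_triangle_le add_mono) (simp_all add: norm_vec_scalar)
      also have "\<dots> \<le> K * norm x + (2 * R) * (K * norm x) + (2 / R) * (K * norm x)"
        using S[OF that(1)] bound[OF that(2)] R by (intro add_mono mult_mono) auto
      finally show ?thesis by (simp add: L_def algebra_simps)
    qed
    have il0: "norm (inverse l0) \<le> 2 / R" using S[OF l0S] by simp
    have B_le: "norm (B l t x) \<le> M * norm x" if "l \<in> S" "t \<in> {0..1}" for l t x
    proof -
      have "norm (B l t x) \<le> norm (A1 t *v x) + norm (inverse l) * norm (inverse l0) * norm (A2 t *v x)"
        unfolding B_def
        by (rule order_trans[OF norm_triangle_ineq4]) (simp add: norm_vec_scalar norm_mult)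
      also have "\<dots> \<le> K * norm x + (2 / R) * (2 / R) * (K * norm x)"
        using S[OF that(1)] il0 bound[OF that(2)] R by (intro add_mono mult_mono) auto
      finally show ?thesis by (simp add: M_def algebra_simps)
    qed
    define G where "G = exp (L + 1 / 2)"
    have G: "G > 0" by (simp add: G_def)
    have yd: "(y l has_vector_derivative A l t (y l t)) (at t)" if "l \<in> S" "t \<in> {0..1}" for l t
      using ode[of l t] S(1)[of l] that by (simp add: A_def)
    define C where "C = G * norm y0"
    have C: "0 \<le> C" using G by (simp add: C_def)
    have y_le: "norm (y l t) \<le> C" if "l \<in> S" "t \<in> {0..1}" for l t
      unfolding C_def G_def init[OF S(1)[OF that(1)], symmetric]
      by (rule gronwall_homogeneous[OF yd A_le]) (use that L in auto)
    define D where "D l t = inverse (l - l0) *s (y l t - y l0 t)" for l t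
    have Dd: "(D l has_vector_derivative A l0 t (D l t) + B l t (y l t)) (at t)"
      if "l \<in> S - {l0}" "t \<in> {0..1}" for l t
    proof -
      have pull: "inverse (l - l0) *s ((l - l0) *s u + v) = inverse (l - l0) *s v + u"
        for u v :: "complex^2"
      proof -
        have "inverse (l - l0) * (l - l0) = 1" using that by simp
        then show ?thesis
          by (simp only: vector_add_ldistrib vector_smult_assoc vector_smult_lid add.commute)
      qed
      have "A l t (y l t) - A l0 t (y l0 t)
          = (A l t (y l t) - A l0 t (y l t)) + (A l0 t (y l t) - A l0 t (y l0 t))"
        by simp
      also have "\<dots> = (l - l0) *s B l t (y l t) + A l0 t (y l t - y l0 t)"
        using A_B[OF S(1)[of l]] that by (simp add: A_diff)
      finally have "inverse (l - l0) *s (A l t (y l t) - A l0 t (y l0 t))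
          = A l0 t (D l t) + B l t (y l t)"
        by (simp only: pull D_def A_scale)
      moreover have "(D l has_vector_derivative
          inverse (l - l0) *s (A l t (y l t) - A l0 t (y l0 t))) (at t)"
        unfolding D_def using that l0S
        by (intro bounded_linear.has_vector_derivative[OF bounded_linear_vec_scalar]
            has_vector_derivative_diff yd) auto
      ultimately show ?thesis by (simp only:)
    qed
    define E where "E = G * (M * C)"
    have E: "0 \<le> E" using G M C by (simp add: E_def)
    have D_le: "norm (D l t) \<le> E" if "l \<in> S - {l0}" "t \<in> {0..1}" for l t
      unfolding E_def G_def
    proof (rule gronwall_inhomogeneous[OF Dd[OF that(1)]])
      fix s :: real assume s: "s \<in> {0..1}"
      have "norm (A l0 s (D l s) + B l s (y l s)) \<le> L * norm (D l s) + M * norm (y l s)"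
        using that s l0S by (intro norm_triangle_le add_mono A_le B_le) auto
      also have "\<dots> \<le> L * norm (D l s) + M * C"
        using y_le[of l s] that s M by (simp add: mult_left_mono)
      finally show "norm (A l0 s (D l s) + B l s (y l s)) \<le> L * norm (D l s) + M * C" .
    qed (use that L M C S(1) l0 in \<open>auto simp: D_def init\<close>)
    have y_diff: "norm (y l t - y l0 t) \<le> E * norm (l - l0)" if "l \<in> S - {l0}" "t \<in> {0..1}" for l t
    proof -
      have "y l t - y l0 t = (l - l0) *s D l t"
        using that by (simp add: D_def vec_eq_iff)
      then show ?thesis
        using D_le[OF that]
        by (simp only: norm_vec_scalar mult.commute[of E]) (simp add: mult_left_mono)
    qed
    define N where "N = M * E + (2 / R) * (2 / R) * (2 / R) * (K * C)"
    have N: "0 \<le> N" using M E K C R by (simp add: N_def)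
    have forcing: "norm (B l t (y l t) - B m t (y m t)) \<le> N * (norm (l - l0) + norm (m - l0))"
      if l: "l \<in> S - {l0}" and m: "m \<in> S - {l0}" and t: "t \<in> {0..1}" for l m t
    proof -
      let ?d = "norm (l - l0) + norm (m - l0)"
      have "norm (y l t - y m t) \<le> norm (y l t - y l0 t) + norm (y m t - y l0 t)"
        by norm
      also have "\<dots> \<le> E * ?d"
        using y_diff[OF l t] y_diff[OF m t] by (simp add: distrib_left)
      finally have 1: "norm (y l t - y m t) \<le> E * ?d" .
      have "norm (B l t (y l t - y m t)) \<le> M * norm (y l t - y m t)"
        using l t by (intro B_le) auto
      also have "\<dots> \<le> M * (E * ?d)"
        using 1 M by (rule mult_left_mono)
      finally have 2: "norm (B l t (y l t - y m t)) \<le> M * E * ?d" by (simp add: mult.assoc)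
      have "B l t (y m t) - B m t (y m t) = ((m - l) * (inverse m * inverse l * inverse l0)) *s
          (- (A2 t *v y m t))"
      proof -
        have "inverse l - inverse m = (m - l) * (inverse m * inverse l)"
          using S(1)[of l] S(1)[of m] l m by (simp add: field_simps)
        moreover have "B l t (y m t) - B m t (y m t) =
            ((inverse l - inverse m) * inverse l0) *s (- (A2 t *v y m t))"
          by (rule vec2_eqI) (simp_all add: B_def algebra_simps)
        ultimately show ?thesis by (simp add: mult_ac)
      qed
      then have "norm (B l t (y m t) - B m t (y m t)) = norm (m - l) *
          (norm (inverse m) * norm (inverse l) * norm (inverse l0)) * norm (A2 t *v y m t)"
        by (simp add: norm_vec_scalar norm_mult)
      also have "\<dots> \<le> ?d * ((2 / R) * (2 / R) * (2 / R)) * (K * C)"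
      proof (intro mult_mono)
        show "norm (m - l) \<le> ?d" by norm
        show "norm (A2 t *v y m t) \<le> K * C"
          using bound(3)[OF t, of "y m t"] y_le[of m t] m t K
          by (smt (verit) DiffD1 mult_left_mono)
      qed (use S(3)[of l] S(3)[of m] il0 l m R K C in auto)
      finally have 3: "norm (B l t (y m t) - B m t (y m t)) \<le>
          (2 / R) * (2 / R) * (2 / R) * (K * C) * ?d" by (simp add: mult_ac)
      have "B l t (y l t) - B m t (y m t) = B l t (y l t - y m t) + (B l t (y m t) - B m t (y m t))"
        by (simp add: B_diff[symmetric])
      then have "norm (B l t (y l t) - B m t (y m t)) \<le>
          norm (B l t (y l t - y m t)) + norm (B l t (y m t) - B m t (y m t))"
        by (metis norm_triangle_ineq)
      also have "\<dots> \<le> N * ?d"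
        using add_mono[OF 2 3] by (simp add: N_def algebra_simps)
      finally show ?thesis .
    qed
    have cauchy: "norm (D l 1 - D m 1) \<le> G * (N * (norm (l - l0) + norm (m - l0)))"
      if l: "l \<in> S - {l0}" and m: "m \<in> S - {l0}" for l m
      unfolding G_def
    proof (rule gronwall_inhomogeneous[where y = "\<lambda>t. D l t - D m t"])
      fix s :: real assume s: "s \<in> {0..1}"
      show "((\<lambda>t. D l t - D m t) has_vector_derivative
          (A l0 s (D l s) + B l s (y l s)) - (A l0 s (D m s) + B m s (y m s))) (at s)"
        by (intro has_vector_derivative_diff Dd l m s)
      have "norm ((A l0 s (D l s) + B l s (y l s)) - (A l0 s (D m s) + B m s (y m s)))
          \<le> norm (A l0 s (D l s - D m s)) + norm (B l s (y l s) - B m s (y m s))"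
        unfolding A_diff[symmetric] by norm
      also have "\<dots> \<le> L * norm (D l s - D m s) + N * (norm (l - l0) + norm (m - l0))"
        by (intro add_mono A_le l0S forcing l m s)
      finally show "norm ((A l0 s (D l s) + B l s (y l s)) - (A l0 s (D m s) + B m s (y m s)))
          \<le> L * norm (D l s - D m s) + N * (norm (l - l0) + norm (m - l0))" .
    qed (use l m L N S(1) l0 in \<open>auto simp: D_def init\<close>)
    have "\<exists>d. ((\<lambda>l. D l 1 $ i) \<longlongrightarrow> d) (at l0)"
    proof (rule cauchy_criterion_at)
      show "R / 2 > 0" using R by simp
      fix l m assume "l \<in> ball l0 (R / 2) - {l0}" "m \<in> ball l0 (R / 2) - {l0}"
      then have "norm (D l 1 - D m 1) \<le> G * (N * (norm (l - l0) + norm (m - l0)))"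
        by (intro cauchy) (simp_all add: S_def)
      then show "norm (D l 1 $ i - D m 1 $ i) \<le> (G * N) * (norm (l - l0) + norm (m - l0))"
        using Finite_Cartesian_Product.norm_nth_le[of "D l 1 - D m 1" i] by (simp add: mult.assoc)
    qed
    then obtain d where "((\<lambda>l. D l 1 $ i) \<longlongrightarrow> d) (at l0)" by blast
    moreover have "D l 1 $ i = (y l 1 $ i - y l0 1 $ i) / (l - l0)" for l
      by (simp add: D_def divide_inverse algebra_simps)
    ultimately have "((\<lambda>l. (y l 1 $ i - y l0 1 $ i) / (l - l0)) \<longlongrightarrow> d) (at l0)"
      by (simp only:)
    then show ?thesis by (auto simp: has_field_derivative_iff)
  qed
  then show ?thesis
    unfolding holomorphic_on_def field_differentiable_def
    by (metis ComplD has_field_derivative_at_within singletonI)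
qed

section \<open>Boundedness and holomorphic functions\<close>

lemma bilinear_bound_on_compact:
  assumes "bounded_bilinear B" "compact S" "continuous_on S A"
  shows "\<exists>K\<ge>0. \<forall>s\<in>S. \<forall>x. norm (B (A s) x) \<le> K * norm x"
proof -
  interpret bounded_bilinear B by fact
  obtain K where K: "\<And>a b. norm (B a b) \<le> norm a * norm b * K" "K > 0"
    using pos_bounded by blast
  have "bounded (A ` S)"
    using assms(2,3) by (intro compact_imp_bounded compact_continuous_image)
  then obtain C where C: "C > 0" "\<And>s. s \<in> S \<Longrightarrow> norm (A s) \<le> C"
    by (auto simp: bounded_pos)
  have "norm (B (A s) x) \<le> (C * K) * norm x" if "s \<in> S" for s x
  proof -
    have "norm (B (A s) x) \<le> norm (A s) * norm x * K" by (rule K)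
    also have "\<dots> \<le> C * norm x * K"
      using C(2)[OF that] K(2) by (intro mult_right_mono) auto
    finally show ?thesis by (simp add: mult_ac)
  qed
  then show ?thesis using C K by (intro exI[of _ "C * K"]) auto
qed

lemma bounded_image_bilinear:
  assumes "bounded_bilinear B" "bounded (f ` X)" "bounded (g ` X)"
  shows "bounded ((\<lambda>x. B (f x) (g x)) ` X)"
proof -
  interpret bounded_bilinear B by fact
  obtain K where K: "\<And>a b. norm (B a b) \<le> norm a * norm b * K" "K > 0"
    using pos_bounded by blast
  obtain C where C: "C > 0" "\<And>x. x \<in> X \<Longrightarrow> norm (f x) \<le> C"
    using assms(2) by (auto simp: bounded_pos)
  obtain D where D: "D > 0" "\<And>x. x \<in> X \<Longrightarrow> norm (g x) \<le> D"
    using assms(3) by (auto simp: bounded_pos)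
  have "norm (B (f x) (g x)) \<le> C * D * K" if "x \<in> X" for x
  proof -
    have "norm (f x) * norm (g x) * K \<le> C * D * K"
      using C(2)[OF that] D(2)[OF that] C(1) K(2) by (intro mult_right_mono mult_mono) auto
    then show ?thesis using K(1) order_trans by blast
  qed
  then show ?thesis by (auto simp: bounded_iff)
qed

lemma bounded_image_linear:
  assumes "bounded_linear T" "bounded (f ` X)"
  shows "bounded ((\<lambda>x. T (f x)) ` X)"
  using bounded_linear_image[OF assms(2,1)] by (simp add: image_image)

lemma bounded_image_add:
  fixes f g :: "'a \<Rightarrow> 'b::real_normed_vector"
  assumes "bounded (f ` X)" "bounded (g ` X)"
  shows "bounded ((\<lambda>x. f x + g x) ` X)"
proof -
  obtain C where C: "\<And>x. x \<in> X \<Longrightarrow> norm (f x) \<le> C" using assms(1) by (auto simp: bounded_iff)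
  obtain D where D: "\<And>x. x \<in> X \<Longrightarrow> norm (g x) \<le> D" using assms(2) by (auto simp: bounded_iff)
  show ?thesis
    unfolding bounded_iff using norm_triangle_le[OF add_mono[OF C D]] by blast
qed

lemma poly_zero_at_zero:
  fixes p :: "complex poly"
  assumes "\<And>l. l \<noteq> 0 \<Longrightarrow> poly p l = 0"
  shows "poly p 0 = 0"
proof -
  have "p = 0"
  proof (rule ccontr)
    assume "p \<noteq> 0"
    then have "finite {x. poly p x = 0}" by (rule poly_roots_finite)
    moreover have "UNIV - {0} \<subseteq> {x. poly p x = 0}" using assms by auto
    ultimately have "finite (UNIV - {0 :: complex})" by (rule rev_finite_subset)
    then show False by (simp add: infinite_UNIV_char_0)
  qed
  then show ?thesis by simp
qed

text \<open>
  For a function \<open>h\<close> of the eigenvalue \<open>\<nu>\<close>, these quotients are the coefficients of the matrix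
  \<open>h(Z) = h\<^sub>0 + h\<^sub>1 Z\<close> where \<open>Z\<^sup>2 = \<nu>\<^sup>2\<close>.  The odd part stays bounded as \<open>\<nu> \<rightarrow> 0\<close> because \<open>h\<close> is Lipschitz.
\<close>

lemma even_odd_parts_bounded:
  assumes r: "r > 0" and h: "h holomorphic_on ball 0 r"
  shows "\<exists>B. \<forall>\<nu>. norm \<nu> \<le> r / 2 \<longrightarrow> norm ((h \<nu> + h (- \<nu>)) / 2) \<le> B \<and>
           norm ((h \<nu> - h (- \<nu>)) / (2 * \<nu>)) \<le> B"
proof -
  have sub: "cball 0 (r / 2) \<subseteq> ball (0::complex) r" using r by auto
  have "continuous_on (cball 0 (r / 2)) h" "continuous_on (cball 0 (r / 2)) (deriv h)"
    using holomorphic_on_imp_continuous_on[OF h] holomorphic_on_imp_continuous_on[OF holomorphic_deriv[OF h open_ball]]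
    by (auto intro: continuous_on_subset[OF _ sub])
  then have "bounded (h ` cball 0 (r / 2))" "bounded (deriv h ` cball 0 (r / 2))"
    by (simp_all add: compact_imp_bounded compact_continuous_image)
  then obtain C D where C: "\<forall>z\<in>cball 0 (r / 2). norm (h z) \<le> C"
    and D: "\<forall>z\<in>cball 0 (r / 2). norm (deriv h z) \<le> D"
    by (auto simp: bounded_iff)
  have "norm ((h \<nu> + h (- \<nu>)) / 2) \<le> max C D \<and> norm ((h \<nu> - h (- \<nu>)) / (2 * \<nu>)) \<le> max C D"
    if "norm \<nu> \<le> r / 2" for \<nu>
  proof
    have in_ball: "\<nu> \<in> cball 0 (r / 2)" "- \<nu> \<in> cball 0 (r / 2)" using that by auto
    have "norm (h \<nu> + h (- \<nu>)) \<le> C + C"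
      using C in_ball by (intro norm_triangle_le add_mono) auto
    then show "norm ((h \<nu> + h (- \<nu>)) / 2) \<le> max C D" by (simp add: norm_divide)
    have "norm (h \<nu> - h (- \<nu>)) \<le> D * norm (\<nu> - - \<nu>)"
    proof (rule field_differentiable_bound[where S = "cball 0 (r / 2)" and f' = "deriv h"])
      show "(h has_field_derivative deriv h z) (at z within cball 0 (r / 2))"
        if "z \<in> cball 0 (r / 2)" for z
        using holomorphic_derivI[OF h open_ball, of z] that sub
        by (auto intro: has_field_derivative_at_within)
    qed (use D in_ball in auto)
    also have "norm (\<nu> - - \<nu>) = norm (2 * \<nu>)" by simp
    finally have "norm (h \<nu> - h (- \<nu>)) \<le> D * norm (2 * \<nu>)" .
    then have "norm ((h \<nu> - h (- \<nu>)) / (2 * \<nu>)) \<le> D"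
    proof (cases "\<nu> = 0")
      case True
      have "norm (deriv h 0) \<le> D" using D r by simp
      then have "0 \<le> D" using norm_ge_zero order_trans by blast
      then show ?thesis by (simp add: True)
    qed (simp add: norm_divide divide_le_eq)
    then show "norm ((h \<nu> - h (- \<nu>)) / (2 * \<nu>)) \<le> max C D" by simp
  qed
  then show ?thesis by blast
qed

text \<open>
  Boundedness near \<open>0\<close> removes the singularity there, and Liouville's theorem applies.
\<close>

lemma Liouville_punctured:
  assumes hol: "f holomorphic_on - {0}"
    and r: "r > 0" and near: "\<And>l. l \<noteq> 0 \<Longrightarrow> norm l < r \<Longrightarrow> norm (f l) \<le> B"
    and far: "\<And>l. norm l > R \<Longrightarrow> norm (f l) \<le> B"
  obtains c where "\<And>l. l \<noteq> 0 \<Longrightarrow> f l = c"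
proof -
  have "\<exists>g. g holomorphic_on UNIV \<and> (\<forall>z\<in>UNIV - {0}. g z = f z)"
  proof -
    have "f holomorphic_on UNIV - {0}" using hol by (simp add: Compl_eq_Diff_UNIV)
    moreover have "\<exists>B. eventually (\<lambda>z. norm (f z) \<le> B) (at 0)"
      using near r by (intro exI[of _ B]) (auto simp: eventually_at dist_norm)
    ultimately show ?thesis
      by (subst holomorphic_on_extend_bounded) auto
  qed
  then obtain g where g: "g holomorphic_on UNIV" "\<And>z. z \<noteq> 0 \<Longrightarrow> g z = f z" by auto
  have "compact (g ` cball 0 \<bar>R\<bar>)"
    using g(1) by (intro compact_continuous_image) (auto intro: holomorphic_on_imp_continuous_on holomorphic_on_subset)
  then have "bounded (g ` cball 0 \<bar>R\<bar>)" by (rule compact_imp_bounded)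
  then obtain C where "\<forall>z\<in>cball 0 \<bar>R\<bar>. norm (g z) \<le> C" by (auto simp: bounded_iff)
  then have C: "norm z \<le> \<bar>R\<bar> \<Longrightarrow> norm (g z) \<le> C" for z by simp
  have "norm (g z) \<le> max B C" for z
  proof (cases "norm z \<le> \<bar>R\<bar>")
    case False
    then have "z \<noteq> 0" by auto
    then show ?thesis using False far[of z] g(2)[of z] by (auto simp: le_max_iff_disj)
  qed (use C[of z] in \<open>auto simp: le_max_iff_disj\<close>)
  then have "bounded (range g)" by (auto simp: bounded_iff)
  from Liouville_theorem[OF g(1) this] obtain c where "\<And>z. g z = c"
    by (auto simp: constant_on_def)
  with g(2) that show thesis by metis
qed

section \<open>Potentials and their frames\<close>

definition pot_beta :: "complex poly^2^2 \<Rightarrow> complex" where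
  "pot_beta \<zeta> = coeff (\<zeta> $ 1 $ 2) 1"

lemma potential_nth:
  "potential \<alpha> \<beta> \<gamma> $ 1 $ 1 = [:0, \<alpha>, - cnj \<alpha>:]"
  "potential \<alpha> \<beta> \<gamma> $ 1 $ 2 = [:- of_real (inverse \<gamma>), \<beta>, - of_real \<gamma>:]"
  "potential \<alpha> \<beta> \<gamma> $ 2 $ 1 = [:0, of_real \<gamma>, - cnj \<beta>, of_real (inverse \<gamma>):]"
  "potential \<alpha> \<beta> \<gamma> $ 2 $ 2 = [:0, - \<alpha>, cnj \<alpha>:]"
  by (simp_all add: potential_def)

lemma eval_mat_P2:
  assumes "\<zeta> \<in> P2"
  shows "eval_mat \<zeta> l = mat2
    (pot_alpha \<zeta> * l - cnj (pot_alpha \<zeta>) * l\<^sup>2)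
    (- inverse (of_real (pot_gamma \<zeta>)) + pot_beta \<zeta> * l - of_real (pot_gamma \<zeta>) * l\<^sup>2)
    (of_real (pot_gamma \<zeta>) * l - cnj (pot_beta \<zeta>) * l\<^sup>2 + inverse (of_real (pot_gamma \<zeta>)) * l^3)
    (- (pot_alpha \<zeta> * l) + cnj (pot_alpha \<zeta>) * l\<^sup>2)"
  and pot_gamma_pos: "pot_gamma \<zeta> > 0"
proof -
  obtain \<alpha> \<beta> \<gamma> where \<zeta>: "\<zeta> = potential \<alpha> \<beta> \<gamma>" and \<gamma>: "\<gamma> > 0"
    using assms by (auto simp: P2_def)
  then show "pot_gamma \<zeta> > 0" by simp
  have "pot_beta \<zeta> = \<beta>" by (simp add: \<zeta> pot_beta_def potential_nth)
  then show "eval_mat \<zeta> l = mat2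
    (pot_alpha \<zeta> * l - cnj (pot_alpha \<zeta>) * l\<^sup>2)
    (- inverse (of_real (pot_gamma \<zeta>)) + pot_beta \<zeta> * l - of_real (pot_gamma \<zeta>) * l\<^sup>2)
    (of_real (pot_gamma \<zeta>) * l - cnj (pot_beta \<zeta>) * l\<^sup>2 + inverse (of_real (pot_gamma \<zeta>)) * l^3)
    (- (pot_alpha \<zeta> * l) + cnj (pot_alpha \<zeta>) * l\<^sup>2)"
    by (intro mat2_eqI)
      (simp_all add: \<zeta> potential_nth algebra_simps power2_eq_square power3_eq_cube)
qed

lemma U_mat_mat2: "U_mat \<zeta> l = mat2
    ((pot_alpha \<zeta> - cnj (pot_alpha \<zeta>)) / 2)
    (- (inverse (of_real (pot_gamma \<zeta>)) * inverse l) - of_real (pot_gamma \<zeta>))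
    (of_real (pot_gamma \<zeta>) + inverse (of_real (pot_gamma \<zeta>)) * l)
    (- ((pot_alpha \<zeta> - cnj (pot_alpha \<zeta>)) / 2))"
  by (simp add: U_mat_def Let_def mat2_def diff_divide_distrib)

lemma V_mat_mat2: "V_mat \<zeta> l = mat2
    (\<i> * ((pot_alpha \<zeta> + cnj (pot_alpha \<zeta>)) / 2))
    (\<i> * (- (inverse (of_real (pot_gamma \<zeta>)) * inverse l) + of_real (pot_gamma \<zeta>)))
    (\<i> * (of_real (pot_gamma \<zeta>) - inverse (of_real (pot_gamma \<zeta>)) * l))
    (- (\<i> * ((pot_alpha \<zeta> + cnj (pot_alpha \<zeta>)) / 2)))"
  by (simp add: V_mat_def Let_def mat2_def)

lemma adj2_U_mat: "adj2 (U_mat \<zeta> l) = - U_mat \<zeta> l" and adj2_V_mat: "adj2 (V_mat \<zeta> l) = - V_mat \<zeta> l"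
  by (rule mat2_eqI; simp add: U_mat_mat2 V_mat_mat2)+

text \<open>
  The reality condition of the frame: on the unit circle \<open>U\<close> and \<open>V\<close> are skew-hermitian.
\<close>

lemma herm_U_mat: "herm (U_mat \<zeta> (inverse (cnj l))) = - U_mat \<zeta> l"
  and herm_V_mat: "herm (V_mat \<zeta> (inverse (cnj l))) = - V_mat \<zeta> l"
  by (rule mat2_eqI; simp add: U_mat_mat2 V_mat_mat2 field_simps)+

text \<open>
  The reality condition of the potential: on the unit circle \<open>\<lambda>\<^bsup>-3/2\<^esup> \<zeta>\<close> is skew-hermitian.
\<close>

lemma herm_eval_mat:
  assumes "\<zeta> \<in> P2" "l \<noteq> 0"
  shows "herm (eval_mat \<zeta> (inverse (cnj l))) = mat (- (inverse l ^ 3)) ** eval_mat \<zeta> l"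
  using assms(2) unfolding eval_mat_P2[OF assms(1)]
  by (intro mat2_eqI) (simp_all add: field_simps power2_eq_square power3_eq_cube)

lemma det_eval_mat: "det (eval_mat \<zeta> l) = poly (det \<zeta>) l"
  by (simp add: det_2)

text \<open>
  Consequently the eigenvalues \<open>\<nu>\<close> of the potential, for which \<open>\<nu>\<^sup>2 = - \<lambda> a(\<lambda>)\<close>, do not vanish near
  \<open>\<lambda> = 0\<close> away from \<open>\<lambda> = 0\<close> itself.
\<close>

lemma poly_at_zero:
  assumes "\<zeta> \<in> P2" "det \<zeta> = [:0, 1:] * a"
  shows "poly a 0 = 1"
proof -
  obtain \<alpha> \<beta> \<gamma> where "\<zeta> = potential \<alpha> \<beta> \<gamma>" "\<gamma> > 0" using assms(1) by (auto simp: P2_def)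
  then have "coeff (det \<zeta>) 1 = 1" by (simp add: det_2 potential_nth)
  then show ?thesis by (simp add: assms(2) poly_0_coeff_0)
qed

locale framed_flow =
  fixes \<zeta>0 :: "complex poly^2^2" and \<zeta> :: "complex \<Rightarrow> complex poly^2^2"
    and F :: "complex \<Rightarrow> complex \<Rightarrow> complex^2^2"
  assumes flow: "is_flow \<zeta>0 \<zeta>" and frame: "is_frame \<zeta> F"
begin

lemma zeta_0: "\<zeta> 0 = \<zeta>0" and zeta_P2: "\<zeta> z \<in> P2"
  and zeta_partials: "l \<noteq> 0 \<Longrightarrow> has_partials (\<lambda>w. eval_mat (\<zeta> w) l)
          (commutator (eval_mat (\<zeta> z) l) (U_mat (\<zeta> z) l))
          (commutator (eval_mat (\<zeta> z) l) (V_mat (\<zeta> z) l)) z"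
  using flow by (auto simp: is_flow_def)

lemma F_0: "l \<noteq> 0 \<Longrightarrow> F l 0 = mat 1"
  and F_partials: "l \<noteq> 0 \<Longrightarrow>
        has_partials (F l) (F l z ** U_mat (\<zeta> z) l) (F l z ** V_mat (\<zeta> z) l) z"
  using frame by (auto simp: is_frame_def)

lemma adj2_F_partials:
  assumes "l \<noteq> 0"
  shows "has_partials (\<lambda>z. adj2 (F l z)) (- (U_mat (\<zeta> z) l ** adj2 (F l z)))
      (- (V_mat (\<zeta> z) l ** adj2 (F l z))) z"
  using has_partials_linear[OF bounded_linear_adj2 F_partials[OF assms]]
  by (simp add: adj2_mult adj2_U_mat adj2_V_mat mult_minus_left2)

lemma det_F: "l \<noteq> 0 \<Longrightarrow> det (F l z) = 1"
proof -
  assume l: "l \<noteq> 0"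
  have "has_partials (\<lambda>z. F l z ** adj2 (F l z)) 0 0 z" for z
    using has_partials_bilinear[OF bounded_bilinear_matrix_mult F_partials[OF l] adj2_F_partials[OF l]]
    by (simp add: mult_minus_right2 matrix_mul_assoc)
  then have "F l z ** adj2 (F l z) = F l 0 ** adj2 (F l 0)"
    by (rule has_partials_zero_imp_const)
  from arg_cong[OF this, of "\<lambda>A. A $ 1 $ 1"] show ?thesis
    by (simp add: F_0[OF l] det_2)
qed

lemma F_adj2: "l \<noteq> 0 \<Longrightarrow> F l z ** adj2 (F l z) = mat 1"
  and adj2_F: "l \<noteq> 0 \<Longrightarrow> adj2 (F l z) ** F l z = mat 1"
  by (simp_all add: adj2_right adj2_left det_F)

text \<open>
  This integrates the Lax equations: \<open>F \<zeta> F\<^sup>-\<^sup>1\<close> has vanishing derivatives.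
\<close>

lemma frame_conjugates_zeta:
  assumes l: "l \<noteq> 0"
  shows "eval_mat \<zeta>0 l ** F l z = F l z ** eval_mat (\<zeta> z) l"
proof -
  have "has_partials (\<lambda>z. F l z ** eval_mat (\<zeta> z) l ** adj2 (F l z)) 0 0 z" for z
    using has_partials_bilinear[OF bounded_bilinear_matrix_mult
      has_partials_bilinear[OF bounded_bilinear_matrix_mult F_partials[OF l] zeta_partials[OF l]]
      adj2_F_partials[OF l], of z]
    by (simp add: commutator_def mult_minus_right2 mult_add_left2 mult_diff_right2 mult_diff_left2
        matrix_mul_assoc)
  then have "F l z ** eval_mat (\<zeta> z) l ** adj2 (F l z)
      = F l 0 ** eval_mat (\<zeta> 0) l ** adj2 (F l 0)"
    by (rule has_partials_zero_imp_const)
  also have "\<dots> = eval_mat \<zeta>0 l"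
    by (rule mat2_eqI) (simp_all add: F_0[OF l] zeta_0)
  finally have "eval_mat \<zeta>0 l ** F l z = F l z ** eval_mat (\<zeta> z) l ** (adj2 (F l z) ** F l z)"
    by (simp add: matrix_mul_assoc)
  then show ?thesis by (simp add: adj2_F l)
qed

lemma frame_unitary:
  assumes l: "l \<noteq> 0"
  shows "F l z ** herm (F (inverse (cnj l)) z) = mat 1"
proof -
  have l': "inverse (cnj l) \<noteq> 0" using l by simp
  have "has_partials (\<lambda>z. F l z ** herm (F (inverse (cnj l)) z)) 0 0 z" for z
    using has_partials_bilinear[OF bounded_bilinear_matrix_mult F_partials[OF l]
        has_partials_linear[OF bounded_linear_herm F_partials[OF l']]]
    by (simp add: herm_mult herm_U_mat herm_V_mat mult_minus_right2 mult_minus_left2 matrix_mul_assoc)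
  then have "F l z ** herm (F (inverse (cnj l)) z) = F l 0 ** herm (F (inverse (cnj l)) 0)"
    by (rule has_partials_zero_imp_const)
  also have "\<dots> = mat 1"
    by (rule mat2_eqI) (simp_all add: F_0[OF l] F_0[OF l'])
  finally show ?thesis .
qed

text \<open>
  The coefficients of the potential are linear in its values at finitely many \<open>\<lambda> \<noteq> 0\<close>.  This transfers
  smoothness from the evaluations, about which the flow makes a statement, to the coefficients.
\<close>

lemma alpha_interpolation: "pot_alpha (\<zeta> z) =
    (eval_mat (\<zeta> z) 1 $ 1 $ 1 - eval_mat (\<zeta> z) (- 1) $ 1 $ 1) * (1 / 2)"
  unfolding eval_mat_P2[OF zeta_P2] by simp

lemma beta_interpolation: "pot_beta (\<zeta> z) =
    (eval_mat (\<zeta> z) 1 $ 1 $ 2 - eval_mat (\<zeta> z) (- 1) $ 1 $ 2) * (1 / 2)"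
  unfolding eval_mat_P2[OF zeta_P2] by simp

lemma gamma_interpolation: "of_real (pot_gamma (\<zeta> z)) =
    (eval_mat (\<zeta> z) 1 $ 1 $ 2 + eval_mat (\<zeta> z) (- 1) $ 1 $ 2
      - eval_mat (\<zeta> z) 2 $ 1 $ 2 - eval_mat (\<zeta> z) (- 2) $ 1 $ 2) * (1 / 6)"
  unfolding eval_mat_P2[OF zeta_P2] by simp

lemma gamma_nonzero: "complex_of_real (pot_gamma (\<zeta> z)) \<noteq> 0"
  using pot_gamma_pos[OF zeta_P2[of z]] by simp

lemmas C_times_rules = C_times_const C_times_add C_times_diff C_times_minus C_times_mult C_times_cnj
  C_times_mat2 C_times_linear[OF bounded_linear_nth2] C_times_bilinear[OF bounded_bilinear_matrix_mult]

lemma coefficients_C_times_aux: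
  assumes "\<And>l. l \<noteq> 0 \<Longrightarrow> C_times k (\<lambda>w. eval_mat (\<zeta> w) l)"
  shows "C_times k (\<lambda>w. pot_alpha (\<zeta> w))" "C_times k (\<lambda>w. pot_beta (\<zeta> w))"
    "C_times k (\<lambda>w. complex_of_real (pot_gamma (\<zeta> w)))"
    "C_times k (\<lambda>w. inverse (complex_of_real (pot_gamma (\<zeta> w))))"
proof -
  show "C_times k (\<lambda>w. pot_alpha (\<zeta> w))" "C_times k (\<lambda>w. pot_beta (\<zeta> w))"
    unfolding alpha_interpolation beta_interpolation
    by (intro C_times_rules assms; simp)+
  show "C_times k (\<lambda>w. complex_of_real (pot_gamma (\<zeta> w)))"
    unfolding gamma_interpolation
    by (intro C_times_rules assms; simp)
  then show "C_times k (\<lambda>w. inverse (complex_of_real (pot_gamma (\<zeta> w))))"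
    by (rule C_times_inverse[OF gamma_nonzero])
qed

text \<open>
  Bootstrapping: the right hand sides of the Lax equations are polynomial in the coefficients and in
  \<open>\<gamma>\<^sup>-\<^sup>1\<close>, so each order of differentiability yields the next one.
\<close>

lemma zeta_C_times: "l \<noteq> 0 \<Longrightarrow> C_times k (\<lambda>w. eval_mat (\<zeta> w) l)"
proof (induction k arbitrary: l)
  case 0
  then show ?case by (auto intro: has_partials_imp_continuous zeta_partials)
next
  case (Suc k)
  have "C_times k (\<lambda>z. U_mat (\<zeta> z) l)" "C_times k (\<lambda>z. V_mat (\<zeta> z) l)"
    unfolding U_mat_mat2 V_mat_mat2 divide_inverse
    by (intro C_times_rules coefficients_C_times_aux Suc.IH; assumption)+
  then show ?case
    using Suc by (intro C_times_SucI[OF zeta_partials])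
      (auto simp: commutator_def intro!: C_times_rules)
qed

lemmas coefficients_C_times = coefficients_C_times_aux[OF zeta_C_times]

lemma U_V_C_times: "C_times k (\<lambda>z. U_mat (\<zeta> z) l)" "C_times k (\<lambda>z. V_mat (\<zeta> z) l)"
  unfolding U_mat_mat2 V_mat_mat2 divide_inverse
  by (intro C_times_rules coefficients_C_times; assumption)+

lemma F_C_times: "l \<noteq> 0 \<Longrightarrow> C_times k (F l)"
proof (induction k)
  case 0
  then show ?case by (auto intro: has_partials_imp_continuous F_partials)
next
  case (Suc k)
  then show ?case
    by (intro C_times_SucI[OF F_partials] C_times_rules U_V_C_times) auto
qed

end

section \<open>Exponentials of trace-free matrices\<close>

text \<open>
  This is \<open>exp(s Z)\<close> if \<open>Z\<^sup>2 = \<nu>\<^sup>2\<close> and \<open>\<nu> \<noteq> 0\<close>.  The closed form is even in \<open>\<nu>\<close>, so either square root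
  may be taken.
\<close>

definition mexp :: "complex^2^2 \<Rightarrow> complex \<Rightarrow> complex \<Rightarrow> complex^2^2" where
  "mexp Z \<nu> s = mat (cosh (s * \<nu>)) + mat (sinh (s * \<nu>) / \<nu>) ** Z"

context
  fixes Z :: "complex^2^2" and \<nu> :: complex
  assumes trace: "Z $ 2 $ 2 = - Z $ 1 $ 1" and det: "\<nu>\<^sup>2 = - det Z"
begin

lemma mexp_0: "mexp Z \<nu> 0 = mat 1"
  by (simp add: mexp_def vec_eq_iff forall_2)

lemma sq_root: "Z $ 1 $ 1 * Z $ 1 $ 1 + Z $ 1 $ 2 * Z $ 2 $ 1 = \<nu> * \<nu>"
  using det trace by (simp add: det_2 power2_eq_square)

lemma square: "Z ** Z = mat (\<nu> * \<nu>)"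
  using sq_root by (intro mat2_eqI) (simp_all add: trace algebra_simps)

text \<open>
  The matrices \<open>a + b Z\<close> form a commutative algebra, since \<open>Z\<^sup>2 = \<nu>\<^sup>2\<close>; all matrices built from the
  potential below live in it.
\<close>

lemma pencil_mult:
  "(mat a + mat b ** Z) ** (mat c + mat d ** Z) = mat (a * c + b * d * \<nu>\<^sup>2) + mat (a * d + b * c) ** Z"
proof -
  have "(mat a + mat b ** Z) ** (mat c + mat d ** Z)
      = mat (a * c) + mat (b * d) ** (Z ** Z) + mat (a * d + b * c) ** Z"
    by (rule mat2_eqI) (simp_all add: algebra_simps)
  also have "mat (b * d) ** (Z ** Z) = mat (b * d * \<nu>\<^sup>2)"
    unfolding square by (rule mat2_eqI) (simp_all add: power2_eq_square)
  finally show ?thesis by (simp add: vec_eq_iff forall_2)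
qed

lemma det_pencil: "det (mat a + mat b ** Z) = a\<^sup>2 - b\<^sup>2 * \<nu>\<^sup>2"
proof -
  have "det (mat a + mat b ** Z) = a\<^sup>2 - b\<^sup>2 * (Z $ 1 $ 1 * Z $ 1 $ 1 + Z $ 1 $ 2 * Z $ 2 $ 1)"
    by (simp add: det_2 trace power2_eq_square algebra_simps)
  then show ?thesis by (simp only: sq_root power2_eq_square)
qed

context
  assumes nz: "\<nu> \<noteq> 0"
begin

lemma det_mexp: "det (mexp Z \<nu> s) = 1"
proof -
  have "(sinh (s * \<nu>) / \<nu>)\<^sup>2 * \<nu>\<^sup>2 = (sinh (s * \<nu>))\<^sup>2"
    using nz by (simp add: power_divide)
  then show ?thesis
    unfolding mexp_def det_pencil by (simp add: cosh_square_eq)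
qed

lemma mexp_add: "mexp Z \<nu> s ** mexp Z \<nu> t = mexp Z \<nu> (s + t)"
proof -
  have "sinh (s * \<nu>) / \<nu> * (sinh (t * \<nu>) / \<nu>) * \<nu>\<^sup>2 = sinh (s * \<nu>) * sinh (t * \<nu>)"
    using nz by (simp add: power2_eq_square)
  then show ?thesis
    unfolding mexp_def pencil_mult
    by (simp add: distrib_right cosh_add sinh_add add_divide_distrib algebra_simps)
qed

lemma mexp_derivative:
  "((\<lambda>t. mexp Z \<nu> (of_real t * s)) has_vector_derivative
     (mat s ** (Z ** mexp Z \<nu> (of_real t * s)))) (at t)"
proof -
  have d: "((\<lambda>t. cosh (of_real t * s * \<nu>)) has_vector_derivative s * \<nu> * sinh (of_real t * s * \<nu>)) (at t)"
    "((\<lambda>t. sinh (of_real t * s * \<nu>) / \<nu>) has_vector_derivative s * cosh (of_real t * s * \<nu>)) (at t)"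
    by (rule has_vector_derivative_real_field, use nz in \<open>auto intro!: derivative_eq_intros\<close>)+
  have "((\<lambda>t. mexp Z \<nu> (of_real t * s)) has_vector_derivative
     (mat (s * \<nu> * sinh (of_real t * s * \<nu>)) + mat (s * cosh (of_real t * s * \<nu>)) ** Z)) (at t)"
    unfolding mexp_def
    by (intro has_vector_derivative_add bounded_linear.has_vector_derivative[OF bounded_linear_mat]
        bounded_linear.has_vector_derivative[OF bounded_bilinear.bounded_linear_left[OF bounded_bilinear_matrix_mult]] d)
  moreover have "mat (s * \<nu> * sinh (of_real t * s * \<nu>)) + mat (s * cosh (of_real t * s * \<nu>)) ** Z
      = mat s ** (Z ** mexp Z \<nu> (of_real t * s))"
  proof -
    have "mat s ** (Z ** mexp Z \<nu> (of_real t * s))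
        = (mat 0 + mat s ** Z) ** (mat (cosh (of_real t * s * \<nu>)) + mat (sinh (of_real t * s * \<nu>) / \<nu>) ** Z)"
      unfolding mexp_def by (simp add: matrix_mul_assoc)
    also have "\<dots> = mat (s * \<nu> * sinh (of_real t * s * \<nu>)) + mat (s * cosh (of_real t * s * \<nu>)) ** Z"
      unfolding pencil_mult using nz by (simp add: power2_eq_square mult_ac)
    finally show ?thesis by simp
  qed
  ultimately show ?thesis by simp
qed

end

end

section \<open>The frame as a function of the spectral parameter\<close>

context framed_flow
begin

lemma coefficients_continuous:
  assumes "continuous_on S g"
  shows "continuous_on S (\<lambda>s. pot_alpha (\<zeta> (g s)))" "continuous_on S (\<lambda>s. pot_beta (\<zeta> (g s)))"
    "continuous_on S (\<lambda>s. complex_of_real (pot_gamma (\<zeta> (g s))))"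
proof -
  have "continuous_on UNIV (\<lambda>w. pot_alpha (\<zeta> w))" "continuous_on UNIV (\<lambda>w. pot_beta (\<zeta> w))"
    "continuous_on UNIV (\<lambda>w. complex_of_real (pot_gamma (\<zeta> w)))"
    using coefficients_C_times[of 0] by simp_all
  from this[THEN continuous_on_compose2, OF assms subset_UNIV]
  show "continuous_on S (\<lambda>s. pot_alpha (\<zeta> (g s)))" "continuous_on S (\<lambda>s. pot_beta (\<zeta> (g s)))"
    "continuous_on S (\<lambda>s. complex_of_real (pot_gamma (\<zeta> (g s))))" .
qed

lemma adj2_F_ray:
  assumes "l \<noteq> 0"
  shows "((\<lambda>t. adj2 (F l (of_real t * z))) has_vector_derivative
    - ((Re z *\<^sub>R U_mat (\<zeta> (of_real t * z)) l + Im z *\<^sub>R V_mat (\<zeta> (of_real t * z)) l)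
      ** adj2 (F l (of_real t * z)))) (at t)"
  using has_partials_ray[OF adj2_F_partials[OF assms], where t = t and w = z]
  by (simp add: mult_add_left2 bounded_bilinear.scaleR_left[OF bounded_bilinear_matrix_mult])

text \<open>
  Along a ray \<open>F\<^sup>-\<^sup>1 v\<close> solves a linear ordinary differential equation whose coefficient is a
  Laurent polynomial in \<open>\<lambda>\<close>.
\<close>

lemma adj2_F_vec_holomorphic: "(\<lambda>l. (adj2 (F l z) *v v) $ i) holomorphic_on - {0}"
proof -
  define x y where "x = complex_of_real (Re z)" and "y = complex_of_real (Im z)"
  define al where "al t = pot_alpha (\<zeta> (of_real t * z))" for t
  define ga where "ga t = complex_of_real (pot_gamma (\<zeta> (of_real t * z)))" for t
  define A0 where "A0 t = (let d = x * ((al t - cnj (al t)) / 2) + y * (\<i> * ((al t + cnj (al t)) / 2))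
      in mat2 (- d) (x * ga t - y * \<i> * ga t) (- (x * ga t) - y * \<i> * ga t) d)" for t
  define A1 where "A1 t = mat2 0 0 (- (x * inverse (ga t)) + y * \<i> * inverse (ga t)) 0" for t
  define A2 where "A2 t = mat2 0 (x * inverse (ga t) + y * \<i> * inverse (ga t)) 0 0" for t
  have ray: "continuous_on {0..1} (\<lambda>t. complex_of_real t * z)" by (intro continuous_intros)
  have c: "continuous_on {0..1} al" "continuous_on {0..1} ga"
    using coefficients_continuous[OF ray] by (simp_all add: al_def ga_def)
  have ga: "ga t \<noteq> 0" for t unfolding ga_def by (rule gamma_nonzero)
  have cont: "continuous_on {0..1} A0" "continuous_on {0..1} A1" "continuous_on {0..1} A2"
    unfolding A0_def A1_def A2_def Let_def
    by (intro continuous_on_mat2 continuous_intros c ballI ga; simp)+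
  from cont[THEN bilinear_bound_on_compact[OF bounded_bilinear_matrix_vec compact_Icc]]
  obtain K0 K1 K2 where K: "K0 \<ge> 0" "K1 \<ge> 0" "K2 \<ge> 0"
    and K0: "\<And>t u. t \<in> {0..1} \<Longrightarrow> norm (A0 t *v u) \<le> K0 * norm u"
    and K1: "\<And>t u. t \<in> {0..1} \<Longrightarrow> norm (A1 t *v u) \<le> K1 * norm u"
    and K2: "\<And>t u. t \<in> {0..1} \<Longrightarrow> norm (A2 t *v u) \<le> K2 * norm u"
    by metis
  have "(\<lambda>l. (adj2 (F l (of_real 1 * z)) *v v) $ i) holomorphic_on - {0}"
  proof (rule linear_ode_holomorphic_parameter[where K = "K0 + K1 + K2" and ?A0.0 = A0 and ?A1.0 = A1 and ?A2.0 = A2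
        and y = "\<lambda>l t. adj2 (F l (of_real t * z)) *v v" and ?y0.0 = v])
    fix l :: complex and t :: real assume l: "l \<noteq> 0" and t: "t \<in> {0..1}"
    let ?G = "adj2 (F l (of_real t * z))"
    have eq: "- ((Re z *\<^sub>R U_mat (\<zeta> (of_real t * z)) l + Im z *\<^sub>R V_mat (\<zeta> (of_real t * z)) l) ** ?G) *v v
      = A0 t *v (?G *v v) + l *s (A1 t *v (?G *v v)) + inverse l *s (A2 t *v (?G *v v))"
      unfolding U_mat_mat2 V_mat_mat2 al_def[symmetric] ga_def[symmetric]
      by (intro vec2_eqI)
        (simp_all add: A0_def A1_def A2_def Let_def x_def y_def scaleR_conv_of_real[where 'a = complex]
          algebra_simps add_divide_distrib diff_divide_distrib)
    show "((\<lambda>t. adj2 (F l (of_real t * z)) *v v) has_vector_derivative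
        A0 t *v (?G *v v) + l *s (A1 t *v (?G *v v)) + inverse l *s (A2 t *v (?G *v v))) (at t)"
      unfolding eq[symmetric]
      by (intro bounded_linear.has_vector_derivative[OF bounded_bilinear.bounded_linear_left[OF
          bounded_bilinear_matrix_vec]] adj2_F_ray l)
  next
    fix l :: complex assume "l \<noteq> 0"
    then show "adj2 (F l (of_real 0 * z)) *v v = v"
      by (intro vec2_eqI) (simp_all add: F_0)
  qed (use K in \<open>auto intro!: order_trans[OF K0] order_trans[OF K1] order_trans[OF K2] mult_right_mono\<close>)
  then show ?thesis by simp
qed

lemma F_holomorphic: "(\<lambda>l. F l z $ i $ j) holomorphic_on - {0}"
proof -
  have "(\<lambda>l. adj2 (F l z) $ i $ j) holomorphic_on - {0}" for i j :: 2
    using adj2_F_vec_holomorphic[of z "axis j 1" i]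
    by (cases j rule: exhaust_2[THEN disjE]) (auto simp: axis_def)
  from this[of 1 1] this[of 1 2] this[of 2 1] this[of 2 2]
  have "(\<lambda>l. F l z $ 2 $ 2) holomorphic_on - {0}" "(\<lambda>l. - (F l z $ 1 $ 2)) holomorphic_on - {0}"
     "(\<lambda>l. - (F l z $ 2 $ 1)) holomorphic_on - {0}" "(\<lambda>l. F l z $ 1 $ 1) holomorphic_on - {0}"
    by simp_all
  then show ?thesis
    using exhaust_2[of i] exhaust_2[of j]
    by (auto dest: holomorphic_on_minus)
qed

lemma trace_zeta: "eval_mat (\<zeta> z) l $ 2 $ 2 = - eval_mat (\<zeta> z) l $ 1 $ 1"
  unfolding eval_mat_P2[OF zeta_P2] by simp

lemma trace_zeta0: "eval_mat \<zeta>0 l $ 2 $ 2 = - eval_mat \<zeta>0 l $ 1 $ 1"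
  using trace_zeta[of 0] by (simp only: zeta_0)

text \<open>
  Since \<open>F\<^sup>-\<^sup>1 \<zeta>\<^sub>0 = \<zeta> F\<^sup>-\<^sup>1\<close>, the matrix \<open>P = F\<^sup>-\<^sup>1 exp(z \<lambda>\<^sup>-\<^sup>1 \<zeta>\<^sub>0)\<close> solves \<open>\<partial>\<^sub>x P = (\<lambda>\<^sup>-\<^sup>1 \<zeta> - U) P\<close> and
  \<open>\<partial>\<^sub>y P = (\<i> \<lambda>\<^sup>-\<^sup>1 \<zeta> - V) P\<close>.  In both coefficients the poles at \<open>\<lambda> = 0\<close> cancel, so Gronwall's inequality
  bounds \<open>P\<close> uniformly for \<open>0 < \<bar>\<lambda>\<bar> \<le> 1\<close>, although both factors have essential singularities.
\<close>

lemma gauge_bounded: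
  "\<exists>B. \<forall>l \<nu>. l \<noteq> 0 \<longrightarrow> norm l \<le> 1 \<longrightarrow> \<nu> \<noteq> 0 \<longrightarrow> \<nu>\<^sup>2 = - det (eval_mat \<zeta>0 l) \<longrightarrow>
     norm (adj2 (F l z) ** mexp (eval_mat \<zeta>0 l) \<nu> (z / l)) \<le> B"
proof -
  define x y where "x = complex_of_real (Re z)" and "y = complex_of_real (Im z)"
  have z: "z = x + \<i> * y" by (simp add: x_def y_def complex_eq)
  define al where "al t = pot_alpha (\<zeta> (of_real t * z))" for t
  define be where "be t = pot_beta (\<zeta> (of_real t * z))" for t
  define ga where "ga t = complex_of_real (pot_gamma (\<zeta> (of_real t * z)))" for t
  have ga: "ga t \<noteq> 0" for t unfolding ga_def by (rule gamma_nonzero)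
  \<comment> \<open>\<open>R\<close> is \<open>z \<lambda>\<^sup>-\<^sup>1 \<zeta> - (x U + y V)\<close> with the cancelled poles removed, hence also defined at \<open>\<lambda> = 0\<close>.\<close>
  define R where "R = (\<lambda>(t, l). let d = x * (al t - cnj (al t) * l - (al t - cnj (al t)) / 2)
        + y * \<i> * (al t - cnj (al t) * l - (al t + cnj (al t)) / 2) in
      mat2 d (x * (be t - ga t * l + ga t) + y * \<i> * (be t - ga t * l - ga t))
        (x * (- (cnj (be t) * l) + inverse (ga t) * (l\<^sup>2 - l))
          + y * \<i> * (- (cnj (be t) * l) + inverse (ga t) * (l\<^sup>2 + l))) (- d))"
  have ray: "continuous_on S (\<lambda>p. complex_of_real (fst p) * z)" for S :: "(real \<times> complex) set"
    by (intro continuous_intros)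
  have c: "continuous_on S (\<lambda>p. al (fst p))" "continuous_on S (\<lambda>p. be (fst p))"
    "continuous_on S (\<lambda>p. ga (fst p))" for S :: "(real \<times> complex) set"
    using coefficients_continuous[OF ray[of S]] by (simp_all add: al_def be_def ga_def)
  have R: "continuous_on ({0..1} \<times> cball 0 1) R"
    unfolding R_def Let_def case_prod_beta
    by (intro continuous_on_mat2 continuous_intros c ballI ga; simp)+
  have "\<exists>K\<ge>0. \<forall>s\<in>{0..1} \<times> cball 0 1. \<forall>A::complex^2^2. norm (R s ** A) \<le> K * norm A"
    by (rule bilinear_bound_on_compact[OF bounded_bilinear_matrix_mult
          compact_Times[OF compact_Icc compact_cball] R])
  then obtain K where K: "K \<ge> 0"
    and "\<forall>s\<in>{0..1} \<times> cball 0 1. \<forall>A::complex^2^2. norm (R s ** A) \<le> K * norm A"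
    by (elim exE conjE) (rule that)
  then have bound: "norm (R (t, l) ** A) \<le> K * norm (A::complex^2^2)" if "t \<in> {0..1}" "norm l \<le> 1" for t l A
    using that by simp
  have "norm (adj2 (F l z) ** mexp (eval_mat \<zeta>0 l) \<nu> (z / l)) \<le> exp (K + 1 / 2) * norm (mat 1 :: complex^2^2)"
    if l: "l \<noteq> 0" "norm l \<le> 1" and \<nu>: "\<nu> \<noteq> 0" "\<nu>\<^sup>2 = - det (eval_mat \<zeta>0 l)" for l \<nu>
  proof -
    define Y where "Y t = adj2 (F l (of_real t * z)) ** mexp (eval_mat \<zeta>0 l) \<nu> (of_real t * (z / l))"
      for t :: real
    have "norm (Y 1) \<le> exp (K + 1 / 2) * norm (Y 0)"
    proof (rule gronwall_homogeneous)
      fix t :: real assume t: "t \<in> {0..1}"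
      let ?G = "adj2 (F l (of_real t * z))" and ?E = "mexp (eval_mat \<zeta>0 l) \<nu> (of_real t * (z / l))"
      let ?W = "Re z *\<^sub>R U_mat (\<zeta> (of_real t * z)) l + Im z *\<^sub>R V_mat (\<zeta> (of_real t * z)) l"
      show "norm (R (t, l) ** Y t) \<le> K * norm (Y t)" by (rule bound[OF t l(2)])
      have "?G ** eval_mat \<zeta>0 l = ?G ** eval_mat \<zeta>0 l ** (F l (of_real t * z) ** ?G)"
        by (simp add: F_adj2 l)
      also have "\<dots> = ?G ** (eval_mat \<zeta>0 l ** F l (of_real t * z)) ** ?G"
        by (simp only: matrix_mul_assoc)
      also have "\<dots> = ?G ** F l (of_real t * z) ** eval_mat (\<zeta> (of_real t * z)) l ** ?G"
        by (simp only: frame_conjugates_zeta[OF l(1)] matrix_mul_assoc)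
      finally have conj: "?G ** eval_mat \<zeta>0 l = eval_mat (\<zeta> (of_real t * z)) l ** ?G"
        by (simp add: adj2_F l)
      have zl: "z / l = (x + \<i> * y) / l" using z by simp
      have xy: "Re z *\<^sub>R c = x * c" "Im z *\<^sub>R c = y * c" for c :: complex
        by (simp_all add: x_def y_def scaleR_conv_of_real)
      have R: "mat (z / l) ** eval_mat (\<zeta> (of_real t * z)) l - ?W = R (t, l)"
        unfolding U_mat_mat2 V_mat_mat2 eval_mat_P2[OF zeta_P2]
          al_def[symmetric] ga_def[symmetric] be_def[symmetric]
        using l(1) ga[of t]
        by (intro mat2_eqI) (simp_all add: R_def Let_def xy zl power2_eq_square power3_eq_cube
            field_simps)
      have "?G ** (mat (z / l) ** (eval_mat \<zeta>0 l ** ?E)) + - (?W ** ?G) ** ?E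
          = mat (z / l) ** (?G ** eval_mat \<zeta>0 l) ** ?E - ?W ** ?G ** ?E"
        by (rule mat2_eqI) (simp_all add: algebra_simps)
      also have "\<dots> = (mat (z / l) ** eval_mat (\<zeta> (of_real t * z)) l - ?W) ** Y t"
        by (simp add: conj Y_def mult_diff_left2 matrix_mul_assoc)
      finally have eq: "?G ** (mat (z / l) ** (eval_mat \<zeta>0 l ** ?E)) + - (?W ** ?G) ** ?E
          = R (t, l) ** Y t" by (simp only: R)
      have "(Y has_vector_derivative
          ?G ** (mat (z / l) ** (eval_mat \<zeta>0 l ** ?E)) + - (?W ** ?G) ** ?E) (at t)"
        unfolding Y_def
        by (intro bounded_bilinear.has_vector_derivative[OF bounded_bilinear_matrix_mult]
            adj2_F_ray mexp_derivative trace_zeta0 l \<nu>)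
      then show "(Y has_vector_derivative R (t, l) ** Y t) (at t)" by (simp only: eq)
    qed (use K in auto)
    moreover have "Y 0 = mat 1"
      unfolding Y_def using mexp_0[OF trace_zeta0 \<nu>(2)] F_0[OF l(1)]
      by (intro mat2_eqI) simp_all
    ultimately show ?thesis by (simp add: Y_def)
  qed
  then show ?thesis by blast
qed

end

section \<open>The frame over a period\<close>

text \<open>
  A unitary triangular matrix is diagonal with entries of modulus one; the last hypothesis makes their
  quotient positive, so they agree, and their product is one.
\<close>

lemma unitary_triangular_scalar:
  fixes C :: "complex^2^2" and s t :: real
  assumes U: "C ** herm C = mat 1" and d: "det C = 1" and C21: "C $ 2 $ 1 = 0"
    and st: "s > 0" "t > 0" "C $ 1 $ 1 * of_real s = of_real t * C $ 2 $ 2"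
  shows "C = mat 1 \<or> C = mat (- 1)"
proof -
  have "(C ** herm C) $ 2 $ 2 = 1" "(C ** herm C) $ 1 $ 1 = 1" by (simp_all add: U)
  then have "complex_of_real ((norm (C $ 2 $ 2))\<^sup>2) = 1"
    and "complex_of_real ((norm (C $ 1 $ 1))\<^sup>2) + complex_of_real ((norm (C $ 1 $ 2))\<^sup>2) = 1"
    unfolding complex_norm_square by (simp_all add: C21)
  then have "(norm (C $ 2 $ 2))\<^sup>2 = 1" and 1: "(norm (C $ 1 $ 1))\<^sup>2 + (norm (C $ 1 $ 2))\<^sup>2 = 1"
    by (simp_all only: of_real_eq_1_iff of_real_add[symmetric])
  then have n22: "norm (C $ 2 $ 2) = 1"
    by (metis abs_norm_cancel abs_square_eq_1)
  have d': "C $ 1 $ 1 * C $ 2 $ 2 = 1" using d by (simp add: det_2 C21)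
  then have n11: "norm (C $ 1 $ 1) = 1" using n22 by (metis mult.right_neutral norm_mult norm_one)
  have C12: "C $ 1 $ 2 = 0" using 1 n11 by simp
  have "norm (C $ 1 $ 1 * of_real s) = norm (of_real t * C $ 2 $ 2)" by (simp only: st(3))
  then have "s = t" using st(1,2) n11 n22 by (simp add: norm_mult)
  then have eq: "C $ 1 $ 1 = C $ 2 $ 2" using st by simp
  then have "(C $ 1 $ 1)\<^sup>2 = 1" using d' by (simp add: power2_eq_square)
  then have "C $ 1 $ 1 = 1 \<or> C $ 1 $ 1 = - 1" by (simp add: power2_eq_1_iff)
  then show ?thesis using eq C12 C21 by (auto simp: vec_eq_iff forall_2)
qed

context framed_flow
begin

text \<open>
  The constancy of \<open>C(\<lambda>) = F(z + \<omega>)\<^sup>-\<^sup>1 M F(z)\<close>, evaluated on an eigenvector of \<open>\<zeta>\<^sub>0\<close>.  The sign \<open>e\<close> may a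
  priori depend on \<open>z\<close>, but not on \<open>\<lambda>\<close>, which suffices for quotients of solutions at two values of \<open>\<lambda>\<close>.
\<close>

lemma frame_over_period:
  assumes I: "\<zeta>0 \<in> I_set a" and mu: "is_mu a \<omega> \<mu>"
  shows "\<exists>e\<in>{1, -1}. \<forall>l \<nu> v. l \<noteq> 0 \<longrightarrow> v \<noteq> 0 \<longrightarrow> eval_mat \<zeta>0 l *v v = \<nu> *s v \<longrightarrow>
           \<mu> (l, \<nu>) *s (adj2 (F l (z + \<omega>)) *v v) = e *s (adj2 (F l z) *v v)"
proof -
  define Z where "Z = eval_mat \<zeta>0"
  have P2: "\<zeta>0 \<in> P2" and det_\<zeta>0: "det \<zeta>0 = [:0, 1:] * a" using I by (auto simp: I_set_def)
  have det_Z: "det (Z l) = l * poly a l" for l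
    by (simp add: Z_def det_eval_mat det_\<zeta>0)
  have trace: "Z l $ 2 $ 2 = - Z l $ 1 $ 1" for l unfolding Z_def by (rule trace_zeta0)
  have curve: "(l, n) \<in> curve a \<longleftrightarrow> l \<noteq> 0 \<and> n\<^sup>2 = - det (Z l)" for l n
    by (auto simp: curve_def det_Z add_eq_0_iff)
  have a0: "poly a 0 = 1" using P2 det_\<zeta>0 by (rule poly_at_zero)

  obtain b where multiplier: "is_multiplier a b \<mu>" and norm0: "normalized_at_zero a \<omega> \<mu>"
    using mu by (auto simp: is_mu_def)
  obtain f g where fg: "f holomorphic_on - {0}" "g holomorphic_on - {0}"
    and "\<forall>(l, n)\<in>curve a. \<mu> (l, n) = f l + g l * n"
    using multiplier by (auto simp: is_multiplier_def)
  then have mu_fg: "\<mu> (l, n) = f l + g l * n" if "(l, n) \<in> curve a" for l n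
    using that by auto
  have minus: "(l, - n) \<in> curve a" if "(l, n) \<in> curve a" for l n
    using that by (simp add: curve)
  have fg_sigma: "(f l + g l * n) * (f l - g l * n) = 1" if "(l, n) \<in> curve a" for l n
  proof -
    have "\<mu> (l, n) \<noteq> 0" "\<mu> (l, - n) = inverse (\<mu> (l, n))"
      using multiplier that by (auto simp: is_multiplier_def Defs.sigma_def)
    then show ?thesis using mu_fg[OF that] mu_fg[OF minus[OF that]] by (simp add: field_simps)
  qed

  \<comment> \<open>\<open>M\<close> has the eigenvalue \<open>\<mu>(l, n)\<close> on the eigenspace of \<open>Z l\<close> to the eigenvalue \<open>n\<close>.\<close>
  define M where "M l = mat (f l) + mat (g l) ** Z l" for l
  have det_M: "det (M l) = 1" if "l \<noteq> 0" for l
  proof -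
    define n where "n = csqrt (- det (Z l))"
    have n: "n\<^sup>2 = - det (Z l)" by (simp add: n_def)
    have "det (M l) = (f l)\<^sup>2 - (g l)\<^sup>2 * n\<^sup>2"
      unfolding M_def by (rule det_pencil[OF trace n])
    also have "\<dots> = (f l + g l * n) * (f l - g l * n)"
      by (simp add: power2_eq_square algebra_simps)
    also have "\<dots> = 1" using that n by (intro fg_sigma) (simp add: curve)
    finally show ?thesis .
  qed
  have M_unitary: "M l ** herm (M (inverse (cnj l))) = mat 1"
    if l: "l \<noteq> 0" and n: "n \<noteq> 0" "n\<^sup>2 = - det (Z l)" for l n
  proof -
    let ?l = "inverse (cnj l)"
    have herm_Z: "herm (Z ?l) = mat (- (inverse l ^ 3)) ** Z l"
      unfolding Z_def by (rule herm_eval_mat[OF P2 l])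
    have rho: "f ?l - g ?l * (inverse (cnj l) ^ 3 * cnj m) = cnj (f l - g l * m)"
      if m: "(l, m) \<in> curve a" for m
    proof -
      have "cnj (det (Z ?l)) = det (herm (Z ?l))" by (simp add: det_2)
      also have "\<dots> = (inverse l ^ 3)\<^sup>2 * det (Z l)"
        unfolding herm_Z by (simp add: det_2 power2_eq_square algebra_simps)
      finally have "det (Z ?l) = cnj ((inverse l ^ 3)\<^sup>2 * det (Z l))"
        by (metis complex_cnj_cnj)
      moreover have "(cnj m)\<^sup>2 = - cnj (det (Z l))"
        using m by (simp add: curve flip: complex_cnj_power)
      ultimately have "(?l, - (inverse (cnj l) ^ 3 * cnj m)) \<in> curve a"
        using l by (simp add: curve power_mult_distrib)
      from mu_fg[OF this] have "\<mu> (rho (l, m)) = f ?l - g ?l * (inverse (cnj l) ^ 3 * cnj m)"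
        by (simp add: rho_def)
      moreover have "\<mu> (rho (l, m)) = inverse (cnj (\<mu> (l, m)))"
        using multiplier m by (auto simp: is_multiplier_def)
      moreover have "inverse (\<mu> (l, m)) = f l - g l * m"
        using fg_sigma[OF m] by (simp add: mu_fg[OF m] inverse_unique)
      ultimately show ?thesis by (metis complex_cnj_inverse)
    qed
    have mem: "(l, n) \<in> curve a" "(l, - n) \<in> curve a" using l n by (simp_all add: curve)
    have sum_diff: "u = c \<and> w = d" if "u - w = c - d" "u + w = c + d" for u w c d :: complex
      using that by (simp add: complex_eq_iff)
    have "f ?l - g ?l * inverse (cnj l) ^ 3 * cnj n = cnj (f l) - cnj (g l) * cnj n"
      "f ?l + g ?l * inverse (cnj l) ^ 3 * cnj n = cnj (f l) + cnj (g l) * cnj n"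
      using rho[OF mem(1)] rho[OF mem(2)] by (simp_all add: mult.assoc)
    \<comment> \<open>The identity holds on both sheets \<open>\<plusminus> n\<close>, so the coefficients of \<open>1\<close> and \<open>n\<close> agree separately.\<close>
    from sum_diff[OF this] n(1)
    have f': "f ?l = cnj (f l)" and g': "g ?l * inverse (cnj l) ^ 3 = cnj (g l)"
      by simp_all
    have "herm (M ?l) = mat (cnj (f ?l)) + mat (cnj (g ?l)) ** herm (Z ?l)"
      unfolding M_def by (rule mat2_eqI) (simp_all add: algebra_simps)
    also have "\<dots> = mat (f l) + mat (- (cnj (g ?l * inverse (cnj l) ^ 3))) ** Z l"
      unfolding herm_Z f' by (rule mat2_eqI) (simp_all add: algebra_simps)
    also have "\<dots> = adj2 (M l)"
      unfolding g' M_def by (rule mat2_eqI) (simp_all add: trace)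
    finally show ?thesis by (simp add: adj2_right det_M[OF l])
  qed

  define \<nu> where "\<nu> l = csqrt (- det (Z l))" for l
  have \<nu>: "(\<nu> l)\<^sup>2 = - det (Z l)" for l by (simp add: \<nu>_def)
  obtain r0 h where r0: "r0 > 0" and h: "h holomorphic_on ball 0 r0"
    and "\<forall>(l, n)\<in>curve a. norm l < r0 \<and> norm n < r0 \<longrightarrow>
        \<mu> (l, n) * exp (- \<omega> * inverse l * n) = h n"
    using norm0 by (auto simp: normalized_at_zero_def)
  then have mu_h: "\<mu> (l, n) * exp (- \<omega> * inverse l * n) = h n"
    if "(l, n) \<in> curve a" "norm l < r0" "norm n < r0" for l n
    using that by auto
  have "\<exists>r>0. r \<le> 1 \<and> r \<le> r0 \<and> (\<forall>l. norm l < r \<longrightarrow> norm (det (Z l)) < (r0 / 2)\<^sup>2 \<and> poly a l \<noteq> 0)"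
  proof -
    have "isCont (\<lambda>l. l * poly a l) 0" "isCont (poly a) 0" by (intro continuous_intros)+
    then obtain s t where st: "s > 0" "t > 0"
      and s: "\<And>l. dist l 0 < s \<Longrightarrow> dist (l * poly a l) (0 * poly a 0) < (r0 / 2)\<^sup>2"
      and t: "\<And>l. dist l 0 < t \<Longrightarrow> dist (poly a l) (poly a 0) < 1"
      unfolding continuous_at_eps_delta using r0 by (metis half_gt_zero zero_less_one zero_less_power)
    show ?thesis
    proof (intro exI[of _ "min (min s t) (min 1 r0)"] conjI allI impI)
      fix l :: complex assume l: "norm l < min (min s t) (min 1 r0)"
      show "norm (det (Z l)) < (r0 / 2)\<^sup>2" using s[of l] l by (simp add: det_Z)
      show "poly a l \<noteq> 0" using t[of l] l a0 by auto
    qed (use st r0 in auto)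
  qed
  then obtain r where r: "r > 0" "r \<le> 1" "r \<le> r0"
    and small: "\<And>l. norm l < r \<Longrightarrow> norm (det (Z l)) < (r0 / 2)\<^sup>2"
    and nonzero: "\<And>l. norm l < r \<Longrightarrow> poly a l \<noteq> 0" by auto
  define X where "X = {l :: complex. l \<noteq> 0 \<and> norm l < r}"
  have X: "l \<noteq> 0" "norm l \<le> 1" "norm l < r0" "\<nu> l \<noteq> 0" "norm (\<nu> l) \<le> r0 / 2" "norm (\<nu> l) < r0"
    if "l \<in> X" for l
  proof -
    show "l \<noteq> 0" "norm l \<le> 1" "norm l < r0" using that r by (auto simp: X_def)
    have "(norm (\<nu> l))\<^sup>2 < (r0 / 2)\<^sup>2"
      using small[of l] that \<nu>[of l] by (simp add: X_def flip: norm_power)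
    then have "norm (\<nu> l) < r0 / 2"
      by (rule power2_less_imp_less) (use r0 in simp)
    then show "norm (\<nu> l) \<le> r0 / 2" "norm (\<nu> l) < r0" using r0 by auto
    show "\<nu> l \<noteq> 0" using \<nu>[of l] nonzero[of l] that by (auto simp: X_def det_Z)
  qed
  \<comment> \<open>\<open>H = h(Z)\<close> is the regular factor of \<open>M\<close> that the normalization of \<open>\<mu>\<close> provides.\<close>
  define H where "H l = mat ((h (\<nu> l) + h (- \<nu> l)) / 2) +
      mat ((h (\<nu> l) - h (- \<nu> l)) / (2 * \<nu> l)) ** Z l" for l
  have M_H: "M l = mexp (Z l) (\<nu> l) (\<omega> / l) ** H l" if "l \<in> X" for l
  proof -
    note x = X[OF that]
    define n E E' where "n = \<nu> l" and "E = exp (\<omega> / l * n)" and "E' = exp (- (\<omega> / l * n))"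
    have EE: "E * E' = 1" by (simp add: E_def E'_def exp_minus)
    have n: "n \<noteq> 0" using x by (simp add: n_def)
    have "(l, n) \<in> curve a" using x \<nu> by (simp add: curve n_def)
    note mem = this minus[OF this]
    have small: "norm l < r0" "norm n < r0" "norm (- n) < r0" using x by (simp_all add: n_def)
    note mu_h[OF mem(1) small(1,2)] mu_h[OF mem(2) small(1,3)]
    moreover have "exp (- \<omega> * inverse l * n) = E'" "exp (- \<omega> * inverse l * - n) = E"
      by (simp_all add: E_def E'_def divide_inverse)
    ultimately have "h n = (f l + g l * n) * E'" "h (- n) = (f l - g l * n) * E"
      by (simp_all only: mu_fg[OF mem(1)] mu_fg[OF mem(2)] mult_minus_right diff_conv_add_uminus)
    then have hE: "h n * E = f l + g l * n" "h (- n) * E' = f l - g l * n"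
      using EE by (simp_all only: mult.assoc mult.commute[of E'] mult_1_right)
    have cs: "cosh (\<omega> / l * n) = (E + E') / 2" "sinh (\<omega> / l * n) = (E - E') / 2"
      by (simp_all add: cosh_field_def sinh_field_def E_def E'_def)
    let ?h0 = "(h n + h (- n)) / 2" and ?h1 = "(h n - h (- n)) / (2 * n)"
    have "(E + E') / 2 * ?h0 + (E - E') / 2 / n * ?h1 * n\<^sup>2 = (h n * E + h (- n) * E') / 2"
      using n by (simp add: field_simps power2_eq_square)
    also have "\<dots> = f l" unfolding hE by simp
    finally have 1: "(E + E') / 2 * ?h0 + (E - E') / 2 / n * ?h1 * n\<^sup>2 = f l" .
    have "(E + E') / 2 * ?h1 + (E - E') / 2 / n * ?h0 = (h n * E - h (- n) * E') / (2 * n)"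
      using n by (simp add: field_simps)
    also have "\<dots> = g l" unfolding hE using n by simp
    finally have 2: "(E + E') / 2 * ?h1 + (E - E') / 2 / n * ?h0 = g l" .
    show ?thesis
      unfolding M_def mexp_def H_def n_def[symmetric] pencil_mult[OF trace \<nu>[of l, folded n_def]] cs 1 2 ..
  qed
  have H_bounded: "bounded (H ` X)"
  proof -
    obtain B where B: "\<And>n. norm n \<le> r0 / 2 \<Longrightarrow> norm ((h n + h (- n)) / 2) \<le> B"
      "\<And>n. norm n \<le> r0 / 2 \<Longrightarrow> norm ((h n - h (- n)) / (2 * n)) \<le> B"
      using even_odd_parts_bounded[OF r0 h] by blast
    have "bounded ((\<lambda>l. (h (\<nu> l) + h (- \<nu> l)) / 2) ` X)" "bounded ((\<lambda>l. (h (\<nu> l) - h (- \<nu> l)) / (2 * \<nu> l)) ` X)"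
      unfolding bounded_iff using B X(5) by blast+
    moreover have "bounded (Z ` X)"
    proof (rule bounded_subset)
      have "continuous_on (cball 0 1) Z"
        unfolding Z_def eval_mat_P2[OF P2] by (intro continuous_on_mat2 continuous_intros)
      then show "bounded (Z ` cball 0 1)"
        by (intro compact_imp_bounded compact_continuous_image compact_cball)
      show "Z ` X \<subseteq> Z ` cball 0 1" using X(2) by auto
    qed
    ultimately show ?thesis
      unfolding H_def
      by (intro bounded_image_add bounded_image_linear[OF bounded_linear_mat]
          bounded_image_bilinear[OF bounded_bilinear_matrix_mult])
  qed
  define P where "P w l = adj2 (F l w) ** mexp (Z l) (\<nu> l) (w / l)" for w l
  have P_bounded: "bounded (P w ` X)" for w
  proof -
    obtain B where "\<And>l n. l \<noteq> 0 \<Longrightarrow> norm l \<le> 1 \<Longrightarrow> n \<noteq> 0 \<Longrightarrow> n\<^sup>2 = - det (Z l) \<Longrightarrow>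
        norm (adj2 (F l w) ** mexp (Z l) n (w / l)) \<le> B"
      using gauge_bounded[of w] unfolding Z_def by blast
    then have "norm (P w l) \<le> B" if "l \<in> X" for l
      using X[OF that] \<nu> by (simp add: P_def)
    then show ?thesis unfolding bounded_iff by blast
  qed

  define C where "C l = adj2 (F l (z + \<omega>)) ** M l ** F l z" for l
  \<comment> \<open>Inserting \<open>F = exp(z \<lambda>\<^sup>-\<^sup>1 \<zeta>\<^sub>0) P\<^sup>-\<^sup>1\<close> and \<open>M = exp(\<omega> \<lambda>\<^sup>-\<^sup>1 \<zeta>\<^sub>0) H\<close> leaves only bounded factors.\<close>
  have C_P: "C l = P (z + \<omega>) l ** H l ** adj2 (P z l)" if "l \<in> X" for l
  proof -
    note x = X[OF that]
    note tr = trace[of l] and nu = \<nu>[of l]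
    let ?E = "mexp (Z l) (\<nu> l)"
    have det_P: "det (P z l) = 1"
      using x by (simp add: P_def det_mul det_F det_mexp[OF tr nu x(4)])
    have "?E (z / l) ** adj2 (P z l) = F l z ** (adj2 (F l z) ** ?E (z / l)) ** adj2 (P z l)"
      using x(1) by (simp add: F_adj2 matrix_mul_assoc)
    also have "\<dots> = F l z ** (P z l ** adj2 (P z l))" by (simp only: P_def matrix_mul_assoc)
    finally have F: "F l z = ?E (z / l) ** adj2 (P z l)" by (simp add: adj2_right det_P)
    have comm: "H l ** ?E (z / l) = ?E (z / l) ** H l"
      unfolding H_def mexp_def pencil_mult[OF tr nu] by (simp add: mult_ac add_ac)
    have "C l = adj2 (F l (z + \<omega>)) ** ?E (\<omega> / l) ** (H l ** ?E (z / l)) ** adj2 (P z l)"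
      unfolding C_def M_H[OF that] by (subst F) (simp only: matrix_mul_assoc)
    also have "\<dots> = adj2 (F l (z + \<omega>)) ** (?E (\<omega> / l) ** ?E (z / l)) ** H l ** adj2 (P z l)"
      unfolding comm by (simp only: matrix_mul_assoc)
    also have "?E (\<omega> / l) ** ?E (z / l) = ?E ((z + \<omega>) / l)"
      by (simp add: mexp_add[OF tr nu x(4)] add_divide_distrib add.commute)
    finally show ?thesis by (simp only: P_def)
  qed
  have C_bounded: "bounded (C ` X)"
  proof -
    have "bounded ((\<lambda>l. P (z + \<omega>) l ** H l ** adj2 (P z l)) ` X)"
      by (intro bounded_image_bilinear[OF bounded_bilinear_matrix_mult]
          bounded_image_linear[OF bounded_linear_adj2] P_bounded H_bounded)
    moreover have "(\<lambda>l. P (z + \<omega>) l ** H l ** adj2 (P z l)) ` X = C ` X"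
      using C_P by (intro image_cong) simp_all
    ultimately show ?thesis by simp
  qed
  have det_C: "det (C l) = 1" if "l \<noteq> 0" for l
    using that by (simp add: C_def det_mul det_F det_M)
  have C_unitary: "C l ** herm (C (inverse (cnj l))) = mat 1" if "l \<in> X" for l
  proof -
    note x = X[OF that]
    let ?l = "inverse (cnj l)"
    have "C l ** herm (C ?l) = adj2 (F l (z + \<omega>)) ** (M l ** (F l z ** herm (F ?l z)) ** herm (M ?l))
        ** herm (adj2 (F ?l (z + \<omega>)))"
      by (simp only: C_def herm_mult matrix_mul_assoc)
    also have "\<dots> = adj2 (F l (z + \<omega>)) ** herm (adj2 (F ?l (z + \<omega>)))"
      using x by (simp add: frame_unitary M_unitary[OF _ x(4) \<nu>])
    also have "\<dots> = adj2 (herm (F ?l (z + \<omega>)) ** F l (z + \<omega>))"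
      by (simp add: adj2_mult adj2_herm)
    also have "herm (F ?l (z + \<omega>)) ** F l (z + \<omega>) = mat 1"
      using frame_unitary[OF x(1), of "z + \<omega>"] matrix_left_right_inverse by blast
    finally show ?thesis by (simp add: vec_eq_iff forall_2)
  qed
  have "\<exists>c. \<forall>l. l \<noteq> 0 \<longrightarrow> C l $ i $ j = c" for i j
  proof -
    have entry: "norm (A $ i $ j) \<le> norm A" for A :: "complex^2^2"
      by (metis Finite_Cartesian_Product.norm_nth_le order_trans)
    obtain B where B: "\<And>l. l \<in> X \<Longrightarrow> norm (C l) \<le> B"
      using C_bounded by (auto simp: bounded_iff)
    obtain B' where B': "\<And>l. l \<in> X \<Longrightarrow> norm (herm (adj2 (C l))) \<le> B'"
      using bounded_image_linear[OF bounded_linear_herm bounded_image_linear[OF bounded_linear_adj2 C_bounded]]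
      by (auto simp: bounded_iff)
    show ?thesis
    proof (rule Liouville_punctured)
      show "(\<lambda>l. C l $ i $ j) holomorphic_on - {0}"
      proof -
        have adj: "(\<lambda>l. adj2 (F l (z + \<omega>)) $ i $ k) holomorphic_on - {0}" for i k
          using exhaust_2[of i] exhaust_2[of k]
          by (auto intro!: holomorphic_intros F_holomorphic)
        have "(\<lambda>l. M l $ i $ k) holomorphic_on - {0}" for i k
          using exhaust_2[of i] exhaust_2[of k] fg
          by (auto simp: M_def Z_def intro!: holomorphic_intros)
        with adj show ?thesis
          unfolding C_def mult_nth by (intro holomorphic_intros F_holomorphic)
      qed
      show "r > 0" by (rule r)
      show "norm (C l $ i $ j) \<le> max B B'" if "l \<noteq> 0" "norm l < r" for l
        using B[of l] entry[of "C l"] that by (auto simp: X_def)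
      \<comment> \<open>Near infinity \<open>C\<close> is the inverse adjoint of its values near \<open>0\<close>.\<close>
      show "norm (C l $ i $ j) \<le> max B B'" if "norm l > inverse r" for l
      proof -
        have l: "l \<noteq> 0" using that r by auto
        define k where "k = inverse (cnj l)"
        have k: "k \<in> X"
          using l less_imp_inverse_less[OF that] r by (simp add: X_def k_def norm_inverse)
        have kl: "inverse (cnj k) = l" by (simp add: k_def)
        have "herm (C l) = adj2 (C k) ** (C k ** herm (C l))"
          using det_C[OF X(1)[OF k]] by (simp add: matrix_mul_assoc adj2_left)
        also have "\<dots> = adj2 (C k)" using C_unitary[OF k] kl by simp
        finally have "herm (herm (C l)) = herm (adj2 (C k))" by simp
        moreover have "herm (herm (C l)) = C l" by (simp add: vec_eq_iff)
        ultimately have "C l = herm (adj2 (C k))" by simp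
        then show ?thesis using B'[OF k] entry[of "C l"] by simp
      qed
    qed blast
  qed
  then obtain c where c: "\<And>i j l. l \<noteq> 0 \<Longrightarrow> C l $ i $ j = c i j" by metis
  define C0 where "C0 = (\<chi> i j. c i j)"
  have C0: "C l = C0" if "l \<noteq> 0" for l
    using c[OF that] by (simp add: C0_def vec_eq_iff)

  have "C0 = mat 1 \<or> C0 = mat (- 1)"
  proof (rule unitary_triangular_scalar)
    have "of_real (r / 2) \<in> X" using r by (simp add: X_def)
    from C_unitary[OF this] show "C0 ** herm C0 = mat 1"
      using r by (simp add: C0)
    show "det C0 = 1" using det_C[of 1] C0[of 1] by simp
    let ?z = "\<zeta> z" and ?w = "\<zeta> (z + \<omega>)"
    have intertwine: "C0 ** eval_mat ?z l = eval_mat ?w l ** C0" if l: "l \<noteq> 0" for l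
    proof -
      let ?G = "adj2 (F l (z + \<omega>))"
      have "?G ** Z l = ?G ** Z l ** (F l (z + \<omega>) ** ?G)"
        by (simp add: F_adj2 l)
      also have "\<dots> = ?G ** (Z l ** F l (z + \<omega>)) ** ?G"
        by (simp only: matrix_mul_assoc)
      also have "\<dots> = ?G ** F l (z + \<omega>) ** eval_mat ?w l ** ?G"
        by (simp only: Z_def frame_conjugates_zeta[OF l] matrix_mul_assoc)
      finally have conj: "?G ** Z l = eval_mat ?w l ** ?G"
        by (simp add: adj2_F l)
      have "C l ** eval_mat ?z l = ?G ** (M l ** Z l) ** F l z"
        unfolding C_def Z_def by (simp only: frame_conjugates_zeta[OF l, symmetric] matrix_mul_assoc[symmetric])
      also have "M l ** Z l = Z l ** M l"
        unfolding M_def by (rule mat2_eqI) (simp_all add: algebra_simps)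
      also have "?G ** (Z l ** M l) ** F l z = (?G ** Z l) ** M l ** F l z"
        by (simp only: matrix_mul_assoc)
      also have "\<dots> = eval_mat ?w l ** C l"
        unfolding conj C_def by (simp only: matrix_mul_assoc)
      finally show ?thesis by (simp only: C0[OF l])
    qed
    \<comment> \<open>The intertwining relation is polynomial in \<open>\<lambda>\<close>, so it persists at \<open>\<lambda> = 0\<close>, where the
      potentials are strictly upper triangular with entry \<open>- \<gamma>\<^sup>-\<^sup>1\<close>.\<close>
    have at_0: "(C0 ** eval_mat ?z 0) $ i $ j = (eval_mat ?w 0 ** C0) $ i $ j" for i j
    proof -
      define p where "p = smult (C0 $ i $ 1) (?z $ 1 $ j) + smult (C0 $ i $ 2) (?z $ 2 $ j)
          - smult (C0 $ 1 $ j) (?w $ i $ 1) - smult (C0 $ 2 $ j) (?w $ i $ 2)"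
      have p: "poly p l = (C0 ** eval_mat ?z l) $ i $ j - (eval_mat ?w l ** C0) $ i $ j" for l
        by (simp add: p_def algebra_simps)
      have "poly p 0 = 0"
        by (rule poly_zero_at_zero) (simp add: p intertwine del: mult_nth)
      then show ?thesis by (simp add: p del: mult_nth)
    qed
    have pos: "pot_gamma ?z > 0" "pot_gamma ?w > 0" by (rule pot_gamma_pos[OF zeta_P2])+
    show "C0 $ 2 $ 1 = 0"
      using at_0[of 2 2] pos unfolding eval_mat_P2[OF zeta_P2] by simp
    show "inverse (pot_gamma ?z) > 0" "inverse (pot_gamma ?w) > 0" using pos by simp_all
    show "C0 $ 1 $ 1 * of_real (inverse (pot_gamma ?z)) = of_real (inverse (pot_gamma ?w)) * C0 $ 2 $ 2"
      using at_0[of 1 2] unfolding eval_mat_P2[OF zeta_P2] by simp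
  qed
  then obtain e where e: "e \<in> {1, - 1}" "C0 = mat e" by auto
  have "\<mu> (l, n) *s (adj2 (F l (z + \<omega>)) *v v) = e *s (adj2 (F l z) *v v)"
    if l: "l \<noteq> 0" and v: "v \<noteq> 0" "eval_mat \<zeta>0 l *v v = n *s v" for l n v
  proof -
    have "n\<^sup>2 = - det (Z l)"
    proof -
      have cramer: "(p * s - q * r) * u = 0" "(p * s - q * r) * w = 0"
        if "p * u + q * w = 0" "r * u + s * w = 0" for p q r s u w :: complex
        using that by algebra+
      have "(Z l $ 1 $ 1 - n) * v $ 1 + Z l $ 1 $ 2 * v $ 2 = 0"
        "Z l $ 2 $ 1 * v $ 1 + (Z l $ 2 $ 2 - n) * v $ 2 = 0"
        using arg_cong[OF v(2), of "\<lambda>u. u $ 1"] arg_cong[OF v(2), of "\<lambda>u. u $ 2"]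
        by (simp_all add: Z_def algebra_simps)
      from cramer[OF this]
      have "((Z l $ 1 $ 1 - n) * (Z l $ 2 $ 2 - n) - Z l $ 1 $ 2 * Z l $ 2 $ 1) * v $ i = 0" for i
        using exhaust_2[of i] by auto
      moreover obtain i where "v $ i \<noteq> 0" using v(1) by (auto simp: vec_eq_iff)
      ultimately have "(Z l $ 1 $ 1 - n) * (Z l $ 2 $ 2 - n) - Z l $ 1 $ 2 * Z l $ 2 $ 1 = 0" by auto
      then show ?thesis
        by (simp add: det_2 trace power2_eq_square algebra_simps)
    qed
    then have mem: "(l, n) \<in> curve a" using l by (simp add: curve)
    have "M l *v v = f l *s v + g l *s (eval_mat \<zeta>0 l *v v)"
      unfolding M_def Z_def by (rule vec2_eqI) (simp_all add: algebra_simps)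
    also have "\<dots> = \<mu> (l, n) *s v"
      unfolding v(2) mu_fg[OF mem] by (rule vec2_eqI) (simp_all add: algebra_simps)
    finally have Mv: "M l *v v = \<mu> (l, n) *s v" .
    have "adj2 (F l (z + \<omega>)) ** M l = C l ** adj2 (F l z)"
      unfolding C_def by (simp add: matrix_mul_assoc[symmetric] F_adj2 l)
    also have "\<dots> = mat e ** adj2 (F l z)" by (simp only: C0[OF l] e(2))
    finally have "adj2 (F l (z + \<omega>)) *v (M l *v v) = mat e *v (adj2 (F l z) *v v)"
      by (simp only: matrix_vector_mul_assoc)
    then show ?thesis
      unfolding Mv by (simp add: vec_eq_iff forall_2 algebra_simps)
  qed
  then show ?thesis using e(1) by blast
qed

end

section \<open>Quotients of two quaternionic solutions\<close>

definition qmat :: "complex \<Rightarrow> complex \<Rightarrow> complex^2^2" where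
  "qmat a b = mat2 a (- cnj b) b (cnj a)"

text \<open>
  The vector \<open>\<gamma>\<^sup>-\<^sup>1 (log_a, log_b)\<close> is the first column of the quaternion \<open>N\<close> in the decomposition
  \<open>quat (U v) = (Q + N) quat v\<close>, where \<open>Q\<close> does not depend on \<open>\<lambda>\<close>.
\<close>

definition log_a :: "complex \<Rightarrow> complex^2 \<Rightarrow> complex" where
  "log_a l v = (cnj l - inverse l) * (v $ 2 * cnj (v $ 1)) / of_real ((norm v)\<^sup>2)"

definition log_b :: "complex \<Rightarrow> complex^2 \<Rightarrow> complex" where
  "log_b l v = (l * (v $ 1 * cnj (v $ 1)) + inverse (cnj l) * (v $ 2 * cnj (v $ 2))) / of_real ((norm v)\<^sup>2)"

lemma norm_vec2_sq: "(norm (v::complex^2))\<^sup>2 = (norm (v $ 1))\<^sup>2 + (norm (v $ 2))\<^sup>2"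
  by (simp add: norm_vec_def L2_set_def sum_2)

lemma norm_vec2_sq_complex:
  "complex_of_real ((norm (v :: complex^2))\<^sup>2) = v $ 1 * cnj (v $ 1) + v $ 2 * cnj (v $ 2)"
  by (simp only: norm_vec2_sq of_real_add complex_norm_square)

lemma det_quat: "det (quat v) = of_real ((norm v)\<^sup>2)"
  by (simp only: norm_vec2_sq_complex det_2 quat_nth) simp

lemma qmat_quat:
  assumes v: "v \<noteq> 0" and g: "cnj g = g"
  shows "qmat (g * log_a l v) (g * log_b l v) ** quat v =
      mat2 (- (g * inverse l * v $ 2)) (- (g * cnj l * cnj (v $ 1))) (g * l * v $ 1) (- (g * inverse (cnj l) * cnj (v $ 2)))"
    and "qmat (\<i> * (g * log_a l v)) (- \<i> * (g * log_b l v)) ** quat v =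
      mat2 (- (\<i> * g * inverse l * v $ 2)) (- (\<i> * g * cnj l * cnj (v $ 1))) (- (\<i> * g * l * v $ 1)) (\<i> * g * inverse (cnj l) * cnj (v $ 2))"
proof -
  \<comment> \<open>All claims are polynomial identities in the entries of \<open>v\<close>, their conjugates and \<open>l\<close>, \<open>1 / l\<close>,
    modulo the relation \<open>m * (v1 * w1 + v2 * w2) = 1\<close>.\<close>
  define m where "m = inverse (complex_of_real ((norm v)\<^sup>2))"
  define v1 v2 w1 w2 k k' where "v1 = v $ 1" "v2 = v $ 2" "w1 = cnj (v $ 1)" "w2 = cnj (v $ 2)"
    "k = inverse l" "k' = inverse (cnj l)"
  note d = this
  have "m * complex_of_real ((norm v)\<^sup>2) = 1" using v by (simp add: m_def)
  then have m: "m * (v1 * w1 + v2 * w2) = 1" by (simp only: norm_vec2_sq_complex d)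
  have a: "log_a l v = (cnj l - k) * (v2 * w1) * m" and b: "log_b l v = (l * (v1 * w1) + k' * (v2 * w2)) * m"
    by (simp_all only: log_a_def log_b_def d divide_inverse m_def)
  have c: "cnj m = m" "cnj v1 = w1" "cnj v2 = w2" "cnj w1 = v1" "cnj w2 = v2" "cnj k = k'" "cnj k' = k"
    by (simp_all add: d m_def)
  have ca: "cnj (log_a l v) = (l - k') * (w2 * v1) * m"
    and cb: "cnj (log_b l v) = (cnj l * (v1 * w1) + k * (v2 * w2)) * m"
    by (simp_all add: a b c mult_ac)
  have e1: "(g * log_a l v) * v1 + - (g * cnj (log_b l v)) * v2 = - (g * k * v2)"
    unfolding cb unfolding a using m by algebra
  have e2: "(g * log_a l v) * (- w2) + - (g * cnj (log_b l v)) * w1 = - (g * cnj l * w1)"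
    unfolding cb unfolding a using m by algebra
  have e3: "(g * log_b l v) * v1 + (g * cnj (log_a l v)) * v2 = g * l * v1"
    unfolding ca unfolding b using m by algebra
  have e4: "(g * log_b l v) * (- w2) + (g * cnj (log_a l v)) * w1 = - (g * k' * w2)"
    unfolding ca unfolding b using m by algebra
  note e = e1 e2 e3 e4
  show "qmat (g * log_a l v) (g * log_b l v) ** quat v =
      mat2 (- (g * inverse l * v $ 2)) (- (g * cnj l * cnj (v $ 1))) (g * l * v $ 1) (- (g * inverse (cnj l) * cnj (v $ 2)))"
    by (intro mat2_eqI; simp only: mult_nth quat_nth qmat_def mat2_nth complex_cnj_mult g)
      (simp_all only: d[symmetric] c(2,3) e)
  have e1': "(\<i> * (g * log_a l v)) * v1 + - (\<i> * (g * cnj (log_b l v))) * v2 = - (\<i> * g * k * v2)"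
    using e1 by algebra
  have e2': "(\<i> * (g * log_a l v)) * (- w2) + - (\<i> * (g * cnj (log_b l v))) * w1 = - (\<i> * g * cnj l * w1)"
    using e2 by algebra
  have e3': "(- \<i> * (g * log_b l v)) * v1 + (- \<i> * (g * cnj (log_a l v))) * v2 = - (\<i> * g * l * v1)"
    using e3 by algebra
  have e4': "(- \<i> * (g * log_b l v)) * (- w2) + (- \<i> * (g * cnj (log_a l v))) * w1 = \<i> * g * k' * w2"
    using e4 by algebra
  note e' = e1' e2' e3' e4'
  show "qmat (\<i> * (g * log_a l v)) (- \<i> * (g * log_b l v)) ** quat v =
      mat2 (- (\<i> * g * inverse l * v $ 2)) (- (\<i> * g * cnj l * cnj (v $ 1))) (- (\<i> * g * l * v $ 1)) (\<i> * g * inverse (cnj l) * cnj (v $ 2))"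
    by (intro mat2_eqI; simp only: mult_nth quat_nth qmat_def mat2_nth complex_cnj_mult complex_cnj_minus
        complex_cnj_i g minus_minus)
      (simp_all only: d[symmetric] c(2,3) e')
qed

text \<open>
  \<open>Q_U\<close> and \<open>Q_V\<close> collect the terms of \<open>U\<close> and \<open>V\<close> of degree zero in \<open>\<lambda>\<close>.  They are quaternions, so they
  commute with the passage from \<open>v\<close> to \<open>quat v\<close> and drop out of the derivative of \<open>s\<^sub>1\<^sup>-\<^sup>1 s\<^sub>2\<close>.
\<close>

definition Q_U :: "complex poly^2^2 \<Rightarrow> complex^2^2" where
  "Q_U \<zeta> = qmat ((pot_alpha \<zeta> - cnj (pot_alpha \<zeta>)) / 2) (of_real (pot_gamma \<zeta>))"

definition Q_V :: "complex poly^2^2 \<Rightarrow> complex^2^2" where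
  "Q_V \<zeta> = qmat (\<i> * ((pot_alpha \<zeta> + cnj (pot_alpha \<zeta>)) / 2)) (\<i> * of_real (pot_gamma \<zeta>))"

lemma quat_U_mat:
  assumes "v \<noteq> 0" and g: "g = inverse (complex_of_real (pot_gamma \<zeta>))"
  shows "quat (U_mat \<zeta> l *v v) = (Q_U \<zeta> + qmat (g * log_a l v) (g * log_b l v)) ** quat v"
    and "quat (V_mat \<zeta> l *v v) = (Q_V \<zeta> + qmat (\<i> * (g * log_a l v)) (- \<i> * (g * log_b l v))) ** quat v"
proof -
  have cg: "cnj g = g" by (simp add: g)
  show "quat (U_mat \<zeta> l *v v) = (Q_U \<zeta> + qmat (g * log_a l v) (g * log_b l v)) ** quat v"
    unfolding mult_add_left2 qmat_quat(1)[OF assms(1) cg] U_mat_mat2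
    by (intro mat2_eqI) (simp_all add: Q_U_def qmat_def g field_simps)
  show "quat (V_mat \<zeta> l *v v) = (Q_V \<zeta> + qmat (\<i> * (g * log_a l v)) (- \<i> * (g * log_b l v))) ** quat v"
    unfolding mult_add_left2 qmat_quat(2)[OF assms(1) cg] V_mat_mat2
    by (intro mat2_eqI) (simp_all add: Q_V_def qmat_def g field_simps)
qed

text \<open>
  For fixed \<open>\<lambda>\<close> the pairs \<open>(log_a, log_b)\<close> lie on a sphere: \<open>log_b\<close> is a positive multiple of \<open>\<lambda>\<close>, and
  the quadratic equation has its centre and radius determined by \<open>\<bar>\<lambda>\<bar> + 1 / \<bar>\<lambda>\<bar>\<close>.
\<close>

lemma log_derivative_relation:
  assumes l: "l \<noteq> 0" and v: "v \<noteq> 0"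
  shows "norm (log_b l v) > 0"
    and "l = of_real (norm l) * (log_b l v / of_real (norm (log_b l v)))"
    and "(norm (log_b l v))\<^sup>2 + (norm (log_a l v))\<^sup>2 + 1
           = (norm l + inverse (norm l)) * norm (log_b l v)"
proof -
  define L p q where "L = norm l" and "p = (norm (v $ 1))\<^sup>2" and "q = (norm (v $ 2))\<^sup>2"
  \<comment> \<open>\<open>log_b\<close> is \<open>bb\<close> times the unit vector \<open>l / \<bar>l\<bar>\<close>.\<close>
  define bb where "bb = (L * p + q / L) / (p + q)"
  have L: "L > 0" using l by (simp add: L_def)
  have n: "(norm v)\<^sup>2 = p + q" by (simp add: norm_vec2_sq p_def q_def)
  moreover have "(norm v)\<^sup>2 > 0" using v by simp
  ultimately have pq: "p \<ge> 0" "q \<ge> 0" "p + q > 0" by (simp_all add: p_def q_def)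
  then have bb: "bb > 0"
    using L by (smt (verit, best) bb_def divide_pos_pos mult_pos_pos divide_nonneg_pos mult_nonneg_nonneg)
  have lL: "l * cnj l = of_real (L\<^sup>2)" by (simp only: L_def complex_norm_square)
  then have inv: "inverse (cnj l) = l / of_real (L\<^sup>2)" using l L by (simp add: field_simps)
  define N where "N = complex_of_real (p + q)"
  have N: "N \<noteq> 0" using pq(3) by (simp only: N_def of_real_eq_0_iff)
  have "log_b l v = (l * of_real p + inverse (cnj l) * of_real q) / N"
    unfolding log_b_def p_def q_def complex_norm_square N_def n[unfolded p_def q_def] ..
  also have "\<dots> = l / of_real L * ((of_real L * of_real p + of_real q / of_real L) / N)"
    unfolding inv using L N by (simp add: field_simps power2_eq_square)
  also have "(of_real L * of_real p + of_real q / of_real L) / N = of_real bb"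
    by (simp only: bb_def N_def of_real_divide of_real_add of_real_mult)
  finally have b: "log_b l v = l / of_real L * of_real bb" .
  then have nb: "norm (log_b l v) = bb" using bb L by (simp add: norm_mult norm_divide L_def)
  with bb show "norm (log_b l v) > 0" by simp
  show "l = of_real (norm l) * (log_b l v / of_real (norm (log_b l v)))"
    unfolding nb unfolding b using L bb by (simp add: L_def)
  have "cnj l - inverse l = of_real (L\<^sup>2 - 1) / l"
    using l lL by (simp add: field_simps)
  then have "norm (cnj l - inverse l) = \<bar>L\<^sup>2 - 1\<bar> / L"
    by (simp only: norm_divide norm_of_real L_def)
  moreover have "norm (log_a l v) = norm (cnj l - inverse l) * (norm (v $ 2) * norm (v $ 1)) / (p + q)"
    unfolding log_a_def n using pq by (simp add: norm_mult norm_divide flip: of_real_add)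
  ultimately have "(norm (log_a l v))\<^sup>2 = (L\<^sup>2 - 1)\<^sup>2 / L\<^sup>2 * (q * p) / (p + q)\<^sup>2"
    by (simp add: power_mult_distrib power_divide p_def q_def)
  then show "(norm (log_b l v))\<^sup>2 + (norm (log_a l v))\<^sup>2 + 1 = (norm l + inverse (norm l)) * norm (log_b l v)"
    unfolding nb bb_def L_def[symmetric] using L pq(3)
    by (simp add: divide_simps) (simp add: power2_eq_square algebra_simps)
qed

lemma log_derivative_determines_lambda:
  assumes "l \<noteq> 0" "l' \<noteq> 0" "v \<noteq> 0" "v' \<noteq> 0"
    and a: "log_a l v = log_a l' v'" and b: "log_b l v = log_b l' v'"
  shows "l' = l \<or> l' = inverse (cnj l)"
proof -
  define L L' where "L = norm l" and "L' = norm l'"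
  have L: "L > 0" "L' > 0" using assms by (simp_all add: L_def L'_def)
  define u where "u = log_b l v / of_real (norm (log_b l v))"
  have l: "l = of_real L * u" and l': "l' = of_real L' * u"
    using log_derivative_relation(2)[OF assms(1,3)] log_derivative_relation(2)[OF assms(2,4)]
    by (simp_all only: L_def L'_def u_def b)
  have "(L + inverse L) * norm (log_b l v) = (L' + inverse L') * norm (log_b l v)"
    using log_derivative_relation(3)[OF assms(1,3)] log_derivative_relation(3)[OF assms(2,4)]
    by (simp only: L_def L'_def a b)
  then have "L + inverse L = L' + inverse L'"
    using log_derivative_relation(1)[OF assms(1,3)] by simp
  then have "(L - L') * (L * L' - 1) = 0"
    using L by (simp add: field_simps)
  then consider "L' = L" | "L * L' = 1" by auto
  then show ?thesis
  proof cases
    case 1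
    then show ?thesis using l l' by simp
  next
    case 2
    have "norm u = 1"
      using log_derivative_relation(1)[OF assms(1,3)] by (simp add: u_def norm_divide)
    then have "u * cnj u = 1" by (metis complex_norm_square of_real_1 power_one)
    then have "l' * cnj l = of_real (L * L')"
      by (simp add: l l' mult_ac)
    then have "l' * cnj l = 1" using 2 by simp
    then show ?thesis by (metis inverse_unique mult.commute)
  qed
qed

text \<open>
  Left and right multiplication by a quaternion are conformal, as \<open>quat v\<close> is \<open>\<bar>v\<bar>\<close> times a unitary matrix.
\<close>

lemma inner_quat_left: "inner (quat v ** A) (quat v ** B) = (norm v)\<^sup>2 * inner A (B :: complex^2^2)"
  unfolding power2_norm_eq_inner
  by (simp add: inner_vec_def sum_2 inner_complex_def algebra_simps)

lemma inner_quat_right: "inner (A ** quat v) (B ** quat v) = (norm v)\<^sup>2 * inner A (B :: complex^2^2)"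
  unfolding power2_norm_eq_inner
  by (simp add: inner_vec_def sum_2 inner_complex_def algebra_simps)

lemma inner_qmat: "inner (qmat a b) (qmat c d) = 2 * (inner a c + inner b d)"
  by (simp add: qmat_def inner_vec_def sum_2 inner_complex_def)

lemma quat_quotient_in_quaternions:
  assumes "v \<noteq> 0"
  shows "matrix_inv (quat v) ** quat w \<in> quaternions"
proof -
  have nz: "det (quat v) \<noteq> 0" using assms by (simp add: det_quat)
  define A where "A = matrix_inv (quat v) ** quat w"
  define r where "r = inverse (det (quat v))"
  have r: "cnj r = r" by (simp add: r_def det_quat)
  have "A = mat r ** adj2 (quat v) ** quat w"
    unfolding A_def matrix_inv_2[OF nz] r_def ..
  then have "A = quat (vector [A $ 1 $ 1, A $ 2 $ 1])"
    using r by (intro mat2_eqI) (simp_all add: algebra_simps)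
  then show ?thesis unfolding A_def[symmetric] quaternions_eq_range by blast
qed

context framed_flow
begin

lemma psi_nonzero: "l \<noteq> 0 \<Longrightarrow> v \<noteq> 0 \<Longrightarrow> adj2 (F l z) *v v \<noteq> 0"
proof
  assume l: "l \<noteq> 0" and v: "v \<noteq> 0" and 0: "adj2 (F l z) *v v = 0"
  have "v = F l z *v (adj2 (F l z) *v v)"
    by (simp only: matrix_vector_mul_assoc F_adj2[OF l] matrix_vector_mul_lid)
  also have "\<dots> = 0" unfolding 0 by simp
  finally show False using v by simp
qed

lemma psi_C_times: "l \<noteq> 0 \<Longrightarrow> C_times k (\<lambda>z. adj2 (F l z) *v v)"
  by (intro C_times_linear[OF bounded_bilinear.bounded_linear_left[OF bounded_bilinear_matrix_vec]]
      C_times_linear[OF bounded_linear_adj2] F_C_times)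

lemma psi_partials:
  assumes "l \<noteq> 0"
  shows "has_partials (\<lambda>z. adj2 (F l z) *v v)
     (- (U_mat (\<zeta> z) l *v (adj2 (F l z) *v v))) (- (V_mat (\<zeta> z) l *v (adj2 (F l z) *v v))) z"
  using has_partials_linear[OF bounded_bilinear.bounded_linear_left[OF bounded_bilinear_matrix_vec]
      adj2_F_partials[OF assms], of v z]
  by (simp only: bounded_bilinear.minus_left[OF bounded_bilinear_matrix_vec] matrix_vector_mul_assoc)

text \<open>
  The \<open>\<lambda>\<close>-independent quaternions cancel in the derivative of \<open>f = s\<^sub>1\<^sup>-\<^sup>1 s\<^sub>2\<close>, so \<open>s\<^sub>1 \<partial>\<^sub>x f\<close> and \<open>s\<^sub>1 \<partial>\<^sub>y f\<close> are
  \<open>(a, b) s\<^sub>2\<close> and \<open>(\<i> a, - \<i> b) s\<^sub>2\<close>, where \<open>(a, b)\<close> is the difference of the two columns of logarithmic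
  derivatives.  These are orthogonal and equally long, and \<open>(a, b) \<noteq> 0\<close> because the columns determine the
  spectral parameter up to reflection in the unit circle.
\<close>

theorem quotient_conformal:
  assumes l: "l1 \<noteq> 0" "l2 \<noteq> 0" and v: "v1 \<noteq> 0" "v2 \<noteq> 0"
    and distinct: "l2 \<noteq> l1" "l2 \<noteq> inverse (cnj l1)"
    and f: "\<And>z. f z = matrix_inv (quat (adj2 (F l1 z) *v v1)) ** quat (adj2 (F l2 z) *v v2)"
  shows "conformal_immersion f"
proof -
  define p1 p2 where "p1 z = adj2 (F l1 z) *v v1" and "p2 z = adj2 (F l2 z) *v v2" for z
  have p: "p1 z \<noteq> 0" "p2 z \<noteq> 0" for z
    using psi_nonzero l v by (simp_all add: p1_def p2_def)
  have det: "det (quat (p1 z)) \<noteq> 0" for z using p by (simp add: det_quat)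
  have smooth: "C_times k f" for k
  proof -
    have q: "C_times k (\<lambda>z. quat (p1 z))" "C_times k (\<lambda>z. quat (p2 z))" for k
      unfolding p1_def p2_def by (intro C_times_linear[OF bounded_linear_quat] psi_C_times l)+
    have "C_times k (\<lambda>z. det (quat (p1 z)))"
      unfolding det_2 by (intro C_times_rules q)
    then have "C_times k (\<lambda>z. inverse (det (quat (p1 z))))"
      by (intro C_times_inverse det)
    moreover have "mat c = mat2 c 0 0 c" for c :: complex by (intro mat2_eqI) simp_all
    ultimately have "C_times k (\<lambda>z. mat (inverse (det (quat (p1 z)))) ** adj2 (quat (p1 z)) ** quat (p2 z))"
      by (simp only:) (intro C_times_rules C_times_linear[OF bounded_linear_adj2] q)
    moreover have "f = (\<lambda>z. mat (inverse (det (quat (p1 z)))) ** adj2 (quat (p1 z)) ** quat (p2 z))"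
      by (rule ext) (simp only: f matrix_inv_2[OF det] p1_def[symmetric] p2_def[symmetric])
    ultimately show ?thesis by simp
  qed
  have range: "range f \<subseteq> quaternions"
    using quat_quotient_in_quaternions[OF p(1)] by (auto simp: f p1_def p2_def)
  have "C_times (Suc 0) f" by (rule smooth)
  \<comment> \<open>The derivatives of \<open>f\<close> are read off from the product rule for \<open>s\<^sub>1 f = s\<^sub>2\<close>.\<close>
  then obtain fx fy where fxy: "\<And>z. has_partials f (fx z) (fy z) z" by (metis C_times_SucE)
  have quotient: "quat (p1 z) ** f z = quat (p2 z)" for z
  proof -
    have "quat (p1 z) ** f z = quat (p1 z) ** (mat (inverse (det (quat (p1 z)))) ** adj2 (quat (p1 z))) ** quat (p2 z)"
      by (simp only: f matrix_inv_2[OF det] p1_def[symmetric] p2_def[symmetric] matrix_mul_assoc)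
    also have "quat (p1 z) ** (mat (inverse (det (quat (p1 z)))) ** adj2 (quat (p1 z)))
        = mat (inverse (det (quat (p1 z)))) ** (quat (p1 z) ** adj2 (quat (p1 z)))"
      by (rule mat2_eqI) (simp_all add: algebra_simps)
    also have "\<dots> = mat 1"
      unfolding adj2_right using det[of z] by (intro mat2_eqI) simp_all
    finally show ?thesis by simp
  qed
  have "\<exists>D. (f has_derivative D) (at z) \<and> inj D \<and>
        (\<exists>c>0. \<forall>u v. quat_inner (D u) (D v) = c * inner u v)" for z
  proof -
    define g where "g = inverse (complex_of_real (pot_gamma (\<zeta> z)))"
    define a where "a = g * log_a l1 (p1 z) - g * log_a l2 (p2 z)"
    define b where "b = g * log_b l1 (p1 z) - g * log_b l2 (p2 z)"
    let ?S1 = "quat (p1 z)" and ?S2 = "quat (p2 z)"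
    have g: "g \<noteq> 0" using gamma_nonzero by (simp add: g_def)
    have ab: "a \<noteq> 0 \<or> b \<noteq> 0"
    proof (rule ccontr)
      assume "\<not> (a \<noteq> 0 \<or> b \<noteq> 0)"
      then have "log_a l1 (p1 z) = log_a l2 (p2 z)" "log_b l1 (p1 z) = log_b l2 (p2 z)"
        using g by (simp_all add: a_def b_def)
      with log_derivative_determines_lambda[OF l p] distinct show False by blast
    qed
    have quat_minus: "quat (- x) = - quat x" for x by (intro mat2_eqI) simp_all
    have S: "has_partials (\<lambda>z. quat (p1 z)) (- quat (U_mat (\<zeta> z) l1 *v p1 z)) (- quat (V_mat (\<zeta> z) l1 *v p1 z)) z"
      "has_partials (\<lambda>z. quat (p2 z)) (- quat (U_mat (\<zeta> z) l2 *v p2 z)) (- quat (V_mat (\<zeta> z) l2 *v p2 z)) z"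
      using has_partials_linear[OF bounded_linear_quat psi_partials[OF l(1)]]
        has_partials_linear[OF bounded_linear_quat psi_partials[OF l(2)]]
      by (simp_all only: p1_def p2_def quat_minus)
    have "has_partials (\<lambda>z. quat (p2 z))
        (?S1 ** fx z + - quat (U_mat (\<zeta> z) l1 *v p1 z) ** f z)
        (?S1 ** fy z + - quat (V_mat (\<zeta> z) l1 *v p1 z) ** f z) z"
      using has_partials_bilinear[OF bounded_bilinear_matrix_mult S(1) fxy[of z]]
      by (simp only: quotient)
    note u = has_partials_unique[OF this S(2)]
    have fx: "?S1 ** fx z = qmat a b ** ?S2"
    proof -
      have "?S1 ** fx z = quat (U_mat (\<zeta> z) l1 *v p1 z) ** f z - quat (U_mat (\<zeta> z) l2 *v p2 z)"
        using u(1) by (simp add: mult_minus_left2 algebra_simps)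
      also have "\<dots> = (Q_U (\<zeta> z) + qmat (g * log_a l1 (p1 z)) (g * log_b l1 (p1 z))) ** (?S1 ** f z)
          - (Q_U (\<zeta> z) + qmat (g * log_a l2 (p2 z)) (g * log_b l2 (p2 z))) ** ?S2"
        by (simp only: quat_U_mat(1)[OF p(1) g_def] quat_U_mat(1)[OF p(2) g_def] matrix_mul_assoc)
      also have "\<dots> = (qmat (g * log_a l1 (p1 z)) (g * log_b l1 (p1 z))
          - qmat (g * log_a l2 (p2 z)) (g * log_b l2 (p2 z))) ** ?S2"
        by (simp add: quotient mult_add_left2 mult_diff_left2)
      also have "qmat (g * log_a l1 (p1 z)) (g * log_b l1 (p1 z))
          - qmat (g * log_a l2 (p2 z)) (g * log_b l2 (p2 z)) = qmat a b"
        by (intro mat2_eqI) (simp_all add: qmat_def a_def b_def)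
      finally show ?thesis .
    qed
    have fy: "?S1 ** fy z = qmat (\<i> * a) (- \<i> * b) ** ?S2"
    proof -
      have "?S1 ** fy z = quat (V_mat (\<zeta> z) l1 *v p1 z) ** f z - quat (V_mat (\<zeta> z) l2 *v p2 z)"
        using u(2) by (simp add: mult_minus_left2 algebra_simps)
      also have "\<dots> = (Q_V (\<zeta> z) + qmat (\<i> * (g * log_a l1 (p1 z))) (- \<i> * (g * log_b l1 (p1 z)))) ** (?S1 ** f z)
          - (Q_V (\<zeta> z) + qmat (\<i> * (g * log_a l2 (p2 z))) (- \<i> * (g * log_b l2 (p2 z)))) ** ?S2"
        by (simp only: quat_U_mat(2)[OF p(1) g_def] quat_U_mat(2)[OF p(2) g_def] matrix_mul_assoc)
      also have "\<dots> = (qmat (\<i> * (g * log_a l1 (p1 z))) (- \<i> * (g * log_b l1 (p1 z)))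
          - qmat (\<i> * (g * log_a l2 (p2 z))) (- \<i> * (g * log_b l2 (p2 z)))) ** ?S2"
        by (simp add: quotient mult_add_left2 mult_diff_left2)
      also have "qmat (\<i> * (g * log_a l1 (p1 z))) (- \<i> * (g * log_b l1 (p1 z)))
          - qmat (\<i> * (g * log_a l2 (p2 z))) (- \<i> * (g * log_b l2 (p2 z))) = qmat (\<i> * a) (- \<i> * b)"
        by (intro mat2_eqI) (simp_all add: qmat_def a_def b_def algebra_simps)
      finally show ?thesis .
    qed
    define c where "c = (norm (p2 z))\<^sup>2 / (norm (p1 z))\<^sup>2 * ((norm a)\<^sup>2 + (norm b)\<^sup>2)"
    have c: "c > 0"
      using p[of z] ab unfolding c_def
      by (intro mult_pos_pos divide_pos_pos) (auto intro: add_pos_nonneg add_nonneg_pos)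
    have inner_eq: "inner A B = (norm (p2 z))\<^sup>2 / (norm (p1 z))\<^sup>2 * inner X Y"
      if "?S1 ** A = X ** ?S2" "?S1 ** B = Y ** ?S2" for A B X Y :: "complex^2^2"
      using inner_quat_left[of "p1 z" A B] inner_quat_right[of X "p2 z" Y] p[of z]
      unfolding that by (simp add: field_simps)
    have i: "inner (fx z) (fx z) = 2 * c" "inner (fy z) (fy z) = 2 * c" "inner (fx z) (fy z) = 0"
      unfolding inner_eq[OF fx fx] inner_eq[OF fy fy] inner_eq[OF fx fy] inner_qmat
      by (simp_all add: c_def norm_mult dot_square_norm inner_complex_def)
    define D where "D h = Re h *\<^sub>R fx z + Im h *\<^sub>R fy z" for h
    have D: "(f has_derivative D) (at z)"
      using fxy[of z] by (simp add: has_partials_def D_def[abs_def])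
    have conf: "quat_inner (D u) (D v) = c * inner u v" for u v
      using i by (simp add: quat_inner_def D_def inner_add_left inner_add_right inner_complex_def
          inner_commute[of "fy z" "fx z"] algebra_simps)
    have "inj D"
    proof (rule linear_injective_0[THEN iffD2, rule_format])
      show "linear D" using D by (rule has_derivative_linear)
      fix h assume "D h = 0"
      with conf[of h h] c show "h = 0" by (simp add: quat_inner_def)
    qed
    with D conf c show ?thesis by blast
  qed
  with range smooth show ?thesis by (simp add: conformal_immersion_def smooth_map_def)
qed

end

section \<open>Eigenvectors and the marked points\<close>

lemma prod_linear_factors_dvd:
  fixes p :: "complex poly"
  assumes "finite S" "\<And>r. r \<in> S \<Longrightarrow> poly p r = 0"
  shows "(\<Prod>r\<in>S. [:- r, 1:]) dvd p"
  using assms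
proof (induction S arbitrary: p rule: finite_induct)
  case (insert s S)
  then obtain t where t: "p = (\<Prod>r\<in>S. [:- r, 1:]) * t" by (meson dvdE insertI2)
  have "poly (\<Prod>r\<in>S. [:- r, 1:]) s \<noteq> 0"
    using insert.hyps by (auto simp: poly_prod)
  then have "poly t s = 0" using insert.prems[of s] t by simp
  then have "[:- s, 1:] dvd t" by (simp add: poly_eq_0_iff_dvd)
  then have "[:- s, 1:] * (\<Prod>r\<in>S. [:- r, 1:]) dvd t * (\<Prod>r\<in>S. [:- r, 1:])"
    by (rule mult_dvd_mono) (rule dvd_refl)
  then show ?case by (simp only: prod.insert[OF insert.hyps] t mult.commute[of _ t])
qed simp

text \<open>
  Up to a scalar, \<open>\<zeta>\<close> is skew-hermitian and trace-free at \<open>r\<close>; if it is also singular, it squares to zero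
  and therefore vanishes.
\<close>

lemma potential_vanishes_at_unit_root:
  assumes P2: "\<zeta> \<in> P2" and r: "norm r = 1" and det0: "det (eval_mat \<zeta> r) = 0"
  shows "poly (\<zeta> $ i $ j) r = 0"
proof -
  let ?Z = "eval_mat \<zeta> r"
  have r0: "r \<noteq> 0" using r by auto
  have "r * cnj r = 1" using r by (simp flip: complex_norm_square)
  then have "inverse (cnj r) = r" by (metis inverse_unique mult.commute)
  then have herm: "herm ?Z = mat (- (inverse r ^ 3)) ** ?Z"
    using herm_eval_mat[OF P2 r0] by simp
  have trace: "?Z $ 2 $ 2 = - ?Z $ 1 $ 1"
    unfolding eval_mat_P2[OF P2] by simp
  have "?Z ** ?Z = mat (- det ?Z)"
    using trace by (intro mat2_eqI) (simp_all add: det_2 algebra_simps)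
  then have "?Z ** ?Z = 0" using det0 by (simp add: vec_eq_iff forall_2)
  moreover have "?Z ** herm ?Z = mat (- (inverse r ^ 3)) ** (?Z ** ?Z)"
    unfolding herm by (rule mat2_eqI) (simp_all add: algebra_simps)
  ultimately have "?Z ** herm ?Z = 0" by simp
  then have "(?Z ** herm ?Z) $ i $ i = 0" by simp
  then have "?Z $ i $ 1 * cnj (?Z $ i $ 1) + ?Z $ i $ 2 * cnj (?Z $ i $ 2) = 0" by simp
  then have "complex_of_real ((norm (?Z $ i $ 1))\<^sup>2 + (norm (?Z $ i $ 2))\<^sup>2) = 0"
    by (simp only: of_real_add complex_norm_square)
  then have "(norm (?Z $ i $ 1))\<^sup>2 + (norm (?Z $ i $ 2))\<^sup>2 = 0" by (simp only: of_real_eq_0_iff)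
  then have "?Z $ i $ 1 = 0" "?Z $ i $ 2 = 0" by (auto simp: sum_power2_eq_zero_iff)
  then show ?thesis using exhaust_2[of j] by auto
qed

lemma double_roots_on_circle:
  assumes "a \<in> M21 \<union> M22 \<union> M23"
  shows "finite (double_roots a)" "double_roots a \<subseteq> sphere 0 1"
proof -
  have "finite {x. poly a x = 0}"
    using assms by (auto simp: M21_def M22_def M23_def intro: card_ge_0_finite)
  then show "finite (double_roots a)"
    by (rule rev_finite_subset) (auto simp: double_roots_def)
  show "double_roots a \<subseteq> sphere 0 1"
  proof
    fix x assume "x \<in> double_roots a"
    then have x: "x \<in> {x. poly a x = 0}" "order x a = 2" by (auto simp: double_roots_def)
    from assms consider "a \<in> M21" | "a \<in> M22" | "a \<in> M23" by blast
    then show "x \<in> sphere 0 1"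
    proof cases
      case 1
      then show ?thesis using x by (auto simp: M21_def)
    next
      case 2
      then obtain r s t where "{x. poly a x = 0} = {r, s, t}" "r \<in> sphere 0 1"
        "order s a = 1" "order t a = 1" by (auto simp: M22_def)
      then show ?thesis using x by (metis insertE numeral_eq_one_iff semiring_norm(85) singletonD)
    next
      case 3
      then obtain r s where "{x. poly a x = 0} = {r, s}" "r \<in> sphere 0 1" "s \<in> sphere 0 1"
        by (auto simp: M23_def)
      then show ?thesis using x by auto
    qed
  qed
qed

text \<open>
  The double roots of \<open>a\<close> lie on the unit circle, so \<open>q\<close> divides every potential in \<open>I(a)\<close>, and
  eigenvectors of \<open>\<zeta> / q\<close> are eigenvectors of \<open>\<zeta>\<close>.
\<close>

lemma eigenvector_of_divided:
  assumes a: "a \<in> M21 \<union> M22 \<union> M23" and I: "\<zeta> \<in> I_set a"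
    and eig: "eval_mat (divided \<zeta> (q_poly a)) (fst p) *v v = snd p *s v"
  shows "eval_mat \<zeta> (fst p) *v v = snd (normalization_map a p) *s v"
proof -
  have "\<zeta> \<in> P2" and det: "det \<zeta> = [:0, 1:] * a" using I by (auto simp: I_set_def)
  have "q_poly a dvd \<zeta> $ i $ j" for i j
    unfolding q_poly_def
  proof (rule prod_linear_factors_dvd[OF double_roots_on_circle(1)[OF a]])
    fix r assume r: "r \<in> double_roots a"
    show "poly (\<zeta> $ i $ j) r = 0"
    proof (rule potential_vanishes_at_unit_root[OF \<open>\<zeta> \<in> P2\<close>])
      show "norm r = 1" using r double_roots_on_circle(2)[OF a] by auto
      show "det (eval_mat \<zeta> r) = 0" using r by (simp add: det_eval_mat det double_roots_def)
    qed
  qed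
  then have "poly (\<zeta> $ i $ j) l = poly (q_poly a) l * poly (\<zeta> $ i $ j div q_poly a) l" for i j l
    by (metis dvd_mult_div_cancel poly_mult)
  then have "eval_mat \<zeta> (fst p) *v v
      = poly (q_poly a) (fst p) *s (eval_mat (divided \<zeta> (q_poly a)) (fst p) *v v)"
    by (intro vec2_eqI) (simp_all add: divided_def algebra_simps)
  then show ?thesis
    unfolding eig by (simp add: normalization_map_def case_prod_beta vector_smult_assoc)
qed

lemma M2_nonzero_at_zero: "a \<in> M2 \<Longrightarrow> poly a 0 \<noteq> 0"
  using poly_at_zero by (fastforce simp: M2_def)

text \<open>
  This is where the three strata are distinguished: the four simple roots are different and stable
  under reflection; a double root is fixed by the reflection whereas the simple roots are different
  from it; two double roots are both fixed.
\<close>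

lemma marked_points_lambda:
  assumes a: "a \<in> M21 \<union> M22 \<union> M23" and marked: "marked_points a p1 p2 p3 p4"
  shows "fst p1 \<noteq> 0" "fst p2 \<noteq> 0" "fst p2 \<noteq> fst p1" "fst p2 \<noteq> inverse (cnj (fst p1))"
proof -
  have p3: "fst p3 = inverse (cnj (fst p1))" and p4: "fst p4 = inverse (cnj (fst p2))"
    using marked by (auto simp: marked_points_def eta_lift_def case_prod_beta)
  have strata:
    "a \<in> M21 \<longrightarrow> {p1, p2, p3, p4} = {p \<in> normalization a. poly a (fst p) = 0}"
    "a \<in> M22 \<longrightarrow> {p1, p3} = {p \<in> normalization a. order (fst p) a = 2} \<and>
        {p2, p4} = {p \<in> normalization a. order (fst p) a = 1}"
    "a \<in> M23 \<longrightarrow> (\<exists>r s. r \<noteq> s \<and> double_roots a = {r, s} \<and>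
        {p1, p3} = {p \<in> normalization a. fst p = r} \<and>
        {p2, p4} = {p \<in> normalization a. fst p = s})"
    using marked unfolding marked_points_def by - (elim conjE; assumption)+
  have unit: "inverse (cnj x) = x" if "x \<in> sphere 0 1" for x :: complex
  proof -
    have "x * cnj x = 1" using that by (simp flip: complex_norm_square)
    then show ?thesis by (metis inverse_unique mult.commute)
  qed
  have "p1 \<in> normalization a \<and> p2 \<in> normalization a \<and>
      fst p2 \<noteq> fst p1 \<and> fst p2 \<noteq> inverse (cnj (fst p1))"
  proof -
    from a consider (1) "a \<in> M21" | (2) "a \<in> M22" | (3) "a \<in> M23" by blast
    then show ?thesis
    proof cases
      case 1
      with strata(1) have eq: "{p1, p2, p3, p4} = {p \<in> normalization a. poly a (fst p) = 0}"
        by (rule mp)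
      have M21: "a \<in> M2" "card {x. poly a x = 0} = 4" "\<And>x. poly a x = 0 \<Longrightarrow> order x a = 1"
        using 1 by (auto simp: M21_def)
      have "double_roots a = {}" using M21(3) by (auto simp: double_roots_def)
      then have q: "q_poly a = 1" by (simp add: q_poly_def)
      have "{x. poly a x = 0} \<subseteq> fst ` {p1, p2, p3, p4}"
      proof
        fix x assume x: "x \<in> {x. poly a x = 0}"
        then have "x \<noteq> 0" using M2_nonzero_at_zero[OF M21(1)] by auto
        then have "(x, 0) \<in> {p \<in> normalization a. poly a (fst p) = 0}"
          using x by (simp add: normalization_def q)
        then show "x \<in> fst ` {p1, p2, p3, p4}" unfolding eq by force
      qed
      then have "card {x. poly a x = 0} \<le> card (fst ` {p1, p2, p3, p4})"
        by (intro card_mono) auto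
      then have "4 \<le> card {fst p1, fst p2, fst p3, fst p4}" by (simp add: M21(2))
      then have "fst p2 \<noteq> fst p1" "fst p2 \<noteq> fst p3"
        by (auto simp: card_insert_if split: if_splits)
      moreover have "p1 \<in> {p1, p2, p3, p4}" "p2 \<in> {p1, p2, p3, p4}" by simp_all
      then have "p1 \<in> normalization a" "p2 \<in> normalization a" unfolding eq by simp_all
      ultimately show ?thesis by (simp add: p3)
    next
      case 2
      note eq = strata(2)[rule_format, OF 2, THEN conjunct1] strata(2)[rule_format, OF 2, THEN conjunct2]
      have "p1 \<in> {p1, p3}" "p2 \<in> {p2, p4}" by simp_all
      then have p: "p1 \<in> normalization a" "order (fst p1) a = 2"
        "p2 \<in> normalization a" "order (fst p2) a = 1"
        unfolding eq by simp_all
      then have "poly a (fst p1) = 0" using order_root[of a "fst p1"] by auto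
      then have "fst p1 \<in> double_roots a" using p by (simp add: double_roots_def)
      then have "inverse (cnj (fst p1)) = fst p1"
        using double_roots_on_circle(2)[OF a] by (intro unit) auto
      moreover have "fst p2 \<noteq> fst p1" using p(2,4) by auto
      ultimately show ?thesis using p by simp
    next
      case 3
      then obtain r s where rs: "r \<noteq> s" "double_roots a = {r, s}"
        and eq: "{p1, p3} = {p \<in> normalization a. fst p = r}" "{p2, p4} = {p \<in> normalization a. fst p = s}"
        using strata(3) by (elim impE exE conjE) auto
      have "p1 \<in> {p1, p3}" "p2 \<in> {p2, p4}" by simp_all
      then have p: "p1 \<in> normalization a" "fst p1 = r" "p2 \<in> normalization a" "fst p2 = s"
        unfolding eq by simp_all
      moreover have "inverse (cnj r) = r"
        using double_roots_on_circle(2)[OF a] rs by (intro unit) auto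
      ultimately show ?thesis using rs by auto
    qed
  qed
  then show "fst p1 \<noteq> 0" "fst p2 \<noteq> 0" "fst p2 \<noteq> fst p1" "fst p2 \<noteq> inverse (cnj (fst p1))"
    by (auto simp: normalization_def)
qed

lemma matrix_inv_uminus: "det A \<noteq> 0 \<Longrightarrow> matrix_inv (- A) = - matrix_inv (A :: complex^2^2)"
  using matrix_inv_2[of A] matrix_inv_2[of "- A"]
  by (simp add: det_2 vec_eq_iff forall_2)

text \<open>
  Over a period, \<open>\<psi>\<^sub>1\<close> and \<open>\<psi>\<^sub>2\<close> are multiplied by opposite signs; the undetermined sign of
  \<open>frame_over_period\<close> is common to both and cancels in the quotient.
\<close>

lemma (in framed_flow) antiperiodic:
  assumes I: "\<zeta>0 \<in> I_set a" and mu: "is_mu a \<omega> \<mu>"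
    and l: "l1 \<noteq> 0" "l2 \<noteq> 0" and v: "v1 \<noteq> 0" "v2 \<noteq> 0"
    and eig: "eval_mat \<zeta>0 l1 *v v1 = n1 *s v1" "eval_mat \<zeta>0 l2 *v v2 = n2 *s v2"
    and sign: "\<mu> (l1, n1) \<in> {1, - 1}" "\<mu> (l2, n2) = - \<mu> (l1, n1)"
    and f: "\<And>z. f z = matrix_inv (quat (adj2 (F l1 z) *v v1)) ** quat (adj2 (F l2 z) *v v2)"
  shows "f (z + \<omega>) = - f z"
proof -
  define p1 p2 where "p1 z = adj2 (F l1 z) *v v1" and "p2 z = adj2 (F l2 z) *v v2" for z
  have det: "det (quat (p1 z)) \<noteq> 0" for z
    using psi_nonzero[OF l(1) v(1)] by (simp add: det_quat p1_def)
  have quat_minus: "quat (- x) = - quat x" for x by (intro mat2_eqI) simp_all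
  have f': "f z = matrix_inv (quat (p1 z)) ** quat (p2 z)" for z
    by (simp only: f p1_def p2_def)
  obtain e where e: "e \<in> {1, - 1}"
    "\<mu> (l1, n1) *s p1 (z + \<omega>) = e *s p1 z" "\<mu> (l2, n2) *s p2 (z + \<omega>) = e *s p2 z"
    using frame_over_period[OF I mu, of z] l v eig unfolding p1_def p2_def by blast
  have neg: "(- 1) *s x = - x" for x :: "complex^2" by (simp add: vec_eq_iff)
  have "p1 (z + \<omega>) = p1 z \<and> p2 (z + \<omega>) = - p2 z \<or> p1 (z + \<omega>) = - p1 z \<and> p2 (z + \<omega>) = p2 z"
    using e sign by (auto simp: neg minus_equation_iff[of "p1 (z + \<omega>)"] minus_equation_iff[of "p2 (z + \<omega>)"])
  then show ?thesis
    by (elim disjE conjE) (simp_all add: f' quat_minus matrix_inv_uminus[OF det] mult_minus_left2 mult_minus_right2)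
qed

lemma periodic_int_multiple:
  fixes f :: "complex \<Rightarrow> 'a"
  assumes "\<And>z. f (z + u) = f z"
  shows "f (z + of_int m * u) = f z"
proof (induction m rule: int_induct[where k = 0])
  case (step1 i)
  then show ?case using assms[of "z + of_int i * u"] by (simp add: algebra_simps)
next
  case (step2 i)
  then show ?case using assms[of "z + of_int (i - 1) * u"] by (simp add: algebra_simps)
qed simp

lemma descends_to_quotient:
  assumes "\<And>z w. w \<in> \<Gamma> \<Longrightarrow> f (z + w) = f z" "0 \<in> \<Gamma>"
  obtains \<phi> where "\<And>z. \<phi> (quotient_proj \<Gamma> z) = f z"
proof
  fix z
  define w where "w = (SOME w. quotient_proj \<Gamma> w = quotient_proj \<Gamma> z)"
  have "quotient_proj \<Gamma> w = quotient_proj \<Gamma> z" unfolding w_def by (rule someI) (rule refl)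
  moreover have "w \<in> quotient_proj \<Gamma> w" using assms(2) by (simp add: quotient_proj_def)
  ultimately have "w - z \<in> \<Gamma>" by (simp add: quotient_proj_def)
  from assms(1)[OF this, of z] show "f (SOME w. quotient_proj \<Gamma> w = quotient_proj \<Gamma> z) = f z"
    by (simp add: w_def)
qed

theorem theorem5p6:
  fixes a :: "complex poly"
    and p1 p2 p3 p4 :: "complex \<times> complex"
    and \<Gamma> :: "complex set"
    and f :: "complex \<Rightarrow> complex^2^2"
  assumes "a \<in> M21 \<union> M22 \<union> M23"
    and "marked_points a p1 p2 p3 p4"
    and "is_hat_lattice a p1 p2 p3 p4 \<Gamma>"
    and "is_f_map a p1 p2 f"
  shows "\<exists>\<phi>. (\<forall>z. \<phi> (quotient_proj \<Gamma> z) = f z) \<and> conformal_immersion_quotient \<Gamma> \<phi>"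
proof -
  note lambda = marked_points_lambda[OF assms(1,2)]
  obtain \<zeta>0 \<zeta> F v1 v2 where I: "\<zeta>0 \<in> I_set a" and "is_flow \<zeta>0 \<zeta>" "is_frame \<zeta> F"
    and v: "v1 \<noteq> 0" "v2 \<noteq> 0"
    and "eval_mat (divided \<zeta>0 (q_poly a)) (fst p1) *v v1 = snd p1 *s v1"
      "eval_mat (divided \<zeta>0 (q_poly a)) (fst p2) *v v2 = snd p2 *s v2"
    and f0: "\<And>z. f z = matrix_inv (quat (matrix_inv (F (fst p1) z) *v v1)) **
                    quat (matrix_inv (F (fst p2) z) *v v2)"
    using assms(4) by (auto simp: is_f_map_def)
  then have eig: "eval_mat \<zeta>0 (fst p1) *v v1 = snd (normalization_map a p1) *s v1"
    "eval_mat \<zeta>0 (fst p2) *v v2 = snd (normalization_map a p2) *s v2"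
    using eigenvector_of_divided[OF assms(1) I] by blast+
  interpret framed_flow \<zeta>0 \<zeta> F by unfold_locales fact+
  have f: "f z = matrix_inv (quat (adj2 (F (fst p1) z) *v v1)) ** quat (adj2 (F (fst p2) z) *v v2)" for z
    by (simp only: f0 matrix_inv_unimodular[OF det_F] lambda(1,2) not_False_eq_True)
  have conformal: "conformal_immersion f"
    by (rule quotient_conformal[OF lambda(1,2) v lambda(3,4) f])
  obtain \<omega>1 \<omega>2 \<mu>1 \<mu>2 where mu: "is_mu a \<omega>1 \<mu>1" "is_mu a \<omega>2 \<mu>2"
    and vals: "\<mu>1 (normalization_map a p1) = - 1" "\<mu>2 (normalization_map a p1) = 1"
      "\<mu>1 (normalization_map a p2) = 1" "\<mu>2 (normalization_map a p2) = - 1"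
    and \<Gamma>: "\<Gamma> = int_span (\<omega>1 + \<omega>2) (\<omega>2 - \<omega>1)"
    using assms(3) by (auto simp: is_hat_lattice_def)
  have nm: "(fst p, snd (normalization_map a p)) = normalization_map a p" for p
    by (simp add: normalization_map_def case_prod_beta)
  have anti: "f (z + \<omega>1) = - f z" "f (z + \<omega>2) = - f z" for z
    using antiperiodic[OF I mu(1) lambda(1,2) v eig _ _ f] antiperiodic[OF I mu(2) lambda(1,2) v eig _ _ f]
    by (simp_all add: nm vals)
  have period1: "f (z + (\<omega>1 + \<omega>2)) = f z" for z
    using anti(1)[of z] anti(2)[of "z + \<omega>1"] by (simp add: add.assoc)
  have period2: "f (z + (\<omega>2 - \<omega>1)) = f z" for z
    using anti(1)[of "z + (\<omega>2 - \<omega>1)"] anti(2)[of z] by (simp add: algebra_simps)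
  have period: "f (z + w) = f z" if mem: "w \<in> \<Gamma>" for z w
  proof -
    obtain m n :: int where w: "w = of_int m * (\<omega>1 + \<omega>2) + of_int n * (\<omega>2 - \<omega>1)"
      using mem unfolding \<Gamma> int_span_def by blast
    show ?thesis
      unfolding w add.assoc[symmetric]
      by (simp only: periodic_int_multiple[where f = f, OF period1]
          periodic_int_multiple[where f = f, OF period2])
  qed
  have "0 \<in> \<Gamma>"
    by (auto simp: \<Gamma> int_span_def intro!: exI[of _ 0])
  then obtain \<phi> where \<phi>: "\<And>z. \<phi> (quotient_proj \<Gamma> z) = f z"
    using descends_to_quotient[OF period] by blast
  then have "\<phi> \<circ> quotient_proj \<Gamma> = f" by auto
  then show ?thesis
    using \<phi> conformal by (auto simp: conformal_immersion_quotient_def)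
qed

end
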